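(* Let $b\ge 2$ be an integer, let $\alpha,\lambda>0$, let $X$ be a symmetric real random variable with $\mathbb{E}[X]=0$, $\mathbb{E}[X^2]=1$ and $\lim_{x\to\infty}x^{-\alpha}\log\mathbb{P}(X>x)=-\lambda$, and let $A\subset\mathbb{R}$, $A\notin\{\emptyset,\mathbb{R}\}$, be a finite union of $r_A\ge1$ pairwise disjoint intervals with endpoints $-\infty\le a_j<b_j\le\infty$. With $\overline Z_n$, $\nu$, $M_A$, $Q_A$ and $Q_A(p+)$ as in the context, for every $p\in(\nu(A),M_A)$, $$-Q_A(p+)\le\liminf_{n\to\infty}n^{-\alpha/2}\log\mathbb{P}\big(\overline Z_n(\sqrt n\,A)\ge p\big)\le\limsup_{n\to\infty}n^{-\alpha/2}\log\mathbb{P}\big(\overline Z_n(\sqrt n\,A)\ge p\big)\le-Q_A(p).$$ Consequently, if $Q_A(p+)=Q_A(p)$, then $$\lim_{n\to\infty}n^{-\alpha/2}\log\mathbb{P}\big(\overline Z_n(\sqrt n\,A)\ge p\big)=-Q_A(p).$$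
   Context: Branching random walk: $\mathbb{T}_b=\bigcup_{k\ge0}\{1,\dots,b\}^k$ is the rooted $b$-ary tree with root $\varnothing$; $|v|$ is the generation (length) of $v$; $v\preceq u$ means $v$ is an ancestor of $u$ or $v=u$ (prefix order), $v\prec u$ means strict ancestor. $(X_v)_{v\ne\varnothing}$ are i.i.d. copies of $X$; $S_\varnothing=0$, $S_u=\sum_{\varnothing\prec v\preceq u}X_v$; $Z_n=\sum_{|u|=n}\delta_{S_u}$ and $\overline Z_n=Z_n/Z_n(\mathbb{R})=b^{-n}Z_n$. $\sqrt n\,A=\{\sqrt n\,a:a\in A\}$. $\nu$ is the standard Gaussian measure on $\mathbb{R}$, $g_A(x)=\nu(A-x)$ with $A-x=\{a-x:a\in A\}$, and $M_A=\sup_{x\in\mathbb{R}}g_A(x)$. Tree space: $\mathcal{H}_b$ is the set of real fields $h=(h_v)_{v\in\mathbb{T}_b}$ with $h_\varnothing=0$ and $\|h\|_b:=\sum_{k\ge1}b^{-k}\sum_{|v|=k}|h_v|<\infty$. $\partial\mathbb{T}_b=\{1,\dots,b\}^{\{1,2,\dots\}}$ carries the product $\sigma$-algebra and the product measure $\mathbf{m}_b$ of uniform measures on $\{1,\dots,b\}$; $\xi|k$ is the vector of the first $k$ coordinates of $\xi$. For $h\in\mathcal{H}_b$, $H_h(\xi)=\sum_{k\ge1}h_{\xi|k}$ (absolutely convergent for $\mathbf{m}_b$-a.e. $\xi$), $\Psi_A(h)=\int_{\partial\mathbb{T}_b}g_A(H_h(\xi))\,\mathbf{m}_b(d\xi)$,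 and $\mathcal{I}_\alpha(h)=\lambda\sum_{v\ne\varnothing}|h_v|^\alpha\in[0,\infty]$. Rate function: $Q_A(q)=\inf\{\mathcal{I}_\alpha(h):h\in\mathcal{H}_b,\ \Psi_A(h)=q\}$ for $q\in[0,1]$, with $\inf\emptyset=\infty$. $Q_A$ is strictly increasing on $[\nu(A),M_A)$, and for $p\in(\nu(A),M_A)$, $Q_A(p+):=\lim_{q\downarrow p}Q_A(q)$. Convention: $\log 0=-\infty$. *)

theory Defs
  imports "HOL-Probability.Probability" "HOL-Library.Sublist"
begin

section \<open>The rooted \<open>b\<close>-ary tree and the branching random walk\<close>

definition tree :: "nat \<Rightarrow> nat list set" where
  "tree b = {v. set v \<subseteq> {1..b}}"

definition generation :: "nat \<Rightarrow> nat \<Rightarrow> nat list set" where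
  "generation b n = {v \<in> tree b. length v = n}"

definition iid_copies ::
  "'w measure \<Rightarrow> 'i set \<Rightarrow> ('i \<Rightarrow> 'w \<Rightarrow> real) \<Rightarrow> 'v measure \<Rightarrow> ('v \<Rightarrow> real) \<Rightarrow> bool" where
  "iid_copies M I Y N X \<longleftrightarrow>
     prob_space.indep_vars M (\<lambda>_. borel) Y I \<and>
     (\<forall>i\<in>I. distr M borel (Y i) = distr N borel X)"

definition walk :: "(nat list \<Rightarrow> 'w \<Rightarrow> real) \<Rightarrow> nat list \<Rightarrow> 'w \<Rightarrow> real" where
  "walk Y u w = (\<Sum>v | strict_prefix [] v \<and> prefix v u. Y v w)"

text \<open>The value on \<open>B\<close> of the sum over generation \<open>n\<close> of the Dirac masses at the positions.\<close>

definition brw_count ::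
  "nat \<Rightarrow> (nat list \<Rightarrow> 'w \<Rightarrow> real) \<Rightarrow> nat \<Rightarrow> 'w \<Rightarrow> real set \<Rightarrow> real" where
  "brw_count b Y n w B = (\<Sum>u\<in>generation b n. indicator B (walk Y u w))"

definition brw_empirical ::
  "nat \<Rightarrow> (nat list \<Rightarrow> 'w \<Rightarrow> real) \<Rightarrow> nat \<Rightarrow> 'w \<Rightarrow> real set \<Rightarrow> real" where
  "brw_empirical b Y n w B = brw_count b Y n w B / brw_count b Y n w UNIV"


section \<open>Intervals and Gaussian mass\<close>

definition interval_with_endpoints :: "ereal \<Rightarrow> ereal \<Rightarrow> real set \<Rightarrow> bool" where
  "interval_with_endpoints l r J \<longleftrightarrow>
     J = ereal -` {l<..<r} \<or> J = ereal -` {l..<r} \<or> J = ereal -` {l<..r} \<or> J = ereal -` {l..r}"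

definition disjoint_interval_union :: "nat \<Rightarrow> real set \<Rightarrow> bool" where
  "disjoint_interval_union k A \<longleftrightarrow>
     (\<exists>l r J. (\<forall>j<k. l j < r j \<and> interval_with_endpoints (l j) (r j) (J j)) \<and>
        disjoint_family_on J {..<k} \<and> A = (\<Union>j<k. J j))"

definition gauss_shift :: "real set \<Rightarrow> real \<Rightarrow> real" where
  "gauss_shift A x = measure std_normal_distribution ((\<lambda>a. a - x) ` A)"

definition gauss_max :: "real set \<Rightarrow> real" where
  "gauss_max A = (SUP x. gauss_shift A x)"


section \<open>Tree space\<close>

definition tree_norm :: "nat \<Rightarrow> (nat list \<Rightarrow> real) \<Rightarrow> ennreal" where
  "tree_norm b h = (\<Sum>k. ennreal ((\<Sum>v\<in>generation b (Suc k). \<bar>h v\<bar>) / real b ^ Suc k))"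

text \<open>Fields are total functions on lists; their values off \<^term>\<open>tree b\<close> are irrelevant to
  all functionals below.\<close>

definition tree_space :: "nat \<Rightarrow> (nat list \<Rightarrow> real) set" where
  "tree_space b = {h. h [] = 0 \<and> tree_norm b h < \<infinity>}"

definition boundary_measure :: "nat \<Rightarrow> (nat \<Rightarrow> nat) measure" where
  "boundary_measure b = (\<Pi>\<^sub>M i\<in>{1::nat..}. uniform_count_measure {1..b})"

definition ray_prefix :: "(nat \<Rightarrow> nat) \<Rightarrow> nat \<Rightarrow> nat list" where
  "ray_prefix \<xi> k = map \<xi> [1..<Suc k]"

text \<open>The series may diverge on a null set of rays, where its value is unspecified.\<close>

definition ray_sum :: "(nat list \<Rightarrow> real) \<Rightarrow> (nat \<Rightarrow> nat) \<Rightarrow> real" where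
  "ray_sum h \<xi> = (\<Sum>k. h (ray_prefix \<xi> (Suc k)))"

definition tree_mass :: "nat \<Rightarrow> real set \<Rightarrow> (nat list \<Rightarrow> real) \<Rightarrow> real" where
  "tree_mass b A h = (LINT \<xi>|boundary_measure b. gauss_shift A (ray_sum h \<xi>))"

definition tree_cost :: "nat \<Rightarrow> real \<Rightarrow> real \<Rightarrow> (nat list \<Rightarrow> real) \<Rightarrow> ennreal" where
  "tree_cost b \<alpha> lam h =
     ennreal lam * (\<Sum>\<^sub>\<infinity>v\<in>tree b - {[]}. ennreal (\<bar>h v\<bar> powr \<alpha>))"


section \<open>Rate function\<close>

definition rate :: "nat \<Rightarrow> real \<Rightarrow> real \<Rightarrow> real set \<Rightarrow> real \<Rightarrow> ereal" where
  "rate b \<alpha> lam A q =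
     (INF h \<in> {h \<in> tree_space b. tree_mass b A h = q}. enn2ereal (tree_cost b \<alpha> lam h))"

definition rate_right :: "nat \<Rightarrow> real \<Rightarrow> real \<Rightarrow> real set \<Rightarrow> real \<Rightarrow> ereal" where
  "rate_right b \<alpha> lam A p = Lim (at_right p) (rate b \<alpha> lam A)"

text \<open>The real \<^const>\<open>ln\<close> satisfies \<open>ln 0 = 0\<close>; here the logarithm of \<open>0\<close> is \<open>-\<infinity>\<close>.\<close>

definition log_prob :: "real \<Rightarrow> ereal" where
  "log_prob x = (if x = 0 then -\<infinity> else ereal (ln x))"

end

theory Submission
  imports Defs "HOL-Real_Asymp.Real_Asymp"
begin

text \<open>Rescale displacements by \<open>sqrt n\<close> and work at speed \<open>n^(\<alpha>/2)\<close>. Two facts reduce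
  the problem to finitely many generations, up to probabilities \<open>exp (- L n^(\<alpha>/2))\<close> with \<open>L\<close>
  arbitrarily large. First, if \<open>m\<close> is a large multiple of \<open>log n\<close>, then given the first \<open>m\<close>
  generations the empirical mass is an average of \<open>b^m\<close> independent variables, whose conditional
  means are Gaussian masses by the central limit theorem, so Hoeffding's inequality applies.
  Second, by a Chernoff bound for \<open>\<Sum>\<bar>Y\<bar>^\<alpha>\<close>, the generations between a fixed large \<open>K\<close>
  and \<open>m\<close> move only a small part of the mass, since doing so requires a positive fraction of the
  \<open>b^k\<close> displacements of some generation \<open>k\<close> to be of order \<open>sqrt n\<close>.

  The upper bound then follows from the same Chernoff bound on the first \<open>K\<close> generations and
  lower semicontinuity of the cost on a compact set of fields; the lower bound from forcing the
  displacements of the first \<open>K\<close> generations to follow a nearly optimal field of mass greater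
  than \<open>p\<close>.\<close>

section \<open>Paths and generations\<close>

text \<open>The bounds differ by \<open>rate_right\<close> against \<open>rate\<close> because every
  approximation loses some \<epsilon> of mass. In the upper bound compactness recovers the loss: a
  cost below the rate at \<open>p\<close> already forces the mass below
  \<open>p - \<epsilon>\<close>. In the lower bound it is paid in advance, by a field of mass
  strictly above \<open>p\<close>. Both rely on scaling a field down to zero, which makes the rate
  monotone above the Gaussian mass. The obstacle is the entropy of deep generations: a Chernoff
  bound over b^k vertices carries a prefactor C^(b^k). Moving a mass e in generation k costs at
  least of order e^(1+\<alpha>) b^k n^(\<alpha>/2), with e for the fraction of vertices and
  e^\<alpha> for their displacements. Budgets e = k^(-2) are summable, and the cost they leave still
  grows with k and beats the entropy for k up to order log n. Convexity of x^\<alpha>, which fails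
  for \<alpha> < 1, is avoided throughout. That A is a finite union of intervals makes the Gaussian
  mass Lipschitz and reduces convergence to distribution functions.\<close>

definition path_sum :: "(nat list \<Rightarrow> real) \<Rightarrow> nat list \<Rightarrow> real" where
  "path_sum f u = (\<Sum>v | strict_prefix [] v \<and> prefix v u. f v)"

definition gen_avg :: "nat \<Rightarrow> nat \<Rightarrow> (nat list \<Rightarrow> real) \<Rightarrow> real" where
  "gen_avg b k f = (\<Sum>v\<in>generation b k. f v) / real b ^ k"

text \<open>The root is left out because no displacement is attached to it.\<close>

definition levels :: "nat \<Rightarrow> nat \<Rightarrow> nat list set" where
  "levels b K = {v \<in> tree b. v \<noteq> [] \<and> length v \<le> K}"

lemma walk_eq_path_sum: "walk Y u w = path_sum (\<lambda>v. Y v w) u"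
  by (simp add: walk_def path_sum_def)

lemma path_sum_Nil [simp]: "path_sum f [] = 0"
proof -
  have *: "{v. strict_prefix [] v \<and> prefix v []} = ({} :: nat list set)" by auto
  show ?thesis unfolding path_sum_def * by simp
qed

lemma finite_prefixes: "finite {v. strict_prefix [] v \<and> prefix v u}"
  by (rule finite_subset[of _ "set (prefixes u)"]) auto

lemma path_sum_snoc: "path_sum f (u @ [i]) = path_sum f u + f (u @ [i])"
proof -
  have "{v. strict_prefix [] v \<and> prefix v (u @ [i])} =
      insert (u @ [i]) {v. strict_prefix [] v \<and> prefix v u}"
    by (auto simp: strict_prefix_def)
  moreover have "u @ [i] \<notin> {v. strict_prefix [] v \<and> prefix v u}"
    by (auto dest: prefix_length_le)
  ultimately show ?thesis
    using finite_prefixes[of u] by (simp add: path_sum_def)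
qed

lemma path_sum_append: "path_sum f (v @ w) = path_sum f v + path_sum (\<lambda>z. f (v @ z)) w"
proof (induction w rule: rev_induct)
  case (snoc i w)
  show ?case
    using snoc path_sum_snoc[of f "v @ w" i] path_sum_snoc[of "\<lambda>z. f (v @ z)" w i] by simp
qed simp

lemma path_sum_cmult: "path_sum (\<lambda>v. c * f v) u = c * path_sum f u"
  by (simp add: path_sum_def sum_distrib_left)

lemma path_sum_diff: "path_sum (\<lambda>v. f v - g v) u = path_sum f u - path_sum g u"
  by (simp add: path_sum_def sum_subtractf)

lemma path_sum_cong:
  assumes "\<And>v. v \<noteq> [] \<Longrightarrow> prefix v u \<Longrightarrow> f v = g v"
  shows "path_sum f u = path_sum g u"
  unfolding path_sum_def using assms by (intro sum.cong) auto

lemma card_path: "card {v. strict_prefix [] v \<and> prefix v u} = length u"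
proof (induction u rule: rev_induct)
  case Nil
  have *: "{v. strict_prefix [] v \<and> prefix v []} = ({} :: nat list set)" by auto
  show ?case unfolding * by simp
next
  case (snoc i u)
  have "{v. strict_prefix [] v \<and> prefix v (u @ [i])} =
      insert (u @ [i]) {v. strict_prefix [] v \<and> prefix v u}"
    by (auto simp: strict_prefix_def)
  moreover have "u @ [i] \<notin> {v. strict_prefix [] v \<and> prefix v u}"
    by (auto dest: prefix_length_le)
  ultimately show ?case
    using finite_prefixes[of u] snoc by simp
qed

lemma abs_path_sum_le:
  assumes "\<And>v. v \<noteq> [] \<Longrightarrow> prefix v u \<Longrightarrow> \<bar>f v\<bar> \<le> c"
  shows "\<bar>path_sum f u\<bar> \<le> real (length u) * c"
proof -
  have "\<bar>path_sum f u\<bar> \<le> (\<Sum>v | strict_prefix [] v \<and> prefix v u. \<bar>f v\<bar>)"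
    unfolding path_sum_def by (rule sum_abs)
  also have "\<dots> \<le> (\<Sum>v | strict_prefix [] v \<and> prefix v u. c)"
    by (intro sum_mono assms) auto
  finally show ?thesis by (simp add: card_path)
qed

lemma tree_append_iff: "v @ w \<in> tree b \<longleftrightarrow> v \<in> tree b \<and> w \<in> tree b"
  by (auto simp: tree_def)

lemma prefix_in_tree: "u \<in> tree b \<Longrightarrow> prefix v u \<Longrightarrow> v \<in> tree b"
  by (auto simp: tree_def dest: set_mono_prefix)

lemma generation_0 [simp]: "generation b 0 = {[]}"
  by (auto simp: generation_def tree_def)

lemma generation_eq: "generation b k = {v. set v \<subseteq> {1..b} \<and> length v = k}"
  by (auto simp: generation_def tree_def)

lemma finite_generation [simp, intro]: "finite (generation b k)"
  unfolding generation_eq by (rule finite_lists_length_eq) simp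

lemma card_generation: "card (generation b k) = b ^ k"
  unfolding generation_eq by (subst card_lists_length_eq) auto

lemma levels_eq: "levels b K = (\<Union>k\<in>{1..K}. generation b k)"
  by (auto simp: levels_def generation_def Suc_le_eq)

lemma finite_levels [simp, intro]: "finite (levels b K)"
  by (simp add: levels_eq)

lemma levels_subset: "levels b K \<subseteq> tree b - {[]}"
  by (auto simp: levels_def)

lemma generation_subset: "k \<ge> 1 \<Longrightarrow> generation b k \<subseteq> tree b - {[]}"
  by (auto simp: generation_def)

lemma prefix_in_levels: "u \<in> generation b K \<Longrightarrow> prefix v u \<Longrightarrow> v \<noteq> [] \<Longrightarrow> v \<in> levels b K"
  by (auto simp: generation_def levels_def intro: prefix_in_tree dest: prefix_length_le)

lemma sum_generation_add:
  fixes f :: "nat list \<Rightarrow> 'a::comm_monoid_add"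
  shows "(\<Sum>u\<in>generation b (m + k). f u) = (\<Sum>v\<in>generation b m. \<Sum>w\<in>generation b k. f (v @ w))"
proof -
  have "(\<Sum>v\<in>generation b m. \<Sum>w\<in>generation b k. f (v @ w)) =
      (\<Sum>(v, w)\<in>generation b m \<times> generation b k. f (v @ w))"
    by (rule sum.cartesian_product)
  also have "\<dots> = (\<Sum>u\<in>generation b (m + k). f u)"
    by (rule sum.reindex_bij_witness[of _ "\<lambda>u. (take m u, drop m u)" "\<lambda>(v, w). v @ w"])
      (auto simp: generation_eq dest: in_set_takeD in_set_dropD)
  finally show ?thesis ..
qed

lemma generation_1: "generation b (Suc 0) = (\<lambda>i. [i]) ` {1..b}"
  by (auto simp: generation_eq length_Suc_conv)

lemma sum_generation_Suc:
  fixes f :: "nat list \<Rightarrow> 'a::comm_monoid_add"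
  shows "(\<Sum>u\<in>generation b (Suc k). f u) = (\<Sum>v\<in>generation b k. \<Sum>i\<in>{1..b}. f (v @ [i]))"
proof -
  have "(\<Sum>w\<in>generation b (Suc 0). f (v @ w)) = (\<Sum>i\<in>{1..b}. f (v @ [i]))" for v
    unfolding generation_1 by (subst sum.reindex) (auto simp: inj_on_def)
  then show ?thesis using sum_generation_add[of f b k 1] by simp
qed

lemma gen_avg_mono:
  "(\<And>v. v \<in> generation b k \<Longrightarrow> f v \<le> g v) \<Longrightarrow> gen_avg b k f \<le> gen_avg b k g"
  by (auto simp: gen_avg_def intro!: divide_right_mono sum_mono)

lemma gen_avg_cong:
  "(\<And>v. v \<in> generation b k \<Longrightarrow> f v = g v) \<Longrightarrow> gen_avg b k f = gen_avg b k g"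
  by (auto simp: gen_avg_def intro!: arg_cong2[where f="(/)"] sum.cong)

lemma gen_avg_diff: "gen_avg b k (\<lambda>v. f v - g v) = gen_avg b k f - gen_avg b k g"
  by (simp add: gen_avg_def sum_subtractf diff_divide_distrib)

lemma gen_avg_add: "gen_avg b k (\<lambda>v. f v + g v) = gen_avg b k f + gen_avg b k g"
  by (simp add: gen_avg_def sum.distrib add_divide_distrib)

lemma gen_avg_cmult: "gen_avg b k (\<lambda>v. c * f v) = c * gen_avg b k f"
  by (simp add: gen_avg_def sum_distrib_left)

lemma gen_avg_const: "b \<ge> 1 \<Longrightarrow> gen_avg b k (\<lambda>v. c) = c"
  by (simp add: gen_avg_def card_generation)

lemma gen_avg_nonneg: "(\<And>v. v \<in> generation b k \<Longrightarrow> 0 \<le> f v) \<Longrightarrow> 0 \<le> gen_avg b k f"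
  by (auto simp: gen_avg_def intro!: divide_nonneg_nonneg sum_nonneg)

lemma abs_gen_avg_le: "\<bar>gen_avg b k f\<bar> \<le> gen_avg b k (\<lambda>v. \<bar>f v\<bar>)"
  by (auto simp: gen_avg_def abs_divide intro!: divide_right_mono sum_abs)

lemma abs_gen_avg_diff_le:
  assumes "b \<ge> 1" "\<And>v. v \<in> generation b k \<Longrightarrow> \<bar>f v - g v\<bar> \<le> c"
  shows "\<bar>gen_avg b k f - gen_avg b k g\<bar> \<le> c"
proof -
  have "\<bar>gen_avg b k f - gen_avg b k g\<bar> \<le> gen_avg b k (\<lambda>v. \<bar>f v - g v\<bar>)"
    unfolding gen_avg_diff[symmetric] by (rule abs_gen_avg_le)
  also have "\<dots> \<le> gen_avg b k (\<lambda>v. c)" by (intro gen_avg_mono assms)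
  finally show ?thesis using assms by (simp add: gen_avg_const)
qed

lemma gen_avg_add_generation:
  "gen_avg b (m + k) f = gen_avg b m (\<lambda>v. gen_avg b k (\<lambda>w. f (v @ w)))"
  by (simp add: gen_avg_def sum_generation_add power_add sum_divide_distrib divide_divide_eq_left mult.commute)

lemma gen_avg_butlast:
  assumes "b \<ge> 1"
  shows "gen_avg b (Suc k) (\<lambda>u. f (butlast u)) = gen_avg b k f"
  using assms by (simp add: gen_avg_def sum_generation_Suc flip: sum_distrib_left)

text \<open>Each vertex has b children, so the average over generation k is also the average over
  generation k + 1 of the value at the parent. Child and parent differ by a single edge: the
  Lipschitz bound handles small increments, the range [0, 1] large ones.\<close>

lemma gen_avg_path_step:
  assumes "b \<ge> 1" and lip: "\<And>x y. \<bar>g x - g y\<bar> \<le> B * \<bar>x - y\<bar>" and bd: "\<And>x. 0 \<le> g x \<and> g x \<le> (1::real)"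
  shows "\<bar>gen_avg b (Suc k) (\<lambda>u. g (path_sum f u)) - gen_avg b k (\<lambda>u. g (path_sum f u))\<bar>
         \<le> gen_avg b (Suc k) (\<lambda>u. min 1 (B * \<bar>f u\<bar>))"
proof -
  define F where "F = (\<lambda>u. g (path_sum f u))"
  define G where "G = (\<lambda>u. F (butlast u))"
  have "gen_avg b (Suc k) F - gen_avg b k F = gen_avg b (Suc k) (\<lambda>u. F u - G u)"
    using gen_avg_butlast[OF assms(1), of k F] by (simp add: gen_avg_diff G_def)
  then have "\<bar>gen_avg b (Suc k) F - gen_avg b k F\<bar> \<le> gen_avg b (Suc k) (\<lambda>u. \<bar>F u - G u\<bar>)"
    by (simp add: abs_gen_avg_le)
  also have "\<dots> \<le> gen_avg b (Suc k) (\<lambda>u. min 1 (B * \<bar>f u\<bar>))"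
  proof (rule gen_avg_mono)
    fix u assume "u \<in> generation b (Suc k)"
    then obtain v i where u: "u = v @ [i]"
      by (cases u rule: rev_cases) (auto simp: generation_def)
    have "\<bar>g (path_sum f u) - g (path_sum f v)\<bar> \<le> 1" using bd[of "path_sum f u"] bd[of "path_sum f v"] by linarith
    moreover have "\<bar>g (path_sum f u) - g (path_sum f v)\<bar> \<le> B * \<bar>f u\<bar>"
      using lip[of "path_sum f u" "path_sum f v"] by (simp add: u path_sum_snoc)
    ultimately show "\<bar>F u - G u\<bar> \<le> min 1 (B * \<bar>f u\<bar>)"
      by (simp add: u F_def G_def)
  qed
  finally show ?thesis by (simp add: F_def)
qed

lemma ray_prefix_0 [simp]: "ray_prefix \<xi> 0 = []"
  by (simp add: ray_prefix_def)

lemma ray_prefix_Suc: "ray_prefix \<xi> (Suc k) = ray_prefix \<xi> k @ [\<xi> (Suc k)]"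
  by (simp add: ray_prefix_def)

lemma length_ray_prefix [simp]: "length (ray_prefix \<xi> k) = k"
  by (simp add: ray_prefix_def)

text \<open>Links sums over ancestors with the partial sums of \<open>ray_sum\<close>; both skip the
  root, hence the shift to \<open>Suc k\<close>.\<close>

lemma path_sum_ray_prefix: "path_sum h (ray_prefix \<xi> K) = (\<Sum>k<K. h (ray_prefix \<xi> (Suc k)))"
  by (induction K) (simp_all add: ray_prefix_Suc path_sum_snoc)

lemma brw_empirical_eq:
  assumes "b \<ge> 1"
  shows "brw_empirical b Y n w B = gen_avg b n (\<lambda>u. indicator B (walk Y u w))"
  by (simp add: brw_empirical_def brw_count_def gen_avg_def card_generation)

section \<open>Unions of intervals and Kolmogorov distance\<close>

text \<open>Captures half-lines, open or closed, together with the empty set and the whole line, so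
  that all endpoint conventions and infinite endpoints are treated at once.\<close>

definition down_closed :: "real set \<Rightarrow> bool" where
  "down_closed D \<longleftrightarrow> (\<forall>x\<in>D. \<forall>y\<le>x. y \<in> D)"

lemma down_closed_cases:
  assumes "down_closed D"
  obtains "D = {}" | "D = UNIV" | t where "D = {..t}" | t where "D = {..<t}"
proof -
  consider "D = {}" | "D \<noteq> {}" "\<not> bdd_above D" | "D \<noteq> {}" "bdd_above D" by (cases "D = {}") auto
  then show thesis
  proof cases
    case 2
    have "D = UNIV"
    proof -
      have "x \<in> D" for x
      proof -
        obtain y where "y \<in> D" "x \<le> y" using 2(2) unfolding bdd_above_def by (auto simp: not_le intro: less_imp_le)
        then show ?thesis using assms unfolding down_closed_def by blast
      qed
      then show ?thesis by auto
    qed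
    then show thesis by (rule that(2))
  next
    case 3
    have lt: "x \<in> D" if lx: "x < Sup D" for x
    proof -
      obtain y where "y \<in> D" "x < y" using lx 3 less_cSup_iff[of D x] by blast
      then show ?thesis using assms less_imp_le[of x y] unfolding down_closed_def by blast
    qed
    have le: "x \<le> Sup D" if "x \<in> D" for x using that 3 by (simp add: cSup_upper)
    show thesis
    proof (cases "Sup D \<in> D")
      case True
      then have "D = {..Sup D}" using assms le unfolding down_closed_def by auto
      then show thesis by (rule that(3))
    next
      case False
      then have "D = {..<Sup D}" using lt le by (force simp: less_le)
      then show thesis by (rule that(4))
    qed
  qed (rule that(1))
qed

lemma down_closed_borel: "down_closed D \<Longrightarrow> D \<in> sets borel"
  by (elim down_closed_cases) auto

lemma down_closed_affine:
  assumes "down_closed D" "c \<ge> 0"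
  shows "down_closed {z. c * z + x \<in> D}"
  unfolding down_closed_def
proof (intro ballI allI impI)
  fix z y assume "z \<in> {z. c * z + x \<in> D}" "y \<le> z"
  moreover from this have "c * y + x \<le> c * z + x" using assms by (simp add: mult_left_mono)
  ultimately show "y \<in> {z. c * z + x \<in> D}" using assms unfolding down_closed_def by auto
qed

text \<open>Distribution functions see only closed half-lines; the open ones are reached as left
  limits, under which the bound survives.\<close>

lemma down_closed_measure_diff_le:
  assumes "real_distribution P" "real_distribution Q" "down_closed D"
    and dist: "\<And>t. \<bar>cdf P t - cdf Q t\<bar> \<le> \<epsilon>"
  shows "\<bar>measure P D - measure Q D\<bar> \<le> \<epsilon>"
proof -
  interpret P: real_distribution P by fact
  interpret Q: real_distribution Q by fact
  have \<epsilon>: "0 \<le> \<epsilon>" using dist[of 0] by linarith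
  show ?thesis using assms(3)
  proof (cases rule: down_closed_cases)
    case 2
    then show ?thesis using \<epsilon> P.prob_space Q.prob_space by simp
  next
    case (4 t)
    have "((\<lambda>s. \<bar>cdf P s - cdf Q s\<bar>) \<longlongrightarrow> \<bar>measure P {..<t} - measure Q {..<t}\<bar>) (at_left t)"
      by (intro tendsto_intros P.cdf_at_left Q.cdf_at_left)
    then have "\<bar>measure P {..<t} - measure Q {..<t}\<bar> \<le> \<epsilon>"
      by (rule tendsto_upperbound) (auto simp: dist)
    then show ?thesis by (simp add: 4)
  qed (use \<epsilon> dist in \<open>auto simp: cdf_def\<close>)
qed

lemma is_interval_interval_with_endpoints:
  assumes "interval_with_endpoints l r J"
  shows "is_interval J"
  unfolding is_interval_1
proof (intro ballI allI impI)
  fix x y z assume "x \<in> J" "y \<in> J" "x \<le> z \<and> z \<le> y"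
  moreover from this have *: "ereal x \<le> ereal z" "ereal z \<le> ereal y" by auto
  ultimately show "z \<in> J"
    using assms unfolding interval_with_endpoints_def
    by (auto intro: less_le_trans[OF _ *(1)] order_trans[OF _ *(1)] le_less_trans[OF *(2)] order_trans[OF *(2)])
qed

text \<open>An interval is its downward closure minus the part of that closure lying below the
  interval. Convexity of the interval is what makes the removed part closed downwards.\<close>

lemma disjoint_interval_union_segments:
  assumes "disjoint_interval_union k A"
  shows "\<exists>D E. (\<forall>j<k. down_closed (D j) \<and> down_closed (E j) \<and> E j \<subseteq> D j) \<and>
    disjoint_family_on (\<lambda>j. D j - E j) {..<k} \<and> A = (\<Union>j<k. D j - E j)"
proof -
  obtain l r J where J: "\<And>j. j < k \<Longrightarrow> interval_with_endpoints (l j) (r j) (J j)"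
    "disjoint_family_on J {..<k}" "A = (\<Union>j<k. J j)"
    using assms unfolding disjoint_interval_union_def by auto
  define D where "D j = {x. \<exists>y\<in>J j. x \<le> y}" for j
  define E where "E j = D j - J j" for j
  have DJ: "J j \<subseteq> D j" for j by (auto simp: D_def)
  have DE: "D j - E j = J j" for j using DJ by (auto simp: E_def)
  show ?thesis
  proof (rule exI[of _ D], rule exI[of _ E], intro conjI allI impI)
    show "down_closed (D j)" for j unfolding down_closed_def D_def by (blast intro: order_trans)
    show "down_closed (E j)" if j: "j < k" for j
      unfolding down_closed_def
    proof (intro ballI allI impI)
      fix x y assume x: "x \<in> E j" "y \<le> x"
      then obtain z where z: "z \<in> J j" "x \<le> z" by (auto simp: E_def D_def)
      have "y \<notin> J j"
        using is_interval_interval_with_endpoints[OF J(1)[OF j]] x z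
        unfolding is_interval_1 E_def by blast
      moreover have "y \<le> z" using x z by simp
      ultimately show "y \<in> E j" using z unfolding E_def D_def by blast
    qed
    show "E j \<subseteq> D j" for j by (auto simp: E_def)
  qed (use J DE in auto)
qed

lemma disjoint_interval_union_borel:
  assumes "disjoint_interval_union k A"
  shows "A \<in> sets borel"
proof -
  obtain D E where "\<And>j. j < k \<Longrightarrow> down_closed (D j)" "\<And>j. j < k \<Longrightarrow> down_closed (E j)"
    and A: "A = (\<Union>j<k. D j - E j)"
    using disjoint_interval_union_segments[OF assms] by metis
  then have "D j - E j \<in> sets borel" if "j < k" for j
    using that by (intro sets.Diff down_closed_borel) auto
  then show ?thesis unfolding A by (intro sets.finite_UN) auto
qed

text \<open>Each interval contributes two half-lines, hence the factor 2k. Disjointness turns the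
  measure of the union into a sum, and \<open>c \<ge> 0\<close> keeps half-lines facing the same way
  under the affine map.\<close>

lemma interval_union_measure_diff_le:
  assumes A: "disjoint_interval_union k A" and PQ: "real_distribution P" "real_distribution Q"
    and dist: "\<And>t. \<bar>cdf P t - cdf Q t\<bar> \<le> \<epsilon>" and c: "c \<ge> 0"
  shows "\<bar>measure P {z. c * z + x \<in> A} - measure Q {z. c * z + x \<in> A}\<bar> \<le> 2 * real k * \<epsilon>"
proof -
  obtain D E where DE: "\<forall>j<k. down_closed (D j) \<and> down_closed (E j) \<and> E j \<subseteq> D j"
    and disj: "disjoint_family_on (\<lambda>j. D j - E j) {..<k}" and A_eq: "A = (\<Union>j<k. D j - E j)"
    using disjoint_interval_union_segments[OF A] by blast
  define D' where "D' j = {z. c * z + x \<in> D j}" for j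
  define E' where "E' j = {z. c * z + x \<in> E j}" for j
  have D': "down_closed (D' j)" and E': "down_closed (E' j)" and DE': "E' j \<subseteq> D' j" if "j < k" for j
    using down_closed_affine[OF _ c, of "D j" x] down_closed_affine[OF _ c, of "E j" x]
      DE[rule_format, OF that] unfolding D'_def E'_def by auto
  have borel: "D' j \<in> sets borel" "E' j \<in> sets borel" if "j < k" for j
    using D'[OF that] E'[OF that] by (auto intro: down_closed_borel)
  have split: "measure R {z. c * z + x \<in> A} = (\<Sum>j<k. measure R (D' j) - measure R (E' j))"
    if "real_distribution R" for R
  proof -
    interpret R: real_distribution R by fact
    have "{z. c * z + x \<in> A} = (\<Union>j<k. D' j - E' j)" by (auto simp: A_eq D'_def E'_def)
    also have "measure R \<dots> = (\<Sum>j<k. measure R (D' j - E' j))"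
    proof (rule R.finite_measure_finite_Union)
      show "disjoint_family_on (\<lambda>j. D' j - E' j) {..<k}"
        using disj unfolding disjoint_family_on_def D'_def E'_def by blast
    qed (use borel in auto)
    also have "\<dots> = (\<Sum>j<k. measure R (D' j) - measure R (E' j))"
      using borel DE' by (intro sum.cong refl R.finite_measure_Diff) auto
    finally show ?thesis .
  qed
  have "measure P {z. c * z + x \<in> A} - measure Q {z. c * z + x \<in> A} =
      (\<Sum>j<k. (measure P (D' j) - measure Q (D' j)) - (measure P (E' j) - measure Q (E' j)))"
    by (simp add: split PQ flip: sum_subtractf) (simp add: algebra_simps)
  also have "\<bar>\<dots>\<bar> \<le> (\<Sum>j<k. 2 * \<epsilon>)"
  proof (rule order_trans[OF sum_abs sum_mono])
    fix j assume "j \<in> {..<k}"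
    then have "\<bar>measure P (D' j) - measure Q (D' j)\<bar> \<le> \<epsilon>" "\<bar>measure P (E' j) - measure Q (E' j)\<bar> \<le> \<epsilon>"
      using down_closed_measure_diff_le[OF PQ _ dist] D' E' by auto
    then show "\<bar>measure P (D' j) - measure Q (D' j) - (measure P (E' j) - measure Q (E' j))\<bar> \<le> 2 * \<epsilon>"
      by linarith
  qed
  finally show ?thesis by simp
qed

section \<open>The Gaussian mass\<close>

interpretation std_normal: real_distribution std_normal_distribution
  by (rule real_dist_normal_dist)

text \<open>The density is bounded by 1 / sqrt (2 pi), which is less than 1.\<close>

lemma std_normal_cdf_lipschitz: "\<bar>cdf std_normal_distribution s - cdf std_normal_distribution t\<bar> \<le> \<bar>s - t\<bar>"
proof -
  have dens: "std_normal_density x \<le> 1" for x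
  proof -
    have "1 \<le> sqrt (2 * pi)" using pi_gt3 by simp
    then have "1 / sqrt (2 * pi) \<le> 1" by simp
    moreover have "exp (- x\<^sup>2 / 2) \<le> (1::real)" by simp
    ultimately have "1 / sqrt (2 * pi) * exp (- x\<^sup>2 / 2) \<le> 1 * 1" by (intro mult_mono) auto
    then show ?thesis unfolding std_normal_density_def by simp
  qed
  have *: "cdf std_normal_distribution t - cdf std_normal_distribution s \<le> t - s" if "s < t" for s t
  proof -
    have "emeasure std_normal_distribution {s<..t} = (\<integral>\<^sup>+x. ennreal (std_normal_density x) * indicator {s<..t} x \<partial>lborel)"
      by (simp add: emeasure_density)
    also have "\<dots> \<le> (\<integral>\<^sup>+x. indicator {s<..t} x \<partial>lborel)"
      by (intro nn_integral_mono) (auto simp: indicator_def dens ennreal_le_1)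
    also have "\<dots> = ennreal (t - s)" using that by simp
    finally show ?thesis
      using that by (simp add: std_normal.cdf_diff_eq std_normal.emeasure_eq_measure)
  qed
  show ?thesis
    using *[of s t] *[of t s] std_normal.cdf_nondecreasing[of s t] std_normal.cdf_nondecreasing[of t s]
    by (cases s t rule: linorder_cases) auto
qed

lemma gauss_shift_eq: "gauss_shift A x = measure std_normal_distribution {z. z + x \<in> A}"
proof -
  have "(\<lambda>a. a - x) ` A = {z. z + x \<in> A}" by (force simp: image_iff intro: bexI[of _ "_ + x"])
  then show ?thesis by (simp add: gauss_shift_def)
qed

lemma gauss_shift_bounds: "0 \<le> gauss_shift A x \<and> gauss_shift A x \<le> 1"
  by (simp add: gauss_shift_def)

lemma gauss_shift_0: "gauss_shift A 0 = measure std_normal_distribution A"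
  by (simp add: gauss_shift_def)

lemma cdf_distr_shift: "cdf (distr std_normal_distribution borel (\<lambda>z. z + x)) t = cdf std_normal_distribution (t - x)"
proof -
  have "(\<lambda>z. z + x) -` {..t} = {..t - x}" by auto
  then show ?thesis by (simp add: cdf_def measure_distr)
qed

text \<open>\<open>gauss_shift A x\<close> is the mass of A under the Gaussian law translated by x,
  and the distribution functions of two translates are uniformly close. The constant depends on A
  only through the number of intervals.\<close>

lemma gauss_shift_lipschitz:
  assumes A: "disjoint_interval_union k A"
  shows "\<bar>gauss_shift A x - gauss_shift A y\<bar> \<le> 2 * real k * \<bar>x - y\<bar>"
proof -
  let ?P = "\<lambda>x. distr std_normal_distribution borel (\<lambda>z. z + x)"
  have eq: "gauss_shift A x = measure (?P x) {z. 1 * z + 0 \<in> A}" for x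
    using disjoint_interval_union_borel[OF A] by (simp add: gauss_shift_eq measure_distr vimage_def)
  have "\<bar>cdf (?P x) t - cdf (?P y) t\<bar> \<le> \<bar>x - y\<bar>" for t
    using std_normal_cdf_lipschitz[of "t - x" "t - y"] by (simp add: cdf_distr_shift abs_minus_commute)
  then show ?thesis unfolding eq
    by (intro interval_union_measure_diff_le[OF A]) auto
qed

lemma gauss_shift_continuous: "disjoint_interval_union k A \<Longrightarrow> continuous_on UNIV (gauss_shift A)"
  by (rule lipschitz_on_continuous_on[of "2 * real k"])
    (auto simp: lipschitz_on_def dist_real_def gauss_shift_lipschitz)

lemma gauss_shift_measurable: "disjoint_interval_union k A \<Longrightarrow> gauss_shift A \<in> borel_measurable borel"
  by (intro borel_measurable_continuous_onI gauss_shift_continuous)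

text \<open>Polya's argument: monotonicity upgrades pointwise convergence of distribution functions to
  uniform convergence, by comparison on a finite grid.\<close>

lemma polya_uniform:
  fixes F :: "nat \<Rightarrow> real \<Rightarrow> real"
  assumes mono: "\<And>n s t. s \<le> t \<Longrightarrow> F n s \<le> F n t" and bd: "\<And>n t. 0 \<le> F n t \<and> F n t \<le> 1"
    and monoG: "\<And>s t. s \<le> t \<Longrightarrow> G s \<le> G t" and bdG: "\<And>t. 0 \<le> G t \<and> G t \<le> 1"
    and lip: "\<And>s t. \<bar>G s - G t\<bar> \<le> \<bar>s - t\<bar>"
    and bot: "(G \<longlongrightarrow> 0) at_bot" and top: "(G \<longlongrightarrow> 1) at_top"
    and conv: "\<And>t. (\<lambda>n. F n t) \<longlonglongrightarrow> G t" and \<epsilon>: "\<epsilon> > 0"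
  shows "\<forall>\<^sub>F n in sequentially. \<forall>t. \<bar>F n t - G t\<bar> \<le> \<epsilon>"
proof -
  obtain a where a: "G a < \<epsilon> / 2"
    using order_tendstoD(2)[OF bot, of "\<epsilon> / 2"] \<epsilon> by (auto simp: eventually_at_bot_linorder)
  obtain b where b: "G b > 1 - \<epsilon> / 2"
    using order_tendstoD(1)[OF top, of "1 - \<epsilon> / 2"] \<epsilon> by (auto simp: eventually_at_top_linorder)
  \<comment> \<open>Mesh \<epsilon>/2 lets G vary by at most \<epsilon>/2 across a cell. The point b
    is added because the grid need not hit it, yet the right tail is compared there.\<close>
  define S where "S = insert b ((\<lambda>j. a + real j * (\<epsilon> / 2)) ` {.. nat \<lceil>(b - a) / (\<epsilon> / 2)\<rceil>})"
  have "\<forall>\<^sub>F n in sequentially. \<forall>s\<in>S. \<bar>F n s - G s\<bar> < \<epsilon> / 2"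
  proof (rule eventually_ball_finite)
    show "\<forall>s\<in>S. \<forall>\<^sub>F n in sequentially. \<bar>F n s - G s\<bar> < \<epsilon> / 2"
      using tendstoD[OF conv, of "\<epsilon> / 2"] \<epsilon> by (auto simp: dist_real_def)
  qed (simp add: S_def)
  then show ?thesis
  proof eventually_elim
    case (elim n)
    have aS: "a \<in> S" and bS: "b \<in> S" by (force simp: S_def)+
    have "\<bar>F n t - G t\<bar> \<le> \<epsilon>" for t
    proof -
      consider "t < a" | "t > b" | "a \<le> t" "t \<le> b" by linarith
      then show ?thesis
      proof cases
        case 1
        have "F n t \<le> F n a" "G t \<le> G a" using 1 by (auto intro!: mono monoG)
        then show ?thesis using elim[rule_format, OF aS] a bd[of n t] bdG[of t] by linarith
      next
        case 2
        have "F n b \<le> F n t" "G b \<le> G t" using 2 by (auto intro!: mono monoG)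
        then show ?thesis using elim[rule_format, OF bS] b bd[of n t] bdG[of t] by linarith
      next
        case 3
        define x where "x = (t - a) / (\<epsilon> / 2)"
        have x: "0 \<le> x" "x \<le> (b - a) / (\<epsilon> / 2)" and t: "t = a + x * (\<epsilon> / 2)"
          using 3 \<epsilon> unfolding x_def by (simp_all add: divide_right_mono) (simp add: field_simps)
        define s where "s = a + real (nat \<lfloor>x\<rfloor>) * (\<epsilon> / 2)"
        define r where "r = a + real (nat \<lceil>x\<rceil>) * (\<epsilon> / 2)"
        have fl: "real (nat \<lfloor>x\<rfloor>) \<le> x" "x - 1 \<le> real (nat \<lfloor>x\<rfloor>)"
          and ce: "x \<le> real (nat \<lceil>x\<rceil>)" "real (nat \<lceil>x\<rceil>) \<le> x + 1"
          using x by linarith+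
        have "nat \<lfloor>x\<rfloor> \<le> nat \<lceil>(b - a) / (\<epsilon> / 2)\<rceil>"
          using ceiling_mono[OF x(2)] by (intro nat_mono) linarith
        then have "s \<in> S" unfolding S_def s_def by (intro insertI2 imageI) simp
        moreover have "nat \<lceil>x\<rceil> \<le> nat \<lceil>(b - a) / (\<epsilon> / 2)\<rceil>"
          by (intro nat_mono ceiling_mono x(2))
        then have "r \<in> S" unfolding S_def r_def by (intro insertI2 imageI) simp
        moreover have "s \<le> t" unfolding s_def t using fl \<epsilon> by (simp add: mult_right_mono)
        moreover have "t \<le> r" unfolding r_def t using ce \<epsilon> by (simp add: mult_right_mono)
        moreover have "t - s \<le> \<epsilon> / 2"
        proof -
          have "(x - real (nat \<lfloor>x\<rfloor>)) * (\<epsilon> / 2) \<le> 1 * (\<epsilon> / 2)" using fl \<epsilon> by (intro mult_right_mono) linarith+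
          then show ?thesis unfolding s_def t by (simp add: algebra_simps)
        qed
        moreover have "r - t \<le> \<epsilon> / 2"
        proof -
          have "(real (nat \<lceil>x\<rceil>) - x) * (\<epsilon> / 2) \<le> 1 * (\<epsilon> / 2)" using ce \<epsilon> by (intro mult_right_mono) linarith+
          then show ?thesis unfolding r_def t by (simp add: algebra_simps)
        qed
        ultimately show ?thesis
          using elim[rule_format, of s] elim[rule_format, of r] mono[of s t n] mono[of t r n]
            lip[of s t] lip[of r t] by linarith
      qed
    qed
    then show ?case by blast
  qed
qed

lemma std_normal_polya:
  assumes "\<And>n s t. s \<le> t \<Longrightarrow> F n s \<le> F n t" "\<And>n t. 0 \<le> F n t \<and> F n t \<le> 1"
    "\<And>t. (\<lambda>n. F n t) \<longlonglongrightarrow> cdf std_normal_distribution t" "\<epsilon> > 0"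
  shows "\<forall>\<^sub>F n in sequentially. \<forall>t. \<bar>F n t - cdf std_normal_distribution t\<bar> \<le> \<epsilon>"
proof (rule polya_uniform)
  show "(cdf std_normal_distribution \<longlongrightarrow> 0) at_bot" by (rule std_normal.cdf_lim_at_bot)
  show "(cdf std_normal_distribution \<longlongrightarrow> 1) at_top" by (rule std_normal.cdf_lim_at_top_prob)
qed (use assms std_normal_cdf_lipschitz std_normal.cdf_nonneg std_normal.cdf_bounded_prob
      std_normal.cdf_nondecreasing in \<open>auto simp: assms\<close>)

lemma isCont_std_normal_cdf: "isCont (cdf std_normal_distribution) t"
proof -
  have "continuous_on UNIV (cdf std_normal_distribution)"
    by (rule lipschitz_on_continuous_on[of 1])
      (auto simp: lipschitz_on_def dist_real_def std_normal_cdf_lipschitz)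
  then show ?thesis by (simp add: continuous_on_eq_continuous_at)
qed

text \<open>Absorbs prefactors: \<open>a3\<close> lies strictly below both rates, so after division
  by the right side both terms tend to 0.\<close>

lemma exp_sum_le_eventually:
  fixes a1 a2 a3 C :: real
  assumes "a3 < a1" "a3 < a2"
  shows "\<forall>\<^sub>F t in at_top. exp (- (a1 * t)) + C * exp (- (a2 * t)) \<le> exp (- (a3 * t))"
proof -
  have lim: "((\<lambda>t. exp (- (d * t))) \<longlongrightarrow> 0) at_top" if "d > 0" for d :: real
    using that by real_asymp
  have "((\<lambda>t. exp (- ((a1 - a3) * t)) + C * exp (- ((a2 - a3) * t))) \<longlongrightarrow> 0 + C * 0) at_top"
    using assms by (intro tendsto_intros lim) auto
  then have "\<forall>\<^sub>F t in at_top. exp (- ((a1 - a3) * t)) + C * exp (- ((a2 - a3) * t)) < 1"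
    by (rule order_tendstoD) simp
  then show ?thesis
  proof eventually_elim
    case (elim t)
    have split: "exp (- (d * t)) = exp (- ((d - a3) * t)) * exp (- (a3 * t))" for d
      by (simp add: algebra_simps flip: exp_add)
    have "exp (- (a1 * t)) + C * exp (- (a2 * t)) =
        (exp (- ((a1 - a3) * t)) + C * exp (- ((a2 - a3) * t))) * exp (- (a3 * t))"
      by (subst split[of a1], subst split[of a2]) (simp only: distrib_right mult.assoc)
    also have "\<dots> \<le> 1 * exp (- (a3 * t))" using elim by (intro mult_right_mono) auto
    finally show ?case by simp
  qed
qed

section \<open>Displacements of the branching random walk\<close>

locale branching_walk = prob_space M for M :: "'w measure" +
  fixes b :: nat and \<alpha> lam :: real
    and N :: "'v measure" and X :: "'v \<Rightarrow> real" and Y :: "nat list \<Rightarrow> 'w \<Rightarrow> real"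
  assumes b_ge: "b \<ge> 2" and \<alpha>_pos: "\<alpha> > 0" and lam_pos: "lam > 0"
    and N: "prob_space N" and X_borel: "X \<in> borel_measurable N"
    and symmetric: "distr N borel (\<lambda>w. - X w) = distr N borel X"
    and mean: "integrable N X" "(LINT w|N. X w) = 0"
    and variance: "integrable N (\<lambda>w. (X w)\<^sup>2)" "(LINT w|N. (X w)\<^sup>2) = 1"
    and tail: "((\<lambda>x::real. ereal (x powr (- \<alpha>)) * log_prob (measure N {w \<in> space N. X w > x}))
                 \<longlongrightarrow> ereal (- lam)) at_top"
    and iid: "iid_copies M (tree b - {[]}) Y N X"
begin

lemmas [measurable] = X_borel

sublocale N: prob_space N by (rule N)

lemma b_ge_1: "b \<ge> 1" using b_ge by simp

lemma indep_Y: "indep_vars (\<lambda>_. borel) Y (tree b - {[]})"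
  and distr_Y: "v \<in> tree b - {[]} \<Longrightarrow> distr M borel (Y v) = distr N borel X"
  using iid by (auto simp: iid_copies_def)

lemma Y_borel: "v \<in> tree b - {[]} \<Longrightarrow> Y v \<in> borel_measurable M"
  using indep_Y by (auto simp: indep_vars_def)

lemma nn_integral_Y:
  assumes "v \<in> tree b - {[]}" and [measurable]: "f \<in> borel_measurable borel"
  shows "(\<integral>\<^sup>+w. f (Y v w) \<partial>M) = (\<integral>\<^sup>+w. f (X w) \<partial>N)"
proof -
  note [measurable] = Y_borel[OF assms(1)]
  have "(\<integral>\<^sup>+w. f (Y v w) \<partial>M) = (\<integral>\<^sup>+x. f x \<partial>distr M borel (Y v))" by (simp add: nn_integral_distr)
  also have "\<dots> = (\<integral>\<^sup>+w. f (X w) \<partial>N)" using assms(1) by (simp add: distr_Y nn_integral_distr)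
  finally show ?thesis .
qed

lemma prob_Y:
  assumes "v \<in> tree b - {[]}" and S: "S \<in> sets borel"
  shows "prob (Y v -` S \<inter> space M) = measure N {w \<in> space N. X w \<in> S}"
proof -
  note [measurable] = Y_borel[OF assms(1)]
  have "prob (Y v -` S \<inter> space M) = measure (distr M borel (Y v)) S" using S by (simp add: measure_distr)
  also have "\<dots> = measure N (X -` S \<inter> space N)" using assms by (simp add: distr_Y measure_distr)
  also have "X -` S \<inter> space N = {w \<in> space N. X w \<in> S}" by auto
  finally show ?thesis .
qed

subsection \<open>Tails of a single displacement\<close>

lemma prob_neg_X: "measure N {w \<in> space N. - X w \<in> S} = measure N {w \<in> space N. X w \<in> S}"
  if [measurable]: "S \<in> sets borel"
proof -
  have "measure N {w \<in> space N. - X w \<in> S} = measure (distr N borel (\<lambda>w. - X w)) S"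
    by (subst measure_distr) (auto intro!: arg_cong[where f="measure N"])
  also have "\<dots> = measure (distr N borel X) S" by (simp only: symmetric)
  also have "\<dots> = measure N {w \<in> space N. X w \<in> S}"
    by (subst measure_distr) (auto intro!: arg_cong[where f="measure N"])
  finally show ?thesis .
qed

lemma tail_bounds:
  assumes "0 < \<eta>"
  shows "\<forall>\<^sub>F x in at_top. exp (- ((1 + \<eta>) * lam * x powr \<alpha>)) \<le> measure N {w \<in> space N. X w > x} \<and>
     measure N {w \<in> space N. X w > x} \<le> exp (- ((1 - \<eta>) * lam * x powr \<alpha>))"
proof -
  let ?L = "\<lambda>x::real. ereal (x powr (- \<alpha>)) * log_prob (measure N {w \<in> space N. X w > x})"
  have "ereal (- ((1 + \<eta>) * lam)) < ereal (- lam)" "ereal (- lam) < ereal (- ((1 - \<eta>) * lam))"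
    using assms lam_pos by (auto simp: field_simps)
  then have "\<forall>\<^sub>F x in at_top. ereal (- ((1 + \<eta>) * lam)) < ?L x" "\<forall>\<^sub>F x in at_top. ?L x < ereal (- ((1 - \<eta>) * lam))"
    using order_tendstoD[OF tail] by auto
  then show ?thesis using eventually_gt_at_top[of 0]
  proof eventually_elim
    case (elim x)
    define q where "q = measure N {w \<in> space N. X w > x}"
    have x: "x powr - \<alpha> > 0" using elim by simp
    \<comment> \<open>For q = 0 the scaled logarithm would be -\<infinity>, against the lower bound;
      afterwards \<open>log_prob\<close> is the real \<open>ln\<close>.\<close>
    have q: "q > 0"
    proof (rule ccontr)
      assume "\<not> q > 0"
      then have "q = 0" by (simp add: q_def not_less measure_le_0_iff)
      then show False using elim(1) x by (simp add: q_def[symmetric] log_prob_def)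
    qed
    then have "- ((1 + \<eta>) * lam) < x powr - \<alpha> * ln q" "x powr - \<alpha> * ln q < - ((1 - \<eta>) * lam)"
      using elim by (auto simp: q_def[symmetric] log_prob_def)
    then have "- ((1 + \<eta>) * lam) * x powr \<alpha> < (x powr - \<alpha> * ln q) * x powr \<alpha>"
      "(x powr - \<alpha> * ln q) * x powr \<alpha> < - ((1 - \<eta>) * lam) * x powr \<alpha>"
      using elim by (intro mult_strict_right_mono; simp)+
    moreover have "(x powr - \<alpha> * ln q) * x powr \<alpha> = ln q"
      using elim by (simp add: powr_minus field_simps)
    ultimately have "- ((1 + \<eta>) * lam * x powr \<alpha>) \<le> ln q" "ln q \<le> - ((1 - \<eta>) * lam * x powr \<alpha>)"
      by auto
    then show ?case using q
      by (metis exp_le_cancel_iff exp_ln q_def)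
  qed
qed

lemma prob_abs_X_gt:
  "measure N {w \<in> space N. \<bar>X w\<bar> > x} \<le> 2 * measure N {w \<in> space N. X w > x}"
proof -
  have "{w \<in> space N. \<bar>X w\<bar> > x} \<subseteq> {w \<in> space N. X w > x} \<union> {w \<in> space N. - X w \<in> {x<..}}" by auto
  then have "measure N {w \<in> space N. \<bar>X w\<bar> > x} \<le> measure N ({w \<in> space N. X w > x} \<union> {w \<in> space N. - X w \<in> {x<..}})"
    by (intro N.finite_measure_mono) auto
  also have "\<dots> \<le> measure N {w \<in> space N. X w > x} + measure N {w \<in> space N. - X w \<in> {x<..}}"
    by (intro measure_Un_le) auto
  finally show ?thesis using prob_neg_X[of "{x<..}"] by simp
qed

text \<open>The limit gives a tail exp (- s' x^\<alpha>) only for s' below \<open>lam\<close>, so s'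
  is placed between s and \<open>lam\<close>. Cutting |X|^\<alpha> at integer levels then leaves a
  geometric series of ratio exp (- (s' - s)).\<close>

lemma exp_moment:
  assumes "0 < s" "s < lam"
  obtains C where "C \<ge> 1" "(\<integral>\<^sup>+w. ennreal (exp (s * \<bar>X w\<bar> powr \<alpha>)) \<partial>N) \<le> ennreal C"
proof -
  define s' where "s' = (s + lam) / 2"
  have s': "s < s'" "s' < lam" using assms by (auto simp: s'_def)
  define \<eta> where "\<eta> = 1 - s' / lam"
  have \<eta>: "0 < \<eta>" "(1 - \<eta>) * lam = s'" using s' lam_pos by (auto simp: \<eta>_def)
  obtain x0 where x0: "\<And>x. x \<ge> x0 \<Longrightarrow> measure N {w \<in> space N. X w > x} \<le> exp (- (s' * x powr \<alpha>))"
    using tail_bounds[OF \<eta>(1)] unfolding \<eta>(2) eventually_at_top_linorder by blast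
  define j0 where "j0 = nat \<lceil>max x0 0 powr \<alpha>\<rceil>"
  define D where "D = 2 + exp (s' * real j0)"
  have level: "measure N {w \<in> space N. \<bar>X w\<bar> powr \<alpha> > real j} \<le> D * exp (- (s' * real j))" for j
  proof (cases "j \<ge> j0")
    case True
    define x where "x = real j powr (1 / \<alpha>)"
    have xp: "x powr \<alpha> = real j" using \<alpha>_pos by (simp add: x_def powr_powr)
    have "max x0 0 powr \<alpha> \<le> real j" using True by (simp add: j0_def)
    then have "(max x0 0 powr \<alpha>) powr (1 / \<alpha>) \<le> x" unfolding x_def
      using \<alpha>_pos by (intro powr_mono2) auto
    then have "x0 \<le> x" using \<alpha>_pos by (simp add: powr_powr)
    have "{w \<in> space N. \<bar>X w\<bar> powr \<alpha> > real j} \<subseteq> {w \<in> space N. \<bar>X w\<bar> > x}"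
    proof safe
      fix w assume "real j < \<bar>X w\<bar> powr \<alpha>"
      then have "x powr \<alpha> < \<bar>X w\<bar> powr \<alpha>" by (simp add: xp)
      then show "x < \<bar>X w\<bar>" using \<alpha>_pos
        by (meson abs_ge_zero less_imp_le not_less powr_mono2)
    qed
    then have "measure N {w \<in> space N. \<bar>X w\<bar> powr \<alpha> > real j} \<le> measure N {w \<in> space N. \<bar>X w\<bar> > x}"
      by (intro N.finite_measure_mono) auto
    also have "\<dots> \<le> 2 * exp (- (s' * real j))"
      using prob_abs_X_gt[of x] x0[OF \<open>x0 \<le> x\<close>] by (simp add: xp)
    also have "\<dots> \<le> D * exp (- (s' * real j))" by (simp add: D_def)
    finally show ?thesis .
  next
    case False
    have "measure N {w \<in> space N. \<bar>X w\<bar> powr \<alpha> > real j} \<le> 1" by simp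
    also have "1 \<le> exp (s' * real j0) * exp (- (s' * real j))"
      using False s' assms by (simp flip: exp_add)
    also have "\<dots> \<le> D * exp (- (s' * real j))" by (intro mult_right_mono) (auto simp: D_def)
    finally show ?thesis .
  qed
  define c where "c j = D * exp s * exp (- (s' - s)) ^ j" for j :: nat
  have c_nonneg: "0 \<le> c j" for j by (simp add: c_def D_def add_nonneg_nonneg)
  have "summable c" unfolding c_def using s' by (intro summable_mult summable_geometric) auto
  have pt: "ennreal (exp (s * \<bar>X w\<bar> powr \<alpha>)) \<le>
      1 + (\<Sum>j. ennreal (exp (s * (real j + 1))) * indicator {w \<in> space N. \<bar>X w\<bar> powr \<alpha> > real j} w)"
    if w: "w \<in> space N" for w
  proof (cases "\<bar>X w\<bar> powr \<alpha> = 0")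
    case False
    define T where "T = \<bar>X w\<bar> powr \<alpha>"
    have T: "T > 0" using False by (simp add: T_def order_less_le)
    \<comment> \<open>The integer with j < T \<le> j + 1; strictness on the left matches the strict
      tail events.\<close>
    define j where "j = nat (\<lceil>T\<rceil> - 1)"
    have j: "real j < T" "T \<le> real j + 1" using T unfolding j_def by linarith+
    have "ennreal (exp (s * T)) \<le> ennreal (exp (s * (real j + 1)))"
      using j assms by (intro ennreal_leI) simp
    also have "\<dots> = (\<Sum>j\<in>{j}. ennreal (exp (s * (real j + 1))) * indicator {w \<in> space N. \<bar>X w\<bar> powr \<alpha> > real j} w)"
      using j w by (simp add: T_def)
    also have "\<dots> \<le> (\<Sum>j. ennreal (exp (s * (real j + 1))) * indicator {w \<in> space N. \<bar>X w\<bar> powr \<alpha> > real j} w)"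
      by (intro sum_le_suminf) auto
    finally show ?thesis unfolding T_def by (rule order_trans) simp
  qed simp
  have "(\<integral>\<^sup>+w. ennreal (exp (s * \<bar>X w\<bar> powr \<alpha>)) \<partial>N) \<le>
      (\<integral>\<^sup>+w. 1 + (\<Sum>j. ennreal (exp (s * (real j + 1))) * indicator {w \<in> space N. \<bar>X w\<bar> powr \<alpha> > real j} w) \<partial>N)"
    by (intro nn_integral_mono pt)
  also have "\<dots> = 1 + (\<Sum>j. ennreal (exp (s * (real j + 1))) * emeasure N {w \<in> space N. \<bar>X w\<bar> powr \<alpha> > real j})"
    by (subst nn_integral_add) (auto simp: nn_integral_suminf nn_integral_cmult N.emeasure_space_1)
  also have "\<dots> \<le> 1 + (\<Sum>j. ennreal (c j))"
  proof (intro add_left_mono suminf_le)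
    fix j
    have "ennreal (exp (s * (real j + 1))) * emeasure N {w \<in> space N. \<bar>X w\<bar> powr \<alpha> > real j} =
        ennreal (exp (s * (real j + 1)) * measure N {w \<in> space N. \<bar>X w\<bar> powr \<alpha> > real j})"
      by (simp add: N.emeasure_eq_measure ennreal_mult)
    also have "\<dots> \<le> ennreal (exp (s * (real j + 1)) * (D * exp (- (s' * real j))))"
      by (intro ennreal_leI mult_left_mono level) simp
    also have "exp (s * (real j + 1)) * (D * exp (- (s' * real j))) = c j"
    proof -
      have "exp (- (s' - s)) ^ j = exp (s * real j) * exp (- (s' * real j))"
        by (simp add: exp_of_nat_mult[symmetric] algebra_simps flip: exp_add)
      then show ?thesis by (simp add: c_def algebra_simps exp_add)
    qed
    finally show "ennreal (exp (s * (real j + 1))) * emeasure N {w \<in> space N. \<bar>X w\<bar> powr \<alpha> > real j} \<le> ennreal (c j)" .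
  qed auto
  also have "\<dots> = ennreal (1 + (\<Sum>j. c j))"
    using \<open>summable c\<close> c_nonneg by (simp add: suminf_ennreal2 suminf_nonneg flip: ennreal_1)
  finally show thesis using \<open>summable c\<close> c_nonneg by (intro that[of "1 + (\<Sum>j. c j)"]) (auto intro: suminf_nonneg)
qed

text \<open>Exponential Markov inequality and independence. The constant C depends on s but serves
  all vertex sets and thresholds, so enlarging J costs one factor C per vertex.\<close>

lemma chernoff:
  assumes "0 < s" "s < lam"
  obtains C where "C \<ge> 1"
    "\<And>J c. finite J \<Longrightarrow> J \<subseteq> tree b - {[]} \<Longrightarrow>
      prob {w \<in> space M. (\<Sum>v\<in>J. \<bar>Y v w\<bar> powr \<alpha>) \<ge> c} \<le> C ^ card J * exp (- (s * c))"
proof -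
  obtain C where C: "C \<ge> 1" "(\<integral>\<^sup>+w. ennreal (exp (s * \<bar>X w\<bar> powr \<alpha>)) \<partial>N) \<le> ennreal C"
    using exp_moment[OF assms] by blast
  show thesis
  proof (rule that[OF C(1)])
    fix J c assume J: "finite J" "J \<subseteq> tree b - {[]}"
    have [measurable]: "Y v \<in> borel_measurable M" if "v \<in> J" for v using that J Y_borel by auto
    let ?f = "\<lambda>x. ennreal (exp (s * \<bar>x\<bar> powr \<alpha>))"
    let ?S = "{w \<in> space M. (\<Sum>v\<in>J. \<bar>Y v w\<bar> powr \<alpha>) \<ge> c}"
    have "emeasure M ?S = (\<integral>\<^sup>+w. indicator ?S w \<partial>M)" by simp
    also have "\<dots> \<le> (\<integral>\<^sup>+w. ennreal (exp (- (s * c))) * (\<Prod>v\<in>J. ?f (Y v w)) \<partial>M)"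
    proof (intro nn_integral_mono)
      fix w
      have "(\<Prod>v\<in>J. ?f (Y v w)) = ennreal (exp (s * (\<Sum>v\<in>J. \<bar>Y v w\<bar> powr \<alpha>)))"
        by (simp add: prod_ennreal exp_sum J sum_distrib_left)
      then have "ennreal (exp (- (s * c))) * (\<Prod>v\<in>J. ?f (Y v w)) =
          ennreal (exp (s * (\<Sum>v\<in>J. \<bar>Y v w\<bar> powr \<alpha>) - s * c))"
        by (simp add: exp_diff exp_minus field_simps flip: ennreal_mult)
      moreover have "1 \<le> ennreal (exp (s * (\<Sum>v\<in>J. \<bar>Y v w\<bar> powr \<alpha>) - s * c))" if "w \<in> ?S"
        using that assms by (auto simp: one_le_exp_iff intro!: mult_left_mono)
      ultimately show "indicator ?S w \<le> ennreal (exp (- (s * c))) * (\<Prod>v\<in>J. ?f (Y v w))"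
        by (auto simp: indicator_def)
    qed
    also have "\<dots> = ennreal (exp (- (s * c))) * (\<integral>\<^sup>+w. (\<Prod>v\<in>J. ?f (Y v w)) \<partial>M)"
      by (intro nn_integral_cmult) measurable
    also have "(\<integral>\<^sup>+w. (\<Prod>v\<in>J. ?f (Y v w)) \<partial>M) = (\<Prod>v\<in>J. \<integral>\<^sup>+w. ?f (Y v w) \<partial>M)"
      by (intro indep_vars_nn_integral J indep_vars_compose2[OF indep_vars_subset[OF indep_Y J(2)]]) auto
    also have "\<dots> \<le> (\<Prod>v\<in>J. ennreal C)"
    proof (rule prod_mono_ennreal)
      fix v assume "v \<in> J"
      then have "(\<integral>\<^sup>+w. ?f (Y v w) \<partial>M) = (\<integral>\<^sup>+w. ?f (X w) \<partial>N)"
        using J by (intro nn_integral_Y) auto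
      then show "(\<integral>\<^sup>+w. ?f (Y v w) \<partial>M) \<le> ennreal C" using C by simp
    qed
    also have "ennreal (exp (- (s * c))) * \<dots> = ennreal (C ^ card J * exp (- (s * c)))"
      using C by (simp add: ennreal_power ennreal_mult mult.commute)
    finally show "prob ?S \<le> C ^ card J * exp (- (s * c))"
      using C by (simp add: emeasure_eq_measure mult_left_mono)
  qed
qed

text \<open>The mass of the tail beyond \<open>\<bar>x\<bar> + \<delta> / 3\<close> is concentrated near its left end.\<close>

lemma local_lower_bound:
  assumes "\<delta> > 0"
  shows "\<forall>\<^sub>F n in sequentially. exp (- (lam * (\<bar>x\<bar> + \<delta>) powr \<alpha> * real n powr (\<alpha> / 2))) \<le>
     measure N {w \<in> space N. \<bar>X w - sqrt (real n) * x\<bar> < sqrt (real n) * \<delta>}"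
proof -
  \<comment> \<open>Only displacements between \<open>y1\<close> and \<open>y2\<close> are used; the
    radius \<open>y3\<close> of the claim is strictly larger, which leaves room for subtracting two
    tail estimates.\<close>
  define y1 y2 y3 where "y1 = \<bar>x\<bar> + \<delta> / 3" and "y2 = \<bar>x\<bar> + 2 * \<delta> / 3" and "y3 = \<bar>x\<bar> + \<delta>"
  have y: "0 < y1" "y1 < y2" "y2 < y3" using assms by (auto simp: y1_def y2_def y3_def)
  define p1 p2 p3 where "p1 = y1 powr \<alpha>" and "p2 = y2 powr \<alpha>" and "p3 = y3 powr \<alpha>"
  have p: "0 < p1" "p1 < p2" "p2 < p3"
    unfolding p1_def p2_def p3_def using y \<alpha>_pos by (auto intro!: powr_less_mono2)
  \<comment> \<open>Makes \<eta> (p1 + p2) half of p2 - p1, so that (1 + \<eta>) p1 stays below (1 -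
    \<eta>) p2 and the far tail is negligible against the near one.\<close>
  define \<eta> where "\<eta> = (p2 - p1) / (2 * (p1 + p2))"
  have \<eta>: "0 < \<eta>" using p by (simp add: \<eta>_def)
  define a1 a2 a3 where "a1 = (1 + \<eta>) * lam * p1" and "a2 = (1 - \<eta>) * lam * p2" and "a3 = lam * p3"
  have "(1 + \<eta>) * p1 < (1 - \<eta>) * p2"
  proof -
    have "p1 + p2 \<noteq> 0" using p by simp
    then have "\<eta> * (p1 + p2) = (p2 - p1) / 2"
      unfolding \<eta>_def by (metis divide_divide_eq_left' mult.commute nonzero_mult_div_cancel_left times_divide_eq_right)
    then have "\<eta> * (p1 + p2) < p2 - p1" using p by simp
    then show ?thesis by (simp add: algebra_simps)
  qed
  then have a12: "a1 < a2" using lam_pos by (simp add: a1_def a2_def mult.assoc mult.left_commute[of _ lam])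
  have "(1 - \<eta>) * p2 \<le> p2" using \<eta> p by simp
  then have "(1 - \<eta>) * p2 < p3" using p by linarith
  then have "a2 < a3" using lam_pos by (simp add: a2_def a3_def mult.assoc mult.left_commute[of _ lam])
  have sq: "filterlim (\<lambda>n::nat. sqrt (real n) * y) at_top sequentially" if "y > 0" for y
    using that by real_asymp
  have pw: "(sqrt (real n) * y) powr \<alpha> = y powr \<alpha> * real n powr (\<alpha> / 2)" if "y > 0" for y n
    using that by (simp add: powr_mult powr_half_sqrt[symmetric] powr_powr)
  have Nlim: "filterlim (\<lambda>n::nat. real n powr (\<alpha> / 2)) at_top sequentially"
    using \<alpha>_pos by real_asymp
  have big: "\<forall>\<^sub>F t in at_top. exp (- (a2 * t)) + exp (- (a3 * t)) \<le> exp (- (a1 * (t::real)))"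
    using exp_sum_le_eventually[of a1 a2 a3 1] a12 \<open>a2 < a3\<close> by simp
  have "\<forall>\<^sub>F n in sequentially. exp (- ((1 + \<eta>) * lam * (sqrt (real n) * y1) powr \<alpha>)) \<le> measure N {w \<in> space N. X w > sqrt (real n) * y1}"
    using filterlim_iff[THEN iffD1, OF sq[OF y(1)], rule_format, OF tail_bounds[OF \<eta>]]
    by eventually_elim simp
  moreover have "\<forall>\<^sub>F n in sequentially. measure N {w \<in> space N. X w > sqrt (real n) * y2} \<le> exp (- ((1 - \<eta>) * lam * (sqrt (real n) * y2) powr \<alpha>))"
    using filterlim_iff[THEN iffD1, OF sq, rule_format, OF _ tail_bounds[OF \<eta>], of y2] y
    by (auto elim!: eventually_mono)
  moreover have "\<forall>\<^sub>F n in sequentially. exp (- (a2 * real n powr (\<alpha> / 2))) + exp (- (a3 * real n powr (\<alpha> / 2))) \<le> exp (- (a1 * real n powr (\<alpha> / 2)))"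
    using filterlim_iff[THEN iffD1, OF Nlim, rule_format, OF big] .
  ultimately show ?thesis using eventually_gt_at_top[of 0]
  proof eventually_elim
    case (elim n)
    let ?N = "real n powr (\<alpha> / 2)"
    let ?r = "sqrt (real n)"
    have r: "?r > 0" using elim by simp
    have "exp (- (a1 * ?N)) \<le> measure N {w \<in> space N. X w > ?r * y1}"
      using elim(1) y by (simp add: pw a1_def p1_def mult.assoc)
    moreover have "measure N {w \<in> space N. X w > ?r * y2} \<le> exp (- (a2 * ?N))"
      using elim(2) y by (simp add: pw a2_def p2_def mult.assoc)
    moreover have "measure N {w \<in> space N. X w > ?r * y1} \<le>
        measure N {w \<in> space N. X w > ?r * y2} + measure N {w \<in> space N. X w \<in> {?r * y1<..?r * y2}}"
    proof -
      have "{w \<in> space N. X w > ?r * y1} \<subseteq> {w \<in> space N. X w > ?r * y2} \<union> {w \<in> space N. X w \<in> {?r * y1<..?r * y2}}"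
        by auto
      then have "measure N {w \<in> space N. X w > ?r * y1} \<le>
          measure N ({w \<in> space N. X w > ?r * y2} \<union> {w \<in> space N. X w \<in> {?r * y1<..?r * y2}})"
        by (intro N.finite_measure_mono) auto
      also have "\<dots> \<le> measure N {w \<in> space N. X w > ?r * y2} + measure N {w \<in> space N. X w \<in> {?r * y1<..?r * y2}}"
        by (intro measure_Un_le) auto
      finally show ?thesis .
    qed
    ultimately have "exp (- (a3 * ?N)) \<le> measure N {w \<in> space N. X w \<in> {?r * y1<..?r * y2}}"
      using elim(3) by linarith
    also have "\<dots> \<le> measure N {w \<in> space N. \<bar>X w - ?r * x\<bar> < ?r * \<delta>}"
    proof (cases "x \<ge> 0")
      case True
      have "{w \<in> space N. X w \<in> {?r * y1<..?r * y2}} \<subseteq> {w \<in> space N. \<bar>X w - ?r * x\<bar> < ?r * \<delta>}"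
        using True mult_pos_pos[OF r assms] by (auto simp: y1_def y2_def abs_less_iff algebra_simps)
      then show ?thesis by (intro N.finite_measure_mono) auto
    next
      case False
      \<comment> \<open>For negative x the window lies on the left; symmetry of X reflects it to the
        right.\<close>
      have "measure N {w \<in> space N. X w \<in> {?r * y1<..?r * y2}} = measure N {w \<in> space N. - X w \<in> {?r * y1<..?r * y2}}"
        by (rule prob_neg_X[symmetric]) simp
      also have "{w \<in> space N. - X w \<in> {?r * y1<..?r * y2}} \<subseteq> {w \<in> space N. \<bar>X w - ?r * x\<bar> < ?r * \<delta>}"
        using False mult_pos_pos[OF r assms] by (auto simp: y1_def y2_def abs_less_iff algebra_simps)
      then have "measure N {w \<in> space N. - X w \<in> {?r * y1<..?r * y2}} \<le> measure N {w \<in> space N. \<bar>X w - ?r * x\<bar> < ?r * \<delta>}"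
        by (intro N.finite_measure_mono) auto
      finally show ?thesis .
    qed
    finally show ?case by (simp add: a3_def p3_def y3_def)
  qed
qed

end

section \<open>Measurability and conditioning on independent variables\<close>

lemma path_sum_measurable:
  assumes "\<And>y. y \<noteq> [] \<Longrightarrow> prefix y z \<Longrightarrow> (\<lambda>w. F w y) \<in> borel_measurable R"
  shows "(\<lambda>w. path_sum (F w) z) \<in> borel_measurable R"
  unfolding path_sum_def using assms by (intro borel_measurable_sum) auto

lemma gen_avg_measurable:
  assumes "\<And>v. v \<in> generation b k \<Longrightarrow> (\<lambda>w. F w v) \<in> borel_measurable R"
  shows "(\<lambda>w. gen_avg b k (F w)) \<in> borel_measurable R"
  unfolding gen_avg_def using assms by measurable

text \<open>Conditioning on \<open>U\<close> amounts to freezing its value.\<close>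

lemma (in prob_space) indep_var_prob_le:
  assumes indep: "indep_var S U T V"
    and B: "{p \<in> space (S \<Otimes>\<^sub>M T). Q (fst p) (snd p)} \<in> sets (S \<Otimes>\<^sub>M T)"
    and le: "\<And>u. u \<in> space S \<Longrightarrow> prob {w \<in> space M. Q u (V w)} \<le> c"
  shows "prob {w \<in> space M. Q (U w) (V w)} \<le> c"
proof -
  have U[measurable]: "random_variable S U" and V[measurable]: "random_variable T V"
    using indep by (auto dest: indep_var_rv1 indep_var_rv2)
  interpret PU: prob_space "distr M S U" by (rule prob_space_distr) simp
  interpret PV: prob_space "distr M T V" by (rule prob_space_distr) simp
  let ?B = "{p \<in> space (S \<Otimes>\<^sub>M T). Q (fst p) (snd p)}"
  obtain w0 where "w0 \<in> space M" using not_empty by auto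
  then have "U w0 \<in> space S" using U by (auto simp: measurable_def)
  then have c: "0 \<le> c" using le measure_nonneg order_trans by blast
  have in_space: "U w \<in> space S" "V w \<in> space T" if "w \<in> space M" for w
    using that U V by (auto simp: measurable_def)
  have eq: "{w \<in> space M. Q (U w) (V w)} = (\<lambda>w. (U w, V w)) -` ?B \<inter> space M"
    using in_space by (auto simp: space_pair_measure)
  have B': "?B \<in> sets (distr M S U \<Otimes>\<^sub>M distr M T V)" using B by simp
  have "emeasure M {w \<in> space M. Q (U w) (V w)} = emeasure (distr M (S \<Otimes>\<^sub>M T) (\<lambda>w. (U w, V w))) ?B"
    unfolding eq by (rule emeasure_distr[symmetric]) (use B in auto)
  also have "\<dots> = emeasure (distr M S U \<Otimes>\<^sub>M distr M T V) ?B"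
    using indep by (simp add: indep_var_distribution_eq)
  also have "\<dots> = (\<integral>\<^sup>+u. emeasure (distr M T V) (Pair u -` ?B) \<partial>distr M S U)"
    by (rule PV.emeasure_pair_measure_alt[OF B'])
  also have "\<dots> \<le> (\<integral>\<^sup>+u. ennreal c \<partial>distr M S U)"
  proof (intro nn_integral_mono)
    fix u assume "u \<in> space (distr M S U)"
    then have u: "u \<in> space S" by simp
    have "emeasure (distr M T V) (Pair u -` ?B) = emeasure M (V -` (Pair u -` ?B) \<inter> space M)"
      using sets_Pair1[OF B, of u] by (intro emeasure_distr) auto
    also have "V -` (Pair u -` ?B) \<inter> space M = {w \<in> space M. Q u (V w)}"
      using u in_space by (auto simp: space_pair_measure)
    finally show "emeasure (distr M T V) (Pair u -` ?B) \<le> ennreal c"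
      using le[OF u] c by (simp add: emeasure_eq_measure)
  qed
  also have "\<dots> = ennreal c" using PU.emeasure_space_1 by simp
  finally show ?thesis using c by (simp add: emeasure_eq_measure)
qed

text \<open>The mass of the field cut off after generation k: a random ray then matters only through
  its first k coordinates, which form a uniform vertex of that generation.\<close>

definition level_mass :: "nat \<Rightarrow> real set \<Rightarrow> nat \<Rightarrow> (nat list \<Rightarrow> real) \<Rightarrow> real" where
  "level_mass b A k h = gen_avg b k (\<lambda>u. gauss_shift A (path_sum h u))"

section \<open>Central limit theorem, uniform in vertex sets and starting points\<close>

context branching_walk
begin

text \<open>Both sums have the characteristic function of X raised to the number of
  summands.\<close>

lemma distr_sum_eq:
  assumes "finite J" "J \<subseteq> tree b - {[]}" "finite J'" "J' \<subseteq> tree b - {[]}" "card J = card J'"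
  shows "distr M borel (\<lambda>w. \<Sum>v\<in>J. Y v w) = distr M borel (\<lambda>w. \<Sum>v\<in>J'. Y v w)"
proof (rule Levy_uniqueness)
  have rv: "(\<lambda>w. \<Sum>v\<in>J. Y v w) \<in> borel_measurable M" if "J \<subseteq> tree b - {[]}" for J
    using that Y_borel by (intro borel_measurable_sum) auto
  show "real_distribution (distr M borel (\<lambda>w. \<Sum>v\<in>J. Y v w))"
    "real_distribution (distr M borel (\<lambda>w. \<Sum>v\<in>J'. Y v w))"
    using assms by (auto intro!: rv)
  have ch: "char (distr M borel (\<lambda>w. \<Sum>v\<in>J. Y v w)) t = char (distr N borel X) t ^ card J"
    if "J \<subseteq> tree b - {[]}" for J t
  proof -
    have "char (distr M borel (\<lambda>w. \<Sum>v\<in>J. Y v w)) t = (\<Prod>v\<in>J. char (distr M borel (Y v)) t)"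
      by (rule char_distr_sum[OF indep_vars_subset[OF indep_Y that]])
    also have "\<dots> = (\<Prod>v\<in>J. char (distr N borel X) t)"
      using that by (intro prod.cong refl) (simp add: distr_Y subset_iff)
    finally show ?thesis by simp
  qed
  show "char (distr M borel (\<lambda>w. \<Sum>v\<in>J. Y v w)) = char (distr M borel (\<lambda>w. \<Sum>v\<in>J'. Y v w))"
    using assms by (auto simp: ch)
qed

lemma integral_Y:
  assumes "v \<in> tree b - {[]}" and [measurable]: "f \<in> borel_measurable borel"
  shows "integrable M (\<lambda>w. f (Y v w)) = integrable N (\<lambda>w. f (X w))"
    and "(LINT w|M. f (Y v w)) = (LINT w|N. f (X w :: real) :: real)"
proof -
  note [measurable] = Y_borel[OF assms(1)]
  show "integrable M (\<lambda>w. f (Y v w)) = integrable N (\<lambda>w. f (X w))"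
    using integrable_distr_eq[of "Y v" M borel f] integrable_distr_eq[of X N borel f] distr_Y[OF assms(1)] by simp
  show "(LINT w|M. f (Y v w)) = (LINT w|N. f (X w))"
    using integral_distr[of "Y v" M borel f] integral_distr[of X N borel f] distr_Y[OF assms(1)] by simp
qed

text \<open>The central limit theorem is applied along one ray; the law of a sum of displacements
  depends only on the number of summands.\<close>

lemma clt_uniform:
  assumes k: "(\<lambda>n. real (k n) / real n) \<longlonglongrightarrow> 1" and \<epsilon>: "\<epsilon> > 0"
  shows "\<forall>\<^sub>F n in sequentially. \<forall>J t. finite J \<longrightarrow> J \<subseteq> tree b - {[]} \<longrightarrow> card J = k n \<longrightarrow>
    \<bar>cdf (distr M borel (\<lambda>w. (\<Sum>v\<in>J. Y v w) / sqrt (real n))) t - cdf std_normal_distribution t\<bar> \<le> \<epsilon>"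
proof -
  \<comment> \<open>The vertices of the ray (1, 1, 1, ...); \<open>Suc i\<close> keeps the root
    out.\<close>
  define R where "R i = replicate (Suc i) (1::nat)" for i :: nat
  have R: "R i \<in> tree b - {[]}" for i using b_ge by (auto simp: R_def tree_def)
  have injR: "inj_on R S" for S by (rule inj_onI) (auto simp: R_def dest: arg_cong[where f=length])
  define S where "S n w = (\<Sum>i<n. Y (R i) w)" for n w
  have [measurable]: "Y (R i) \<in> borel_measurable M" for i using Y_borel R by auto
  have [measurable]: "S n \<in> borel_measurable M" for n unfolding S_def by measurable
  have S_eq: "S n w = (\<Sum>v\<in>R ` {..<n}. Y v w)" for n w
    unfolding S_def by (subst sum.reindex) (auto simp: injR)
  have "indep_vars (\<lambda>i. \<Pi>\<^sub>M v\<in>{R i}. borel) (\<lambda>i w. restrict (\<lambda>v. Y v w) {R i}) UNIV"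
    using R injR[of UNIV] by (intro indep_vars_restrict[OF indep_Y]) (auto simp: disjoint_family_on_def inj_on_def)
  then have "indep_vars (\<lambda>i. borel) (\<lambda>i w. (\<lambda>f. f (R i)) (restrict (\<lambda>v. Y v w) {R i})) UNIV"
    by (rule indep_vars_compose2) auto
  then have "indep_vars (\<lambda>i. borel) (\<lambda>i. Y (R i)) UNIV" by simp
  then have "weak_conv_m (\<lambda>n. distr M borel (\<lambda>w. (\<Sum>i<n. Y (R i) w) / sqrt (real n * 1\<^sup>2))) std_normal_distribution"
    using integral_Y[OF R, of "\<lambda>x. x"] integral_Y[OF R, of "\<lambda>x. x\<^sup>2"] mean variance
    by (intro central_limit_theorem_zero_mean[where \<mu>="distr N borel X"]) (auto intro!: distr_Y[OF R])
  then have clt: "weak_conv_m (\<lambda>n. distr M borel (\<lambda>w. S n w / sqrt (real n))) std_normal_distribution"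
    by (simp add: S_def)
  define F where "F n t = cdf (distr M borel (\<lambda>w. S n w / sqrt (real n))) t" for n t
  define G where "G n t = cdf (distr M borel (\<lambda>w. S (k n) w / sqrt (real n))) t" for n t
  let ?\<Phi> = "cdf std_normal_distribution"
  have cdf_props: "cdf (distr M borel f) s \<le> cdf (distr M borel f) t"
    "0 \<le> cdf (distr M borel f) t \<and> cdf (distr M borel f) t \<le> 1"
    if "s \<le> t" "f \<in> borel_measurable M" for f s t
  proof -
    interpret Q: real_distribution "distr M borel f" using that by simp
    show "cdf (distr M borel f) s \<le> cdf (distr M borel f) t" using that by (intro Q.cdf_nondecreasing)
    show "0 \<le> cdf (distr M borel f) t \<and> cdf (distr M borel f) t \<le> 1"
      using Q.cdf_nonneg Q.cdf_bounded_prob by auto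
  qed
  have unif: "\<forall>\<^sub>F n in sequentially. \<forall>t. \<bar>F n t - ?\<Phi> t\<bar> \<le> e" if "e > 0" for e
  proof (rule std_normal_polya[OF _ _ _ that])
    show "F n s \<le> F n t" if "s \<le> t" for n s t using that by (auto simp: F_def intro!: cdf_props)
    show "0 \<le> F n t \<and> F n t \<le> 1" for n t unfolding F_def by (rule cdf_props(2)[of t]) auto
    show "(\<lambda>n. F n t) \<longlonglongrightarrow> ?\<Phi> t" for t
      using clt isCont_std_normal_cdf by (auto simp: weak_conv_m_def weak_conv_def F_def)
  qed
  have "filterlim (\<lambda>n. real (k n) / real n * real n) at_top sequentially"
    by (rule filterlim_tendsto_pos_mult_at_top[OF k _ filterlim_real_sequentially]) simp
  moreover have "\<forall>\<^sub>F n in sequentially. real (k n) / real n * real n = real (k n)"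
    using eventually_gt_at_top[of 0] by eventually_elim simp
  ultimately have rk: "filterlim (\<lambda>n. real (k n)) at_top sequentially"
    by (rule filterlim_cong[OF refl refl, THEN iffD1, rotated])
  then have k_top: "filterlim k at_top sequentially"
    by (simp add: filterlim_sequentially_iff_filterlim_real)
  \<comment> \<open>A sum of \<open>k n\<close> terms is divided by sqrt n. The mismatch moves into
    the argument of \<open>F\<close>, where the ratio tends to 1.\<close>
  have G_eq: "\<forall>\<^sub>F n in sequentially. \<forall>t. G n t = F (k n) (t / sqrt (real (k n) / real n))"
    using eventually_gt_at_top[of 0] filterlim_at_top_dense[THEN iffD1, OF rk, rule_format, of 0]
  proof eventually_elim
    case (elim n)
    show ?case
    proof
      fix t
      have "x / sqrt (real n) \<le> t \<longleftrightarrow> x / sqrt (real (k n)) \<le> t / sqrt (real (k n) / real n)" for x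
        using elim by (simp add: real_sqrt_divide field_simps)
      then show "G n t = F (k n) (t / sqrt (real (k n) / real n))"
        unfolding G_def F_def cdf_def by (subst (1 2) measure_distr) (auto simp: vimage_def)
    qed
  qed
  have G_unif: "\<forall>\<^sub>F n in sequentially. \<forall>t. \<bar>G n t - ?\<Phi> t\<bar> \<le> \<epsilon>"
  proof (rule std_normal_polya[OF _ _ _ \<epsilon>])
    show "G n s \<le> G n t" if "s \<le> t" for n s t using that by (auto simp: G_def intro!: cdf_props)
    show "0 \<le> G n t \<and> G n t \<le> 1" for n t unfolding G_def by (rule cdf_props(2)[of t]) auto
    fix t
    let ?s = "\<lambda>n. t / sqrt (real (k n) / real n)"
    have "?s \<longlonglongrightarrow> t / sqrt 1" by (intro tendsto_intros k) auto
    then have "(\<lambda>n. ?\<Phi> (?s n)) \<longlonglongrightarrow> ?\<Phi> t"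
      by (intro isCont_tendsto_compose[OF isCont_std_normal_cdf]) simp
    \<comment> \<open>The argument moves with n, so pointwise convergence is not enough; the uniform
      version is used along \<open>k n\<close>.\<close>
    moreover have "(\<lambda>n. F (k n) (?s n) - ?\<Phi> (?s n)) \<longlonglongrightarrow> 0"
    proof (rule tendstoI)
      fix e :: real assume "e > 0"
      have "\<forall>\<^sub>F n in sequentially. \<forall>t. \<bar>F (k n) t - ?\<Phi> t\<bar> \<le> e / 2"
        using filterlim_iff[THEN iffD1, OF k_top, rule_format, OF unif[of "e / 2"]] \<open>e > 0\<close> by simp
      then show "\<forall>\<^sub>F n in sequentially. dist (F (k n) (?s n) - ?\<Phi> (?s n)) 0 < e"
      proof eventually_elim
        case (elim n)
        then have "\<bar>F (k n) (?s n) - ?\<Phi> (?s n)\<bar> \<le> e / 2" by blast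
        then show ?case using \<open>e > 0\<close> by (simp add: dist_real_def)
      qed
    qed
    ultimately have "(\<lambda>n. (F (k n) (?s n) - ?\<Phi> (?s n)) + ?\<Phi> (?s n)) \<longlonglongrightarrow> 0 + ?\<Phi> t"
      by (intro tendsto_add)
    then have "(\<lambda>n. F (k n) (?s n)) \<longlonglongrightarrow> ?\<Phi> t" by simp
    then show "(\<lambda>n. G n t) \<longlonglongrightarrow> ?\<Phi> t"
    proof (rule Lim_transform_eventually)
      show "\<forall>\<^sub>F n in sequentially. F (k n) (?s n) = G n t" using G_eq by eventually_elim simp
    qed
  qed
  then show ?thesis
  proof eventually_elim
    case (elim n)
    show ?case
    proof (intro allI impI)
      fix J t assume J: "finite J" "J \<subseteq> tree b - {[]}" "card J = k n"
      have [measurable]: "(\<lambda>w. \<Sum>v\<in>J. Y v w) \<in> borel_measurable M"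
        using J Y_borel by (intro borel_measurable_sum) auto
      have scale: "distr M borel (\<lambda>w. f w / sqrt (real n)) = distr (distr M borel f) borel (\<lambda>x. x / sqrt (real n))"
        if "f \<in> borel_measurable M" for f
        using that by (simp add: distr_distr comp_def)
      have "distr M borel (\<lambda>w. \<Sum>v\<in>J. Y v w) = distr M borel (\<lambda>w. \<Sum>v\<in>R ` {..<k n}. Y v w)"
        using J R injR by (intro distr_sum_eq) (auto simp: card_image)
      then have "distr M borel (\<lambda>w. \<Sum>v\<in>J. Y v w) = distr M borel (S (k n))" by (simp add: S_eq[abs_def])
      then have "distr M borel (\<lambda>w. (\<Sum>v\<in>J. Y v w) / sqrt (real n)) = distr M borel (\<lambda>w. S (k n) w / sqrt (real n))"
        by (subst (1 2) scale) auto
      then show "\<bar>cdf (distr M borel (\<lambda>w. (\<Sum>v\<in>J. Y v w) / sqrt (real n))) t - ?\<Phi> t\<bar> \<le> \<epsilon>"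
        using elim by (simp add: G_def)
    qed
  qed
qed

text \<open>The starting point x merely translates A, and the error depends only on the number of
  intervals. It is therefore uniform in x, as needed when the positions in an earlier generation are
  frozen.\<close>

lemma clt_interval_union:
  assumes A: "disjoint_interval_union r A"
    and k: "(\<lambda>n. real (k n) / real n) \<longlonglongrightarrow> 1" and \<epsilon>: "\<epsilon> > 0"
  shows "\<forall>\<^sub>F n in sequentially. \<forall>J x. finite J \<longrightarrow> J \<subseteq> tree b - {[]} \<longrightarrow> card J = k n \<longrightarrow>
    \<bar>prob {w \<in> space M. (x + (\<Sum>v\<in>J. Y v w)) / sqrt (real n) \<in> A} - gauss_shift A (x / sqrt (real n))\<bar> \<le> \<epsilon>"
proof -
  define e where "e = \<epsilon> / (2 * real r + 1)"
  have e: "e > 0" "2 * real r * e \<le> \<epsilon>" using \<epsilon> by (auto simp: e_def field_simps)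
  have [measurable]: "A \<in> sets borel" by (rule disjoint_interval_union_borel[OF A])
  show ?thesis using clt_uniform[OF k e(1)]
  proof eventually_elim
    case (elim n)
    show ?case
    proof (intro allI impI)
      fix J x assume J: "finite J" "J \<subseteq> tree b - {[]}" "card J = k n"
      have [measurable]: "(\<lambda>w. \<Sum>v\<in>J. Y v w) \<in> borel_measurable M"
        using J Y_borel by (intro borel_measurable_sum) auto
      let ?P = "distr M borel (\<lambda>w. (\<Sum>v\<in>J. Y v w) / sqrt (real n))"
      have "measure ?P {z. 1 * z + x / sqrt (real n) \<in> A} =
          prob {w \<in> space M. (x + (\<Sum>v\<in>J. Y v w)) / sqrt (real n) \<in> A}"
        by (subst measure_distr) (auto intro!: arg_cong[where f=prob] simp: add_divide_distrib add.commute)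
      moreover have "\<bar>measure ?P {z. 1 * z + x / sqrt (real n) \<in> A} -
          measure std_normal_distribution {z. 1 * z + x / sqrt (real n) \<in> A}\<bar> \<le> 2 * real r * e"
        using elim J by (intro interval_union_measure_diff_le[OF A]) (auto simp: real_dist_normal_dist)
      ultimately show "\<bar>prob {w \<in> space M. (x + (\<Sum>v\<in>J. Y v w)) / sqrt (real n) \<in> A} - gauss_shift A (x / sqrt (real n))\<bar> \<le> \<epsilon>"
        using e(2) by (simp add: gauss_shift_eq)
    qed
  qed
qed

end

locale walk_in_set = branching_walk +
  fixes A :: "real set" and r :: nat
  assumes A: "disjoint_interval_union r A"
begin

text \<open>The prediction for the empirical mass from the first k generations: each particle is
  replaced by a Gaussian cloud around its rescaled position.\<close>

definition mass_at :: "nat \<Rightarrow> nat \<Rightarrow> 'a \<Rightarrow> real" where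
  "mass_at n k w = level_mass b A k (\<lambda>v. Y v w / sqrt (real n))"

definition empirical :: "nat \<Rightarrow> 'a \<Rightarrow> real" where
  "empirical n w = brw_empirical b Y n w ((\<lambda>a. sqrt (real n) * a) ` A)"

lemma A_borel [measurable]: "A \<in> sets borel"
  by (rule disjoint_interval_union_borel[OF A])

lemma gauss_shift_A_measurable [measurable]: "gauss_shift A \<in> borel_measurable borel"
  by (rule gauss_shift_measurable[OF A])

lemma mass_at_measurable [measurable]: "mass_at n k \<in> borel_measurable M"
proof -
  have "(\<lambda>w. path_sum (\<lambda>v. Y v w / sqrt (real n)) u) \<in> borel_measurable M" if "u \<in> generation b k" for u
  proof (rule path_sum_measurable)
    fix y assume y: "y \<noteq> []" "prefix y u"
    with that have "y \<in> tree b - {[]}" by (auto simp: generation_def intro: prefix_in_tree)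
    then show "(\<lambda>w. Y y w / sqrt (real n)) \<in> borel_measurable M" using Y_borel by auto
  qed
  then show ?thesis unfolding mass_at_def[abs_def] level_mass_def
    by (intro gen_avg_measurable measurable_compose[OF _ gauss_shift_A_measurable])
qed

subsection \<open>Averaging over many independent subtrees\<close>

text \<open>With the first m generations frozen, the subtrees of the b^m vertices are independent
  and each contributes a variable in [0, 1]. Half of \<epsilon> pays for the central limit error of
  the means, the other half for the fluctuation around them.\<close>

lemma hoeffding_level:
  assumes n: "n > 0" "m \<le> n" and \<epsilon>: "\<epsilon> > 0"
    and clt: "\<And>J x. finite J \<Longrightarrow> J \<subseteq> tree b - {[]} \<Longrightarrow> card J = n - m \<Longrightarrow>
      \<bar>prob {w \<in> space M. (x + (\<Sum>v\<in>J. Y v w)) / sqrt (real n) \<in> A} - gauss_shift A (x / sqrt (real n))\<bar> \<le> \<epsilon> / 2"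
  shows "prob {w \<in> space M. \<epsilon> < \<bar>empirical n w - mass_at n m w\<bar>} \<le> 2 * exp (- (\<epsilon>\<^sup>2 / 2 * real b ^ m))"
proof -
  define k where "k = n - m"
  define S where "S = {z. z / sqrt (real n) \<in> A}"
  have S[measurable]: "S \<in> sets borel" unfolding S_def by measurable
  have S_eq: "(\<lambda>a. sqrt (real n) * a) ` A = S"
    unfolding S_def using n by (force simp: image_iff)
  define K1 where "K1 = levels b m"
  define K2 where "K2 = levels b n - levels b m"
  let ?P1 = "\<Pi>\<^sub>M v\<in>K1. (borel :: real measure)" and ?P2 = "\<Pi>\<^sub>M v\<in>K2. (borel :: real measure)"
  define U where "U w = restrict (\<lambda>v. Y v w) K1" for w
  define V where "V w = restrict (\<lambda>v. Y v w) K2" for w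
  have indep: "indep_var ?P1 U ?P2 V"
    unfolding U_def[abs_def] V_def[abs_def] using levels_subset
    by (intro indep_var_restrict[OF indep_Y]) (auto simp: K1_def K2_def)
  \<comment> \<open>The event as a predicate on two separate families of values, those of the first
    m generations and those below, as conditioning requires.\<close>
  define Q where "Q u v \<longleftrightarrow> \<epsilon> < \<bar>gen_avg b m (\<lambda>a. gen_avg b k (\<lambda>z.
      indicator S (path_sum u a + path_sum (\<lambda>y. v (a @ y)) z)) - gauss_shift A (path_sum u a / sqrt (real n)))\<bar>"
    for u v :: "nat list \<Rightarrow> real"
  have in_K1: "y \<in> K1" if "a \<in> generation b m" "y \<noteq> []" "prefix y a" for a y
    using that prefix_in_levels by (auto simp: K1_def)
  have in_levels: "y \<in> levels b k" if "z \<in> generation b k" "y \<noteq> []" "prefix y z" for z y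
    using that prefix_in_levels by auto
  have app_K2: "a @ y \<in> K2" if "a \<in> generation b m" "y \<in> levels b k" for a y
    using that n by (auto simp: K2_def levels_def generation_def tree_append_iff k_def)
  have QUV: "Q (U w) (V w) \<longleftrightarrow> \<epsilon> < \<bar>empirical n w - mass_at n m w\<bar>" for w
  proof -
    have "empirical n w = gen_avg b (m + k) (\<lambda>u. indicator S (walk Y u w))"
      using n by (simp add: empirical_def S_eq brw_empirical_eq[OF b_ge_1] k_def)
    also have "\<dots> = gen_avg b m (\<lambda>a. gen_avg b k (\<lambda>z.
        indicator S (path_sum (U w) a + path_sum (\<lambda>y. V w (a @ y)) z)))"
      unfolding gen_avg_add_generation
    proof (intro gen_avg_cong arg_cong[where f="indicator S"])
      fix a z assume a: "a \<in> generation b m" and z: "z \<in> generation b k"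
      have "path_sum (U w) a = path_sum (\<lambda>v. Y v w) a"
        by (rule path_sum_cong) (auto simp: U_def in_K1[OF a])
      moreover have "path_sum (\<lambda>y. V w (a @ y)) z = path_sum (\<lambda>y. Y (a @ y) w) z"
        by (rule path_sum_cong) (auto simp: V_def app_K2[OF a in_levels[OF z]])
      ultimately show "walk Y (a @ z) w = path_sum (U w) a + path_sum (\<lambda>y. V w (a @ y)) z"
        by (simp add: walk_eq_path_sum path_sum_append)
    qed
    finally have emp: "empirical n w = \<dots>" .
    have "mass_at n m w = gen_avg b m (\<lambda>a. gauss_shift A (path_sum (U w) a / sqrt (real n)))"
      unfolding mass_at_def level_mass_def
    proof (intro gen_avg_cong arg_cong[where f="gauss_shift A"])
      fix a assume a: "a \<in> generation b m"
      have "path_sum (U w) a = path_sum (\<lambda>v. Y v w) a"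
        by (rule path_sum_cong) (auto simp: U_def in_K1[OF a])
      then show "path_sum (\<lambda>v. Y v w / sqrt (real n)) a = path_sum (U w) a / sqrt (real n)"
        using path_sum_cmult[of "1 / sqrt (real n)"] by simp
    qed
    then show ?thesis unfolding Q_def emp gen_avg_diff by simp
  qed
  have "prob {w \<in> space M. Q (U w) (V w)} \<le> 2 * exp (- (\<epsilon>\<^sup>2 / 2 * real b ^ m))"
  proof (rule indep_var_prob_le[OF indep])
    have [measurable]: "(\<lambda>p. path_sum (fst p) a) \<in> borel_measurable (?P1 \<Otimes>\<^sub>M ?P2)" if "a \<in> generation b m" for a
      using in_K1[OF that]
      by (intro path_sum_measurable measurable_compose[OF measurable_fst measurable_component_singleton])
    have [measurable]: "(\<lambda>p. path_sum (\<lambda>y. snd p (a @ y)) z) \<in> borel_measurable (?P1 \<Otimes>\<^sub>M ?P2)"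
      if "a \<in> generation b m" "z \<in> generation b k" for a z
      using app_K2[OF that(1) in_levels[OF that(2)]]
      by (intro path_sum_measurable measurable_compose[OF measurable_snd measurable_component_singleton])
    have [measurable]: "(\<lambda>p. gen_avg b m (\<lambda>a. gen_avg b k (\<lambda>z.
        indicator S (path_sum (fst p) a + path_sum (\<lambda>y. snd p (a @ y)) z)) - gauss_shift A (path_sum (fst p) a / sqrt (real n))))
        \<in> borel_measurable (?P1 \<Otimes>\<^sub>M ?P2)"
      by (intro gen_avg_measurable borel_measurable_diff) measurable
    show "{p \<in> space (?P1 \<Otimes>\<^sub>M ?P2). Q (fst p) (snd p)} \<in> sets (?P1 \<Otimes>\<^sub>M ?P2)"
      unfolding Q_def by measurable
  next
    fix u assume "u \<in> space ?P1"
    define x where "x a = path_sum u a" for a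
    define X' where "X' a w = gen_avg b k (\<lambda>z. indicator S (x a + path_sum (\<lambda>y. Y (a @ y) w) z))" for a and w
    let ?G = "generation b m"
    have path_meas[measurable]: "(\<lambda>w. path_sum (\<lambda>y. Y (a @ y) w) z) \<in> borel_measurable M"
      if "a \<in> ?G" "z \<in> generation b k" for a z
      using app_K2[OF that(1) in_levels[OF that(2)]] levels_subset[of b n] Y_borel
      by (intro path_sum_measurable) (auto simp: K2_def)
    \<comment> \<open>Subtrees below distinct vertices of one generation use disjoint sets of
      displacements.\<close>
    have "indep_vars (\<lambda>a. \<Pi>\<^sub>M v\<in>(\<lambda>y. a @ y) ` levels b k. borel) (\<lambda>a w. restrict (\<lambda>v. Y v w) ((\<lambda>y. a @ y) ` levels b k)) ?G"
      using app_K2 levels_subset[of b n]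
      by (intro indep_vars_restrict[OF indep_Y]) (auto simp: disjoint_family_on_def generation_def K2_def)
    then have "indep_vars (\<lambda>a. borel) (\<lambda>a w. (\<lambda>f. gen_avg b k (\<lambda>z. indicator S (x a + path_sum (\<lambda>y. f (a @ y)) z)) :: real)
        (restrict (\<lambda>v. Y v w) ((\<lambda>y. a @ y) ` levels b k))) ?G"
    proof (rule indep_vars_compose2)
      fix a assume "a \<in> ?G"
      have [measurable]: "(\<lambda>f. path_sum (\<lambda>y. f (a @ y)) z) \<in> borel_measurable (\<Pi>\<^sub>M v\<in>(\<lambda>y. a @ y) ` levels b k. borel)"
        if "z \<in> generation b k" for z
        using in_levels[OF that] by (intro path_sum_measurable measurable_component_singleton) auto
      show "(\<lambda>f. gen_avg b k (\<lambda>z. indicator S (x a + path_sum (\<lambda>y. f (a @ y)) z)) :: real)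
          \<in> borel_measurable (\<Pi>\<^sub>M v\<in>(\<lambda>y. a @ y) ` levels b k. borel)"
        by (intro gen_avg_measurable) measurable
    qed
    moreover have "gen_avg b k (\<lambda>z. indicator S (x a + path_sum (\<lambda>y. (restrict (\<lambda>v. Y v w) ((\<lambda>y. a @ y) ` levels b k)) (a @ y)) z)) = X' a w" for a w
      unfolding X'_def
      by (intro gen_avg_cong arg_cong[where f="indicator S"] arg_cong2[where f="(+)"] refl path_sum_cong)
        (auto simp: in_levels)
    ultimately have indep': "indep_vars (\<lambda>a. borel) X' ?G" by simp
    have X'_bounds: "0 \<le> X' a w \<and> X' a w \<le> 1" for a w
    proof
      show "0 \<le> X' a w" unfolding X'_def by (intro gen_avg_nonneg) simp
      have "X' a w \<le> gen_avg b k (\<lambda>z. 1)" unfolding X'_def by (intro gen_avg_mono) (simp add: indicator_def)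
      then show "X' a w \<le> 1" using b_ge_1 by (simp add: gen_avg_const)
    qed
    interpret H: Hoeffding_ineq M ?G X' "\<lambda>_. 0" "\<lambda>_. 1" "\<Sum>a\<in>?G. expectation (X' a)"
      by unfold_locales (use indep' X'_bounds in auto)
    have EX: "\<bar>expectation (X' a) - gauss_shift A (x a / sqrt (real n))\<bar> \<le> \<epsilon> / 2" if a: "a \<in> ?G" for a
    proof -
      have "expectation (X' a) = gen_avg b k (\<lambda>z. expectation (\<lambda>w. indicator S (x a + path_sum (\<lambda>y. Y (a @ y) w) z)))"
        unfolding X'_def gen_avg_def using a
        by (simp, subst Bochner_Integration.integral_sum)
          (auto intro!: integrable_const_bound[of _ 1] simp: indicator_def)
      also have "\<bar>\<dots> - gen_avg b k (\<lambda>z. gauss_shift A (x a / sqrt (real n)))\<bar> \<le> \<epsilon> / 2"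
      proof (rule abs_gen_avg_diff_le[OF b_ge_1])
        fix z assume z: "z \<in> generation b k"
        \<comment> \<open>The vertices strictly below \<open>a\<close> on the path to
          \<open>a @ z\<close>: exactly n - m, the number for which the normal approximation is
          assumed.\<close>
        let ?J = "(\<lambda>y. a @ y) ` {y. strict_prefix [] y \<and> prefix y z}"
        have "expectation (\<lambda>w. indicator S (x a + path_sum (\<lambda>y. Y (a @ y) w) z)) =
            expectation (\<lambda>w. indicator ((\<lambda>w. x a + path_sum (\<lambda>y. Y (a @ y) w) z) -` S \<inter> space M) w)"
          by (intro Bochner_Integration.integral_cong) (auto simp: indicator_def)
        also have "\<dots> = prob ((\<lambda>w. x a + path_sum (\<lambda>y. Y (a @ y) w) z) -` S \<inter> space M)"
          by simp
        also have "(\<lambda>w. x a + path_sum (\<lambda>y. Y (a @ y) w) z) -` S \<inter> space M =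
            {w \<in> space M. (x a + (\<Sum>v\<in>?J. Y v w)) / sqrt (real n) \<in> A}"
          by (auto simp: S_def path_sum_def sum.reindex inj_on_def)
        finally have "expectation (\<lambda>w. indicator S (x a + path_sum (\<lambda>y. Y (a @ y) w) z)) =
            prob {w \<in> space M. (x a + (\<Sum>v\<in>?J. Y v w)) / sqrt (real n) \<in> A}" .
        moreover have "finite ?J" by (intro finite_imageI finite_prefixes)
        moreover have "card ?J = n - m"
          using z by (subst card_image) (auto simp: card_path generation_def k_def inj_on_def)
        moreover have "?J \<subseteq> tree b - {[]}"
          using app_K2[OF a in_levels[OF z]] levels_subset[of b n]
          by (auto simp: K2_def strict_prefix_def subset_iff)
        ultimately show "\<bar>expectation (\<lambda>w. indicator S (x a + path_sum (\<lambda>y. Y (a @ y) w) z)) - gauss_shift A (x a / sqrt (real n))\<bar> \<le> \<epsilon> / 2"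
          using clt[of ?J "x a"] by simp
      qed
      finally show ?thesis using b_ge_1 by (simp add: gen_avg_const)
    qed
    have bpos: "real b ^ m > 0" using b_ge by simp
    have "{w \<in> space M. Q u (V w)} \<subseteq> {w \<in> space M. \<bar>(\<Sum>a\<in>?G. X' a w) - (\<Sum>a\<in>?G. expectation (X' a))\<bar> \<ge> real b ^ m * (\<epsilon> / 2)}"
    proof safe
      fix w assume "Q u (V w)"
      moreover have "gen_avg b k (\<lambda>z. indicator S (path_sum u a + path_sum (\<lambda>y. V w (a @ y)) z)) = X' a w" if a: "a \<in> ?G" for a
        unfolding X'_def x_def
        by (intro gen_avg_cong arg_cong[where f="indicator S"] arg_cong2[where f="(+)"] refl path_sum_cong)
          (auto simp: V_def app_K2[OF a in_levels])
      then have "gen_avg b m (\<lambda>a. gen_avg b k (\<lambda>z. indicator S (path_sum u a + path_sum (\<lambda>y. V w (a @ y)) z)) - gauss_shift A (path_sum u a / sqrt (real n))) =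
          gen_avg b m (\<lambda>a. X' a w - gauss_shift A (x a / sqrt (real n)))"
        by (intro gen_avg_cong) (simp add: x_def)
      ultimately have "\<epsilon> < \<bar>gen_avg b m (\<lambda>a. X' a w) - gen_avg b m (\<lambda>a. gauss_shift A (x a / sqrt (real n)))\<bar>"
        unfolding Q_def by (simp add: gen_avg_diff)
      moreover have "\<bar>gen_avg b m (\<lambda>a. expectation (X' a)) - gen_avg b m (\<lambda>a. gauss_shift A (x a / sqrt (real n)))\<bar> \<le> \<epsilon> / 2"
        by (rule abs_gen_avg_diff_le[OF b_ge_1 EX])
      ultimately have "\<epsilon> / 2 \<le> \<bar>gen_avg b m (\<lambda>a. X' a w) - gen_avg b m (\<lambda>a. expectation (X' a))\<bar>"
        by linarith
      also have "\<dots> = \<bar>(\<Sum>a\<in>?G. X' a w) - (\<Sum>a\<in>?G. expectation (X' a))\<bar> / real b ^ m"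
        using bpos by (simp add: gen_avg_def abs_divide flip: diff_divide_distrib)
      finally show "real b ^ m * (\<epsilon> / 2) \<le> \<bar>(\<Sum>a\<in>?G. X' a w) - (\<Sum>a\<in>?G. expectation (X' a))\<bar>"
        using bpos by (simp add: field_simps)
    qed
    then have "prob {w \<in> space M. Q u (V w)} \<le> prob {w \<in> space M. \<bar>(\<Sum>a\<in>?G. X' a w) - (\<Sum>a\<in>?G. expectation (X' a))\<bar> \<ge> real b ^ m * (\<epsilon> / 2)}"
      by (intro finite_measure_mono) measurable
    also have "\<dots> \<le> 2 * exp (-2 * (real b ^ m * (\<epsilon> / 2))\<^sup>2 / (\<Sum>a\<in>?G. (1 - 0)\<^sup>2))"
      using \<epsilon> bpos by (intro H.Hoeffding_ineq_abs_ge) (auto simp: card_generation)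
    also have "-2 * (real b ^ m * (\<epsilon> / 2))\<^sup>2 / (\<Sum>a\<in>?G. (1 - 0)\<^sup>2) = - (\<epsilon>\<^sup>2 / 2 * real b ^ m)"
      using bpos by (simp add: card_generation power2_eq_square field_simps)
    finally show "prob {w \<in> space M. Q u (V w)} \<le> 2 * exp (- (\<epsilon>\<^sup>2 / 2 * real b ^ m))" .
  qed
  then show ?thesis by (simp add: QUV)
qed

lemma empirical_measurable:
  assumes "n > 0"
  shows "empirical n \<in> borel_measurable M"
proof -
  have "{z. z / sqrt (real n) \<in> A} = (\<lambda>a. sqrt (real n) * a) ` A"
    using assms by (force simp: image_iff)
  moreover have "{z. z / sqrt (real n) \<in> A} \<in> sets borel" by measurable
  ultimately have [measurable]: "(\<lambda>a. sqrt (real n) * a) ` A \<in> sets borel" by simp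
  have [measurable]: "(\<lambda>w. path_sum (\<lambda>v. Y v w) u) \<in> borel_measurable M" if "u \<in> generation b n" for u
    using prefix_in_levels[OF that] levels_subset[of b n] Y_borel by (intro path_sum_measurable) auto
  show ?thesis unfolding empirical_def[abs_def] brw_empirical_eq[OF b_ge_1] walk_eq_path_sum
    by (intro gen_avg_measurable) measurable
qed

subsection \<open>Contribution of the deep generations\<close>

text \<open>The extra 1 keeps the constant strictly positive, so that it can be divided by.\<close>

lemma gauss_shift_A_lipschitz: "\<bar>gauss_shift A x - gauss_shift A y\<bar> \<le> (2 * real r + 1) * \<bar>x - y\<bar>"
  by (rule order_trans[OF gauss_shift_lipschitz[OF A]]) (simp add: mult_right_mono)

text \<open>Each summand \<open>min 1 (B |Y|/sqrt n)\<close> is at most \<open>e/2\<close> plus a multiple of \<open>|Y|^\<alpha>\<close>.\<close>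

lemma mass_at_step_imp:
  assumes n: "n > 0" and e: "e > 0" and step: "e < \<bar>mass_at n (Suc k) w - mass_at n k w\<bar>"
  shows "e / 2 * (e / (2 * (2 * real r + 1))) powr \<alpha> * real b ^ Suc k * real n powr (\<alpha> / 2)
    \<le> (\<Sum>v\<in>generation b (Suc k). \<bar>Y v w\<bar> powr \<alpha>)"
proof -
  define B where "B = 2 * real r + 1"
  \<comment> \<open>Displacements of size at most c sqrt n change the average by at most B c =
    e/2.\<close>
  define c where "c = e / (2 * B)"
  have B: "B > 0" and c: "c > 0" using e by (auto simp: B_def c_def add_nonneg_pos)
  have rn: "sqrt (real n) > 0" using n by simp
  have bk: "real b ^ Suc k > 0" using b_ge by simp
  define K where "K = (c * sqrt (real n)) powr \<alpha>"
  have K: "K > 0" "K = c powr \<alpha> * real n powr (\<alpha> / 2)"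
    using c rn by (auto simp: K_def powr_mult powr_half_sqrt[symmetric] powr_powr)
  have "e < gen_avg b (Suc k) (\<lambda>v. min 1 (B * \<bar>Y v w / sqrt (real n)\<bar>))"
    using step gen_avg_path_step[of b "gauss_shift A" B k "\<lambda>v. Y v w / sqrt (real n)"]
      gauss_shift_A_lipschitz gauss_shift_bounds b_ge_1
    unfolding mass_at_def level_mass_def B_def by fastforce
  also have "\<dots> \<le> gen_avg b (Suc k) (\<lambda>v. e / 2 + \<bar>Y v w\<bar> powr \<alpha> / K)"
  proof (rule gen_avg_mono)
    fix v
    show "min 1 (B * \<bar>Y v w / sqrt (real n)\<bar>) \<le> e / 2 + \<bar>Y v w\<bar> powr \<alpha> / K"
    proof (cases "\<bar>Y v w\<bar> \<le> c * sqrt (real n)")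
      case True
      then have "B * \<bar>Y v w / sqrt (real n)\<bar> \<le> B * c"
        using B rn by (intro mult_left_mono) (auto simp: field_simps)
      also have "B * c = e / 2" using B by (simp add: c_def)
      also have "\<dots> \<le> e / 2 + \<bar>Y v w\<bar> powr \<alpha> / K" using K by simp
      finally show ?thesis by linarith
    next
      case False
      then have "K \<le> \<bar>Y v w\<bar> powr \<alpha>" unfolding K_def
        using c rn \<alpha>_pos by (intro powr_mono2) auto
      then have "1 \<le> \<bar>Y v w\<bar> powr \<alpha> / K" using K by simp
      then show ?thesis using e by linarith
    qed
  qed
  also have "\<dots> = e / 2 + (\<Sum>v\<in>generation b (Suc k). \<bar>Y v w\<bar> powr \<alpha>) / K / real b ^ Suc k"
    by (simp add: gen_avg_add gen_avg_const[OF b_ge_1]) (simp add: gen_avg_def sum_divide_distrib)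
  finally have "e / 2 < (\<Sum>v\<in>generation b (Suc k). \<bar>Y v w\<bar> powr \<alpha>) / K / real b ^ Suc k" by linarith
  then have "e / 2 * real b ^ Suc k * K < (\<Sum>v\<in>generation b (Suc k). \<bar>Y v w\<bar> powr \<alpha>)"
    using pos_less_divide_eq[OF bk] pos_less_divide_eq[OF K(1)] by blast
  moreover have "e / 2 * real b ^ Suc k * K =
      e / 2 * (e / (2 * (2 * real r + 1))) powr \<alpha> * real b ^ Suc k * real n powr (\<alpha> / 2)"
    unfolding K(2) c_def B_def by (simp only: mult_ac)
  ultimately show ?thesis by linarith
qed

text \<open>Entropy \<open>ln C\<close> and energy carry the same factor b^(k+1), so the bound is
  effective at every depth once the energy in the bracket exceeds \<open>ln C\<close>. The choice
  \<open>s = lam / 2\<close> is arbitrary: only the order of the energy matters here, not its sharp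
  constant.\<close>

lemma mass_at_step_prob:
  obtains C \<kappa> where "C \<ge> 1" "\<kappa> > 0"
    "\<And>n k e. n > 0 \<Longrightarrow> e > 0 \<Longrightarrow> prob {w \<in> space M. e < \<bar>mass_at n (Suc k) w - mass_at n k w\<bar>}
      \<le> exp (real b ^ Suc k * (ln C - \<kappa> * e powr (1 + \<alpha>) * real n powr (\<alpha> / 2)))"
proof -
  define s where "s = lam / 2"
  have s: "0 < s" "s < lam" using lam_pos by (auto simp: s_def)
  obtain C where C: "C \<ge> 1" and ch: "\<And>J c. finite J \<Longrightarrow> J \<subseteq> tree b - {[]} \<Longrightarrow>
      prob {w \<in> space M. (\<Sum>v\<in>J. \<bar>Y v w\<bar> powr \<alpha>) \<ge> c} \<le> C ^ card J * exp (- (s * c))"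
    using chernoff[OF s] by blast
  define \<kappa> where "\<kappa> = s / 2 * (1 / (2 * (2 * real r + 1))) powr \<alpha>"
  show thesis
  proof (rule that[OF C])
    show "\<kappa> > 0" using s by (simp add: \<kappa>_def)
    fix n k :: nat and e :: real assume n: "n > 0" and e: "e > 0"
    define c where "c = e / 2 * (e / (2 * (2 * real r + 1))) powr \<alpha> * real b ^ Suc k * real n powr (\<alpha> / 2)"
    let ?G = "generation b (Suc k)"
    have Ym: "Y v \<in> borel_measurable M" if "v \<in> ?G" for v using that generation_subset[of "Suc k" b] Y_borel by auto
    have "prob {w \<in> space M. e < \<bar>mass_at n (Suc k) w - mass_at n k w\<bar>} \<le> prob {w \<in> space M. (\<Sum>v\<in>?G. \<bar>Y v w\<bar> powr \<alpha>) \<ge> c}"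
    proof (rule finite_measure_mono)
      show "{w \<in> space M. e < \<bar>mass_at n (Suc k) w - mass_at n k w\<bar>} \<subseteq> {w \<in> space M. (\<Sum>v\<in>?G. \<bar>Y v w\<bar> powr \<alpha>) \<ge> c}"
        unfolding c_def using mass_at_step_imp[OF n e] by auto
      note [measurable] = Ym
      show "{w \<in> space M. (\<Sum>v\<in>?G. \<bar>Y v w\<bar> powr \<alpha>) \<ge> c} \<in> events" by measurable
    qed
    also have "\<dots> \<le> C ^ card ?G * exp (- (s * c))"
      using generation_subset[of "Suc k" b] by (intro ch) auto
    also have "C ^ card ?G = exp (real b ^ Suc k * ln C)"
    proof -
      have "C ^ card ?G = exp (ln C) ^ (b ^ Suc k)" using C unfolding card_generation by simp
      also have "\<dots> = exp (real (b ^ Suc k) * ln C)" by (rule exp_of_nat_mult[symmetric])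
      finally show ?thesis unfolding of_nat_power .
    qed
    also have "s * c = real b ^ Suc k * (\<kappa> * e powr (1 + \<alpha>) * real n powr (\<alpha> / 2))"
    proof -
      define Q where "Q = (1 / (2 * (2 * real r + 1))) powr \<alpha>"
      have eq1: "(e / (2 * (2 * real r + 1))) powr \<alpha> = e powr \<alpha> * Q"
        using powr_mult[of e "1 / (2 * (2 * real r + 1))" \<alpha>] by (simp add: Q_def)
      have eq2: "e powr (1 + \<alpha>) = e * e powr \<alpha>" using e by (simp add: powr_add)
      have "s * (e / 2 * (p * Q) * x * y) = x * (s / 2 * Q * (e * p) * y)" for p x y :: real
        by (simp add: mult_ac)
      from this[of "e powr \<alpha>" "real b ^ Suc k" "real n powr (\<alpha> / 2)"]
      show ?thesis unfolding c_def \<kappa>_def eq1 eq2 Q_def[symmetric] .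
    qed
    finally show "prob {w \<in> space M. e < \<bar>mass_at n (Suc k) w - mass_at n k w\<bar>}
      \<le> exp (real b ^ Suc k * (ln C - \<kappa> * e powr (1 + \<alpha>) * real n powr (\<alpha> / 2)))"
      by (simp only: right_diff_distrib exp_diff exp_minus divide_inverse)
  qed
qed

text \<open>The intermediate level \<open>m\<close> is chosen so that \<open>b^m \<ge> n^(\<alpha>/2 + 1)\<close>, which makes Hoeffding's
  bound superexponentially small.\<close>

lemma empirical_approx:
  assumes \<epsilon>: "\<epsilon> > 0" and L: "L \<ge> 0"
  shows "\<exists>K0. \<forall>K\<ge>K0. \<forall>\<^sub>F n in sequentially.
    prob {w \<in> space M. \<epsilon> < \<bar>empirical n w - mass_at n K w\<bar>} \<le> exp (- (L * real n powr (\<alpha> / 2)))"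
proof -
  obtain C \<kappa> where C: "C \<ge> 1" and \<kappa>: "\<kappa> > 0" and step:
    "\<And>n k e. n > 0 \<Longrightarrow> e > 0 \<Longrightarrow> prob {w \<in> space M. e < \<bar>mass_at n (Suc k) w - mass_at n k w\<bar>}
      \<le> exp (real b ^ Suc k * (ln C - \<kappa> * e powr (1 + \<alpha>) * real n powr (\<alpha> / 2)))"
    using mass_at_step_prob by blast
  define \<beta> where "\<beta> = real b"
  have \<beta>: "\<beta> > 1" using b_ge by (simp add: \<beta>_def)
  define \<gamma> where "\<gamma> = \<alpha> / 2 + 1"
  have \<gamma>: "\<gamma> > 0" using \<alpha>_pos by (simp add: \<gamma>_def)
  define m where "m n = nat \<lceil>\<gamma> * log \<beta> (real n)\<rceil>" for n :: nat
  define e where "e j = real (Suc j) powr (-2)" for j :: nat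
  have e_pos: "e j > 0" for j by (simp add: e_def)
  have e_pow: "e j powr (1 + \<alpha>) = real (Suc j) powr (- (2 * (1 + \<alpha>)))" for j
    by (simp only: e_def powr_powr) (simp add: algebra_simps)
  have "summable e" unfolding e_def
    by (subst summable_Suc_iff[of "\<lambda>j. real j powr (-2)"]) (simp add: summable_real_powr_iff)
  then obtain K1 where K1: "\<And>K m. K \<ge> K1 \<Longrightarrow> \<bar>sum e {K..<m}\<bar> < \<epsilon> / 2"
    unfolding summable_Cauchy using \<epsilon> by (metis half_gt_zero real_norm_def)
  \<comment> \<open>Half of the energy in generation j + 1 is to supply the rate L + 1; the other
    half is reserved for the entropy \<open>ln C\<close>.\<close>
  have "filterlim (\<lambda>j::nat. \<kappa> / 2 * real (Suc j) powr (- (2 * (1 + \<alpha>))) * \<beta> ^ Suc j) at_top sequentially"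
    using \<kappa> \<beta> \<alpha>_pos by real_asymp
  then obtain K2 where K2: "\<And>j. j \<ge> K2 \<Longrightarrow> L + 1 \<le> \<kappa> / 2 * real (Suc j) powr (- (2 * (1 + \<alpha>))) * \<beta> ^ Suc j"
    unfolding filterlim_at_top eventually_sequentially by blast
  have m_le: "real (m n) \<le> \<gamma> * log \<beta> (real n) + 1" if "n > 0" for n
  proof -
    have "0 \<le> \<gamma> * log \<beta> (real n)" using \<gamma> \<beta> that by (intro mult_nonneg_nonneg) auto
    then show ?thesis unfolding m_def by linarith
  qed
  have m_lim: "(\<lambda>n. real (m n) / real n) \<longlonglongrightarrow> 0"
  proof (rule tendsto_sandwich[OF _ _ tendsto_const])
    show "(\<lambda>n::nat. (\<gamma> * log \<beta> (real n) + 1) / real n) \<longlonglongrightarrow> 0"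
      unfolding log_def using \<beta> \<gamma> by real_asymp
    show "\<forall>\<^sub>F n in sequentially. real (m n) / real n \<le> (\<gamma> * log \<beta> (real n) + 1) / real n"
      using eventually_gt_at_top[of 0] by eventually_elim (simp add: m_le divide_right_mono)
  qed simp
  have m_lt: "\<forall>\<^sub>F n in sequentially. m n \<le> n"
    using order_tendstoD(2)[OF m_lim zero_less_one] eventually_gt_at_top[of 0]
    by eventually_elim auto
  have "(\<lambda>n. real (n - m n) / real n) \<longlonglongrightarrow> 1"
  proof (rule Lim_transform_eventually)
    show "(\<lambda>n. 1 - real (m n) / real n) \<longlonglongrightarrow> 1" using tendsto_diff[OF tendsto_const m_lim, of 1] by simp
    show "\<forall>\<^sub>F n in sequentially. 1 - real (m n) / real n = real (n - m n) / real n"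
      using m_lt eventually_gt_at_top[of 0] by eventually_elim (simp add: of_nat_diff diff_divide_distrib)
  qed
  then have clt: "\<forall>\<^sub>F n in sequentially. \<forall>J x. finite J \<longrightarrow> J \<subseteq> tree b - {[]} \<longrightarrow> card J = n - m n \<longrightarrow>
    \<bar>prob {w \<in> space M. (x + (\<Sum>v\<in>J. Y v w)) / sqrt (real n) \<in> A} - gauss_shift A (x / sqrt (real n))\<bar> \<le> \<epsilon> / 2 / 2"
    using \<epsilon> by (intro clt_interval_union[OF A]) auto
  have m_top: "filterlim (\<lambda>n::nat. \<gamma> * log \<beta> (real n)) at_top sequentially"
    unfolding log_def using \<beta> \<gamma> by real_asymp
  have bm: "real n powr \<gamma> \<le> \<beta> ^ m n" if "n > 0" for n
  proof -
    have "real n powr \<gamma> = \<beta> powr (\<gamma> * log \<beta> (real n))"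
      using \<beta> that by (simp add: powr_powr[symmetric] mult.commute[of \<gamma>])
    also have "\<dots> \<le> \<beta> powr real (m n)"
      using \<beta> unfolding m_def by (intro powr_mono) linarith+
    finally show ?thesis using \<beta> by (simp add: powr_realpow)
  qed
  have ev_hoeff: "\<forall>\<^sub>F n::nat in sequentially. L * real n powr (\<alpha> / 2) + real n powr (\<alpha> / 2) + ln 2 \<le> (\<epsilon> / 2)\<^sup>2 / 2 * real n powr \<gamma>"
    unfolding \<gamma>_def using \<epsilon> L \<alpha>_pos by real_asymp
  \<comment> \<open>The union bound involves at most m + 1 events; lowering the rate from L + 1 to L
    pays for their number.\<close>
  have ev_count: "\<forall>\<^sub>F n::nat in sequentially. \<gamma> * log \<beta> (real n) + 2 \<le> exp (real n powr (\<alpha> / 2))"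
    unfolding log_def using \<beta> \<gamma> \<alpha>_pos by real_asymp
  \<comment> \<open>Up to level m the budgets are at least a power of 1 / log n, and n^(\<alpha>/2)
    outgrows every power of log n, so the weakest energy still beats the entropy.\<close>
  have ev_lnC: "\<forall>\<^sub>F n::nat in sequentially. ln C \<le> \<kappa> / 2 * (\<gamma> * log \<beta> (real n) + 1) powr (- (2 * (1 + \<alpha>))) * real n powr (\<alpha> / 2)"
  proof -
    have "filterlim (\<lambda>n::nat. \<kappa> / 2 * (\<gamma> * log \<beta> (real n) + 1) powr (- (2 * (1 + \<alpha>))) * real n powr (\<alpha> / 2)) at_top sequentially"
      unfolding log_def using \<kappa> \<beta> \<gamma> \<alpha>_pos by real_asymp
    then show ?thesis unfolding filterlim_at_top by blast
  qed
  show ?thesis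
  proof (intro exI[of _ "max K1 K2"] allI impI)
    fix K assume K: "max K1 K2 \<le> K"
    have mK: "\<forall>\<^sub>F n in sequentially. K \<le> m n"
      using filterlim_at_top[THEN iffD1, OF m_top, rule_format, of "real K"]
      by eventually_elim (simp add: m_def, linarith)
    show "\<forall>\<^sub>F n in sequentially. prob {w \<in> space M. \<epsilon> < \<bar>empirical n w - mass_at n K w\<bar>} \<le> exp (- (L * real n powr (\<alpha> / 2)))"
      using mK m_lt clt ev_hoeff ev_count ev_lnC eventually_gt_at_top[of 0]
    proof eventually_elim
      case (elim n)
      let ?N = "real n powr (\<alpha> / 2)"
      let ?bad = "\<lambda>j. {w \<in> space M. e j < \<bar>mass_at n (Suc j) w - mass_at n j w\<bar>}"
      let ?H = "{w \<in> space M. \<epsilon> / 2 < \<bar>empirical n w - mass_at n (m n) w\<bar>}"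
      have "prob ?H \<le> 2 * exp (- ((\<epsilon> / 2)\<^sup>2 / 2 * real b ^ m n))"
        using elim \<epsilon> by (intro hoeffding_level) auto
      also have "\<dots> = exp (ln 2 + - ((\<epsilon> / 2)\<^sup>2 / 2 * \<beta> ^ m n))" unfolding exp_add \<beta>_def by simp
      also have "\<dots> \<le> exp (- ((L + 1) * ?N))"
      proof -
        have "(\<epsilon> / 2)\<^sup>2 / 2 * real n powr \<gamma> \<le> (\<epsilon> / 2)\<^sup>2 / 2 * \<beta> ^ m n"
          using bm[of n] elim by (intro mult_left_mono) auto
        then show ?thesis using elim by (simp add: algebra_simps)
      qed
      finally have H: "prob ?H \<le> exp (- ((L + 1) * ?N))" .
      have bad: "prob (?bad j) \<le> exp (- ((L + 1) * ?N))" if j: "j \<in> {K..<m n}" for j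
      proof -
        define q where "q = \<kappa> / 2 * real (Suc j) powr (- (2 * (1 + \<alpha>)))"
        have "prob (?bad j) \<le> exp (\<beta> ^ Suc j * (ln C - 2 * q * ?N))"
          using step[of n "e j" j] elim e_pos by (simp add: \<beta>_def e_pow q_def del: power_Suc)
        also have "\<dots> \<le> exp (- ((L + 1) * ?N))"
        proof -
          have "(\<gamma> * log \<beta> (real n) + 1) powr (- (2 * (1 + \<alpha>))) \<le> real (Suc j) powr (- (2 * (1 + \<alpha>)))"
            using j m_le[of n] elim \<alpha>_pos by (intro powr_mono2') auto
          then have "\<kappa> / 2 * (\<gamma> * log \<beta> (real n) + 1) powr (- (2 * (1 + \<alpha>))) * ?N \<le> q * ?N"
            unfolding q_def using \<kappa> by (intro mult_right_mono mult_left_mono) auto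
          then have "ln C - 2 * q * ?N \<le> - (q * ?N)" using elim by linarith
          then have "\<beta> ^ Suc j * (ln C - 2 * q * ?N) \<le> \<beta> ^ Suc j * (- (q * ?N))"
            using \<beta> by (intro mult_left_mono) auto
          also have "\<dots> = - ((q * \<beta> ^ Suc j) * ?N)" by (simp only: mult_minus_right mult_ac)
          also have "\<dots> \<le> - ((L + 1) * ?N)"
            using K2[of j] j K unfolding q_def[symmetric] by (intro le_imp_neg_le mult_right_mono) auto
          finally show ?thesis by simp
        qed
        finally show ?thesis .
      qed
      \<comment> \<open>If no generation exceeds its budget, telescoping from K to m moves less than
        \<epsilon>/2.\<close>
      have "{w \<in> space M. \<epsilon> < \<bar>empirical n w - mass_at n K w\<bar>} \<subseteq> ?H \<union> (\<Union>j\<in>{K..<m n}. ?bad j)"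
      proof (rule subsetI, rule ccontr)
        fix w assume w: "w \<in> {w \<in> space M. \<epsilon> < \<bar>empirical n w - mass_at n K w\<bar>}"
          and nw: "w \<notin> ?H \<union> (\<Union>j\<in>{K..<m n}. ?bad j)"
        have "mass_at n (m n) w - mass_at n K w = (\<Sum>j=K..<m n. mass_at n (Suc j) w - mass_at n j w)"
          using sum_Suc_diff'[of K "m n" "\<lambda>j. mass_at n j w"] elim(1) by simp
        also have "\<bar>\<dots>\<bar> \<le> (\<Sum>j=K..<m n. e j)"
          using w nw by (intro order_trans[OF sum_abs sum_mono]) (auto simp: not_less)
        also have "\<dots> < \<epsilon> / 2" using K1[of K "m n"] K by linarith
        finally have "\<bar>mass_at n (m n) w - mass_at n K w\<bar> < \<epsilon> / 2" .
        moreover have "\<bar>empirical n w - mass_at n (m n) w\<bar> \<le> \<epsilon> / 2" using w nw by auto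
        moreover have "\<epsilon> < \<bar>empirical n w - mass_at n K w\<bar>" using w by simp
        ultimately show False by linarith
      qed
      moreover note [measurable] = empirical_measurable[OF elim(7)]
      ultimately have "prob {w \<in> space M. \<epsilon> < \<bar>empirical n w - mass_at n K w\<bar>} \<le> prob (?H \<union> (\<Union>j\<in>{K..<m n}. ?bad j))"
        by (intro finite_measure_mono) auto
      also have "\<dots> \<le> prob ?H + prob (\<Union>j\<in>{K..<m n}. ?bad j)"
        by (intro measure_Un_le) auto
      also have "prob (\<Union>j\<in>{K..<m n}. ?bad j) \<le> (\<Sum>j\<in>{K..<m n}. prob (?bad j))"
        by (intro measure_UNION_le) auto
      also have "\<dots> \<le> (\<Sum>j\<in>{K..<m n}. exp (- ((L + 1) * ?N)))"
        by (intro sum_mono bad)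
      also have "\<dots> \<le> real (m n) * exp (- ((L + 1) * ?N))"
        by (simp add: mult_right_mono)
      finally have "prob {w \<in> space M. \<epsilon> < \<bar>empirical n w - mass_at n K w\<bar>} \<le> (real (m n) + 1) * exp (- ((L + 1) * ?N))"
        using H by (simp add: algebra_simps)
      also have "\<dots> \<le> exp ?N * exp (- ((L + 1) * ?N))"
        using elim m_le[of n] by (intro mult_right_mono) auto
      also have "\<dots> = exp (- (L * ?N))" by (simp add: algebra_simps flip: exp_add)
      finally show ?case .
    qed
  qed
qed

end

section \<open>The boundary of the tree\<close>

context
  fixes b :: nat
  assumes b1: "b \<ge> 1"
begin

interpretation unif: product_prob_space "\<lambda>_::nat. uniform_count_measure {1..b}" "{1::nat..}"
proof -
  interpret prob_space "uniform_count_measure {1..b}"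
    using b1 by (intro prob_space_uniform_count_measure) auto
  show "product_prob_space (\<lambda>_::nat. uniform_count_measure {1..b})"
    by unfold_locales
qed

lemma prob_space_boundary: "prob_space (boundary_measure b)"
  unfolding boundary_measure_def by (rule unif.prob_space_axioms)

text \<open>Coordinates of rays start at 1, list positions at 0. Membership in singletons is the
  form in which the product measure evaluates cylinders.\<close>

lemma ray_prefix_eq_iff:
  assumes "length v = k"
  shows "ray_prefix \<xi> k = v \<longleftrightarrow> (\<forall>i\<in>{1..k}. \<xi> i \<in> {v ! (i - 1)})"
proof
  assume "ray_prefix \<xi> k = v"
  then have "v ! (i - 1) = \<xi> i" if "i \<in> {1..k}" for i
    using that by (auto simp: ray_prefix_def simp del: upt_Suc)
  then show "\<forall>i\<in>{1..k}. \<xi> i \<in> {v ! (i - 1)}" by auto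
next
  assume *: "\<forall>i\<in>{1..k}. \<xi> i \<in> {v ! (i - 1)}"
  show "ray_prefix \<xi> k = v"
  proof (rule nth_equalityI)
    fix i assume "i < length (ray_prefix \<xi> k)"
    then show "ray_prefix \<xi> k ! i = v ! i" using *[rule_format, of "Suc i"] by (simp add: ray_prefix_def del: upt_Suc)
  qed (simp add: assms)
qed

lemma ray_prefix_vertex:
  assumes v: "v \<in> generation b k"
  shows "{\<xi> \<in> space (boundary_measure b). ray_prefix \<xi> k = v} \<in> sets (boundary_measure b)"
    and "measure (boundary_measure b) {\<xi> \<in> space (boundary_measure b). ray_prefix \<xi> k = v} = 1 / real b ^ k"
proof -
  have len: "length v = k" using v by (simp add: generation_def)
  have vi: "v ! (i - 1) \<in> {1..b}" if "i \<in> {1..k}" for i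
  proof -
    have "v ! (i - 1) \<in> set v" using that len by (intro nth_mem) auto
    then show ?thesis using v by (auto simp: generation_eq)
  qed
  have eq: "{\<xi> \<in> space (boundary_measure b). ray_prefix \<xi> k = v} =
      {\<xi> \<in> space (boundary_measure b). \<forall>i\<in>{1..k}. \<xi> i \<in> {v ! (i - 1)}}"
    by (simp add: ray_prefix_eq_iff[OF len])
  show "{\<xi> \<in> space (boundary_measure b). ray_prefix \<xi> k = v} \<in> sets (boundary_measure b)"
    unfolding eq
  proof (rule sets.sets_Collect_finite_All)
    fix i assume i: "i \<in> {1..k}"
    have "(\<lambda>\<xi>. \<xi> i) \<in> measurable (boundary_measure b) (uniform_count_measure {1..b})"
      unfolding boundary_measure_def using i by (intro measurable_component_singleton) auto
    then have "(\<lambda>\<xi>. \<xi> i) -` {v ! (i - 1)} \<inter> space (boundary_measure b) \<in> sets (boundary_measure b)"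
      by (rule measurable_sets) (use vi[OF i] in \<open>auto simp: sets_uniform_count_measure\<close>)
    also have "(\<lambda>\<xi>. \<xi> i) -` {v ! (i - 1)} \<inter> space (boundary_measure b) =
        {\<xi> \<in> space (boundary_measure b). \<xi> i \<in> {v ! (i - 1)}}" by auto
    finally show "{\<xi> \<in> space (boundary_measure b). \<xi> i \<in> {v ! (i - 1)}} \<in> sets (boundary_measure b)" .
  qed simp
  have "emeasure (boundary_measure b) {\<xi> \<in> space (boundary_measure b). ray_prefix \<xi> k = v} =
      (\<Prod>i\<in>{1..k}. emeasure (uniform_count_measure {1..b}) {v ! (i - 1)})"
    unfolding eq unfolding boundary_measure_def using vi
    by (intro unif.emeasure_PiM_Collect) (auto simp: sets_uniform_count_measure)
  also have "\<dots> = (\<Prod>i\<in>{1..k}. ennreal (1 / real b))"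
    using vi by (intro prod.cong refl) (simp add: emeasure_uniform_count_measure)
  also have "\<dots> = ennreal (1 / real b ^ k)"
    by (simp add: ennreal_power power_one_over)
  finally show "measure (boundary_measure b) {\<xi> \<in> space (boundary_measure b). ray_prefix \<xi> k = v} = 1 / real b ^ k"
    by (simp add: measure_def)
qed

lemma ray_prefix_in_generation:
  assumes "\<xi> \<in> space (boundary_measure b)"
  shows "ray_prefix \<xi> k \<in> generation b k"
proof -
  have "\<xi> i \<in> {1..b}" if "i \<ge> 1" for i
    using assms that unfolding boundary_measure_def space_PiM space_uniform_count_measure
    by (blast dest: PiE_mem)
  then show ?thesis unfolding generation_eq ray_prefix_def by (simp add: image_subset_iff del: upt_Suc)
qed

text \<open>A function of the first k coordinates is a finite combination of indicators of
  cylinders, which yields both its measurability and its integral.\<close>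

lemma ray_prefix_expand:
  fixes f :: "nat list \<Rightarrow> real"
  assumes "\<xi> \<in> space (boundary_measure b)"
  shows "f (ray_prefix \<xi> k) = (\<Sum>v\<in>generation b k. f v * indicator {\<xi> \<in> space (boundary_measure b). ray_prefix \<xi> k = v} \<xi>)"
proof -
  have "(\<Sum>v\<in>generation b k. f v * indicator {\<xi> \<in> space (boundary_measure b). ray_prefix \<xi> k = v} \<xi>) =
      (\<Sum>v\<in>generation b k. if ray_prefix \<xi> k = v then f v else 0)"
    using assms by (intro sum.cong) (auto simp: indicator_def)
  then show ?thesis using ray_prefix_in_generation[OF assms, of k] by simp
qed

lemma ray_prefix_measurable: "(\<lambda>\<xi>. f (ray_prefix \<xi> k) :: real) \<in> borel_measurable (boundary_measure b)"
proof -
  have "(\<lambda>\<xi>. \<Sum>v\<in>generation b k. f v * indicator {\<xi> \<in> space (boundary_measure b). ray_prefix \<xi> k = v} \<xi>)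
      \<in> borel_measurable (boundary_measure b)"
    by (intro borel_measurable_sum borel_measurable_times borel_measurable_indicator borel_measurable_const ray_prefix_vertex)
  then show ?thesis by (rule measurable_cong[THEN iffD1, rotated]) (simp add: ray_prefix_expand)
qed

lemma integral_ray_prefix:
  "integrable (boundary_measure b) (\<lambda>\<xi>. f (ray_prefix \<xi> k) :: real)"
  "(LINT \<xi>|boundary_measure b. f (ray_prefix \<xi> k)) = gen_avg b k f"
proof -
  interpret prob_space "boundary_measure b" by (rule prob_space_boundary)
  let ?F = "\<lambda>\<xi>. \<Sum>v\<in>generation b k. f v * indicator {\<xi> \<in> space (boundary_measure b). ray_prefix \<xi> k = v} \<xi>"
  have int: "integrable (boundary_measure b) (\<lambda>\<xi>. f v * indicator {\<xi> \<in> space (boundary_measure b). ray_prefix \<xi> k = v} \<xi>)"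
    if "v \<in> generation b k" for v
    using ray_prefix_vertex[OF that] by (intro integrable_mult_right integrable_real_indicator) (auto simp: less_top[symmetric])
  then have "integrable (boundary_measure b) ?F" by (intro Bochner_Integration.integrable_sum)
  then show "integrable (boundary_measure b) (\<lambda>\<xi>. f (ray_prefix \<xi> k))"
    by (rule Bochner_Integration.integrable_cong[THEN iffD1, OF refl, rotated]) (simp add: ray_prefix_expand)
  have "(LINT \<xi>|boundary_measure b. f (ray_prefix \<xi> k)) = (LINT \<xi>|boundary_measure b. ?F \<xi>)"
    by (intro Bochner_Integration.integral_cong refl ray_prefix_expand)
  also have "\<dots> = (\<Sum>v\<in>generation b k. f v * (1 / real b ^ k))"
    using int ray_prefix_vertex by (subst Bochner_Integration.integral_sum) auto
  finally show "(LINT \<xi>|boundary_measure b. f (ray_prefix \<xi> k)) = gen_avg b k f"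
    by (simp add: gen_avg_def sum_divide_distrib)
qed

lemma ray_sum_measurable: "ray_sum h \<in> borel_measurable (boundary_measure b)"
  unfolding ray_sum_def[abs_def] by (intro borel_measurable_suminf ray_prefix_measurable)

text \<open>By Tonelli the expected sum of |h| along a random ray is the tree norm, and a finite
  expectation forces almost sure finiteness.\<close>

lemma AE_summable_ray:
  assumes "summable (\<lambda>k. gen_avg b (Suc k) (\<lambda>v. \<bar>h v\<bar>))"
  shows "AE \<xi> in boundary_measure b. summable (\<lambda>k. \<bar>h (ray_prefix \<xi> (Suc k))\<bar>)"
proof -
  have [measurable]: "(\<lambda>\<xi>. \<bar>h (ray_prefix \<xi> k)\<bar>) \<in> borel_measurable (boundary_measure b)" for k
    by (rule ray_prefix_measurable)
  have nonneg: "0 \<le> gen_avg b k (\<lambda>v. \<bar>h v\<bar>)" for k by (rule gen_avg_nonneg) simp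
  have "(\<integral>\<^sup>+\<xi>. (\<Sum>k. ennreal \<bar>h (ray_prefix \<xi> (Suc k))\<bar>) \<partial>boundary_measure b) =
      (\<Sum>k. \<integral>\<^sup>+\<xi>. ennreal \<bar>h (ray_prefix \<xi> (Suc k))\<bar> \<partial>boundary_measure b)"
    by (intro nn_integral_suminf) measurable
  also have "\<dots> = (\<Sum>k. ennreal (gen_avg b (Suc k) (\<lambda>v. \<bar>h v\<bar>)))"
  proof (intro suminf_cong)
    fix k
    show "(\<integral>\<^sup>+\<xi>. ennreal \<bar>h (ray_prefix \<xi> (Suc k))\<bar> \<partial>boundary_measure b) = ennreal (gen_avg b (Suc k) (\<lambda>v. \<bar>h v\<bar>))"
      using integral_ray_prefix[of "\<lambda>v. \<bar>h v\<bar>" "Suc k"] by (subst nn_integral_eq_integral) auto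
  qed
  also have "\<dots> = ennreal (\<Sum>k. gen_avg b (Suc k) (\<lambda>v. \<bar>h v\<bar>))"
    using assms nonneg by (intro suminf_ennreal2) auto
  finally have "(\<integral>\<^sup>+\<xi>. (\<Sum>k. ennreal \<bar>h (ray_prefix \<xi> (Suc k))\<bar>) \<partial>boundary_measure b) \<noteq> \<infinity>" by simp
  then have "AE \<xi> in boundary_measure b. (\<Sum>k. ennreal \<bar>h (ray_prefix \<xi> (Suc k))\<bar>) \<noteq> \<infinity>"
    by (intro nn_integral_PInf_AE) auto
  then show ?thesis
    by eventually_elim (auto intro: summable_suminf_not_top)
qed

text \<open>Cutting at K changes the ray sum by at most the remaining absolute sum, whose
  expectation is the tail of the norm. The field enters only through that tail, so the estimate is
  uniform over fields with a common summable majorant.\<close>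

lemma tree_mass_approx:
  assumes A: "disjoint_interval_union r A"
    and sm: "summable (\<lambda>k. gen_avg b (Suc k) (\<lambda>v. \<bar>h v\<bar>))"
  shows "\<bar>tree_mass b A h - level_mass b A K h\<bar> \<le> 2 * real r * (\<Sum>k. gen_avg b (Suc (k + K)) (\<lambda>v. \<bar>h v\<bar>))"
proof -
  interpret prob_space "boundary_measure b" by (rule prob_space_boundary)
  let ?P = "boundary_measure b"
  note [measurable] = gauss_shift_measurable[OF A] ray_sum_measurable
  have [measurable]: "(\<lambda>\<xi>. path_sum h (ray_prefix \<xi> K)) \<in> borel_measurable ?P" by (rule ray_prefix_measurable)
  have [measurable]: "(\<lambda>\<xi>. \<bar>h (ray_prefix \<xi> k)\<bar>) \<in> borel_measurable ?P" for k by (rule ray_prefix_measurable)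
  define T where "T \<xi> = (\<Sum>k. \<bar>h (ray_prefix \<xi> (Suc (k + K)))\<bar>)" for \<xi>
  have AE: "AE \<xi> in ?P. summable (\<lambda>k. \<bar>h (ray_prefix \<xi> (Suc (k + K)))\<bar>)"
    using AE_summable_ray[OF sm] by eventually_elim (rule summable_ignore_initial_segment)
  have sm': "summable (\<lambda>k. gen_avg b (Suc (k + K)) (\<lambda>v. \<bar>h v\<bar>))"
    using summable_ignore_initial_segment[OF sm] .
  have T_int: "integrable ?P T" "(LINT \<xi>|?P. T \<xi>) = (\<Sum>k. gen_avg b (Suc (k + K)) (\<lambda>v. \<bar>h v\<bar>))"
    unfolding T_def[abs_def] using AE sm' integral_ray_prefix[of "\<lambda>v. \<bar>h v\<bar>"]
    by (auto intro!: integrable_suminf integral_suminf[THEN trans])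
  have g_int: "integrable ?P (\<lambda>\<xi>. gauss_shift A (ray_sum h \<xi>))"
    using gauss_shift_bounds by (intro integrable_const_bound[of _ 1]) auto
  have g_int': "integrable ?P (\<lambda>\<xi>. gauss_shift A (path_sum h (ray_prefix \<xi> K)))"
    using gauss_shift_bounds by (intro integrable_const_bound[of _ 1]) auto
  have "level_mass b A K h = (LINT \<xi>|?P. gauss_shift A (path_sum h (ray_prefix \<xi> K)))"
    unfolding level_mass_def by (rule integral_ray_prefix(2)[symmetric])
  then have "tree_mass b A h - level_mass b A K h =
      (LINT \<xi>|?P. gauss_shift A (ray_sum h \<xi>) - gauss_shift A (path_sum h (ray_prefix \<xi> K)))"
    using g_int g_int' by (simp add: tree_mass_def)
  also have "\<bar>\<dots>\<bar> \<le> (LINT \<xi>|?P. \<bar>gauss_shift A (ray_sum h \<xi>) - gauss_shift A (path_sum h (ray_prefix \<xi> K))\<bar>)"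
    by (rule integral_abs_bound)
  also have "\<dots> \<le> (LINT \<xi>|?P. 2 * real r * T \<xi>)"
  proof (rule integral_mono_AE)
    show "AE \<xi> in ?P. \<bar>gauss_shift A (ray_sum h \<xi>) - gauss_shift A (path_sum h (ray_prefix \<xi> K))\<bar> \<le> 2 * real r * T \<xi>"
      using AE_summable_ray[OF sm]
    proof eventually_elim
      case (elim \<xi>)
      have "ray_sum h \<xi> - path_sum h (ray_prefix \<xi> K) = (\<Sum>k. h (ray_prefix \<xi> (Suc (k + K))))"
        unfolding ray_sum_def path_sum_ray_prefix
        using suminf_minus_initial_segment[OF summable_rabs_cancel[OF elim], of K] by simp
      also have "\<bar>\<dots>\<bar> \<le> T \<xi>" unfolding T_def
        using elim by (intro summable_rabs) (rule summable_ignore_initial_segment)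
      finally have "2 * real r * \<bar>ray_sum h \<xi> - path_sum h (ray_prefix \<xi> K)\<bar> \<le> 2 * real r * T \<xi>"
        by (intro mult_left_mono) auto
      then show ?case by (rule order_trans[OF gauss_shift_lipschitz[OF A]])
    qed
  qed (use g_int g_int' T_int in auto)
  also have "\<dots> = 2 * real r * (\<Sum>k. gen_avg b (Suc (k + K)) (\<lambda>v. \<bar>h v\<bar>))"
    using T_int by simp
  finally show ?thesis .
qed

text \<open>Scaling commutes with the ray sum wherever the series converges. The exceptional null
  set does not depend on t, and the constant 1 dominates the integrands.\<close>

lemma tree_mass_scale_continuous:
  assumes A: "disjoint_interval_union r A"
    and sm: "summable (\<lambda>k. gen_avg b (Suc k) (\<lambda>v. \<bar>h v\<bar>))"
  shows "continuous_on UNIV (\<lambda>t. tree_mass b A (\<lambda>v. t * h v))"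
proof (rule continuous_on_sequentiallyI)
  interpret prob_space "boundary_measure b" by (rule prob_space_boundary)
  let ?P = "boundary_measure b"
  note [measurable] = gauss_shift_measurable[OF A] ray_sum_measurable
  fix u :: "nat \<Rightarrow> real" and t assume "u \<longlonglongrightarrow> t"
  show "(\<lambda>n. tree_mass b A (\<lambda>v. u n * h v)) \<longlonglongrightarrow> tree_mass b A (\<lambda>v. t * h v)"
    unfolding tree_mass_def
  proof (rule integral_dominated_convergence[where w="\<lambda>_. 1"])
    show "AE \<xi> in ?P. (\<lambda>n. gauss_shift A (ray_sum (\<lambda>v. u n * h v) \<xi>)) \<longlonglongrightarrow> gauss_shift A (ray_sum (\<lambda>v. t * h v) \<xi>)"
      using AE_summable_ray[OF sm]
    proof eventually_elim
      case (elim \<xi>)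
      have eq: "ray_sum (\<lambda>v. c * h v) \<xi> = c * ray_sum h \<xi>" for c
        unfolding ray_sum_def by (rule suminf_mult[OF summable_rabs_cancel[OF elim]])
      have "isCont (gauss_shift A) x" for x
        using gauss_shift_continuous[OF A] by (simp add: continuous_on_eq_continuous_at)
      then show ?case unfolding eq
        by (rule isCont_tendsto_compose) (intro tendsto_intros \<open>u \<longlonglongrightarrow> t\<close>)
    qed
  qed (use gauss_shift_bounds in auto)
qed

end

section \<open>The rate function\<close>

text \<open>Trades the infinite sum for its finite partial sums, a form of the bound that passes to
  pointwise limits of fields.\<close>

lemma tree_cost_le_iff:
  assumes "lam > 0" "c \<ge> 0"
  shows "tree_cost b \<alpha> lam h \<le> ennreal c \<longleftrightarrow>
    (\<forall>F. finite F \<longrightarrow> F \<subseteq> tree b - {[]} \<longrightarrow> lam * (\<Sum>v\<in>F. \<bar>h v\<bar> powr \<alpha>) \<le> c)"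
proof -
  have "tree_cost b \<alpha> lam h =
      (SUP F\<in>{F. finite F \<and> F \<subseteq> tree b - {[]}}. ennreal lam * (\<Sum>v\<in>F. ennreal (\<bar>h v\<bar> powr \<alpha>)))"
    unfolding tree_cost_def by (subst nonneg_infsum_complete) (simp_all add: SUP_mult_left_ennreal)
  also have "\<dots> = (SUP F\<in>{F. finite F \<and> F \<subseteq> tree b - {[]}}. ennreal (lam * (\<Sum>v\<in>F. \<bar>h v\<bar> powr \<alpha>)))"
    using assms by (intro SUP_cong refl) (simp add: sum_ennreal ennreal_mult sum_nonneg)
  finally show ?thesis using assms by (auto simp: SUP_le_iff)
qed

lemma summable_gen_avg_if_tree_space:
  assumes "h \<in> tree_space b"
  shows "summable (\<lambda>k. gen_avg b (Suc k) (\<lambda>v. \<bar>h v\<bar>))"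
proof (rule summable_suminf_not_top)
  show "(\<Sum>k. ennreal (gen_avg b (Suc k) (\<lambda>v. \<bar>h v\<bar>))) \<noteq> top"
    using assms by (auto simp: tree_space_def tree_norm_def gen_avg_def)
qed (rule gen_avg_nonneg, simp)

lemma tree_space_if_summable_gen_avg:
  assumes "h [] = 0" "summable (\<lambda>k. gen_avg b (Suc k) (\<lambda>v. \<bar>h v\<bar>))"
  shows "h \<in> tree_space b"
proof -
  have "tree_norm b h = (\<Sum>k. ennreal (gen_avg b (Suc k) (\<lambda>v. \<bar>h v\<bar>)))"
    by (simp add: tree_norm_def gen_avg_def)
  also have "\<dots> = ennreal (\<Sum>k. gen_avg b (Suc k) (\<lambda>v. \<bar>h v\<bar>))"
    using assms(2) by (intro suminf_ennreal2) (auto intro: gen_avg_nonneg)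
  finally show ?thesis using assms(1) by (simp add: tree_space_def)
qed

lemma gen_avg_scale: "gen_avg b k (\<lambda>v. \<bar>t * h v\<bar>) = \<bar>t\<bar> * gen_avg b k (\<lambda>v. \<bar>h v\<bar>)"
  unfolding abs_mult by (rule gen_avg_cmult)

text \<open>Shrinking a field lowers its cost and moves its mass continuously to that of the zero field.\<close>

lemma rate_le_tree_cost:
  assumes b: "b \<ge> 1" and A: "disjoint_interval_union r A" and \<alpha>: "\<alpha> > 0" and lam: "lam > 0"
    and h: "h \<in> tree_space b" and q: "measure std_normal_distribution A \<le> q" "q \<le> tree_mass b A h"
  shows "rate b \<alpha> lam A q \<le> enn2ereal (tree_cost b \<alpha> lam h)"
proof -
  note sm = summable_gen_avg_if_tree_space[OF h]
  have cont: "continuous_on {0..1} (\<lambda>t. tree_mass b A (\<lambda>v. t * h v))"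
    by (rule continuous_on_subset[OF tree_mass_scale_continuous[OF b A sm]]) simp
  interpret prob_space "boundary_measure b" by (rule prob_space_boundary[OF b])
  have "tree_mass b A (\<lambda>v. 0 * h v) = measure std_normal_distribution A"
    by (simp add: tree_mass_def ray_sum_def gauss_shift_0 prob_space)
  then obtain t where t: "0 \<le> t" "t \<le> 1" "tree_mass b A (\<lambda>v. t * h v) = q"
    using IVT'[of "\<lambda>t. tree_mass b A (\<lambda>v. t * h v)" 0 q 1] q cont by auto
  have ts: "(\<lambda>v. t * h v) \<in> tree_space b"
    using h summable_mult[OF sm, of "\<bar>t\<bar>"]
    by (intro tree_space_if_summable_gen_avg) (auto simp: gen_avg_scale tree_space_def)
  have "tree_cost b \<alpha> lam (\<lambda>v. t * h v) \<le> tree_cost b \<alpha> lam h"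
  proof (cases "tree_cost b \<alpha> lam h" rule: ennreal_cases)
    case (real c)
    have le: "lam * (\<Sum>v\<in>F. \<bar>h v\<bar> powr \<alpha>) \<le> c" if "finite F" "F \<subseteq> tree b - {[]}" for F
      using tree_cost_le_iff[OF lam real(1), of b \<alpha> h] real(2) that by simp
    have "lam * (\<Sum>v\<in>F. \<bar>t * h v\<bar> powr \<alpha>) \<le> c" if F: "finite F" "F \<subseteq> tree b - {[]}" for F
    proof -
      have "(\<Sum>v\<in>F. \<bar>t * h v\<bar> powr \<alpha>) \<le> (\<Sum>v\<in>F. \<bar>h v\<bar> powr \<alpha>)"
        using t \<alpha> by (intro sum_mono powr_mono2) (auto simp: abs_mult mult_left_le_one_le)
      then have "lam * (\<Sum>v\<in>F. \<bar>t * h v\<bar> powr \<alpha>) \<le> lam * (\<Sum>v\<in>F. \<bar>h v\<bar> powr \<alpha>)"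
        using lam by simp
      then show ?thesis using le[OF F] by linarith
    qed
    then show ?thesis using tree_cost_le_iff[OF lam real(1), of b \<alpha> "\<lambda>v. t * h v"] real(2) by simp
  qed simp
  then have "enn2ereal (tree_cost b \<alpha> lam (\<lambda>v. t * h v)) \<le> enn2ereal (tree_cost b \<alpha> lam h)"
    by (simp add: less_eq_ennreal.rep_eq)
  moreover have "rate b \<alpha> lam A q \<le> enn2ereal (tree_cost b \<alpha> lam (\<lambda>v. t * h v))"
    unfolding rate_def using ts t by (intro INF_lower) auto
  ultimately show ?thesis by (rule order_trans[rotated])
qed

text \<open>By \<open>rate_le_tree_cost\<close> the cost of every field of mass q' also bounds the
  rate at q, so the equality constraint acts like an inequality.\<close>

lemma rate_mono:
  assumes "b \<ge> 1" "disjoint_interval_union r A" "\<alpha> > 0" "lam > 0"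
    and "measure std_normal_distribution A \<le> q" "q \<le> q'"
  shows "rate b \<alpha> lam A q \<le> rate b \<alpha> lam A q'"
  unfolding rate_def[of _ _ _ _ q'] using assms
  by (intro INF_greatest) (auto intro: rate_le_tree_cost)

text \<open>Monotonicity turns the limit from the right into an infimum over larger masses, from
  which a competitor can be picked; the value \<infinity> is covered too.\<close>

lemma rate_right_eq_INF:
  assumes "b \<ge> 1" "disjoint_interval_union r A" "\<alpha> > 0" "lam > 0"
    and p: "measure std_normal_distribution A \<le> p"
  shows "rate_right b \<alpha> lam A p = (INF q\<in>{p<..}. rate b \<alpha> lam A q)"
  unfolding rate_right_def
proof (rule tendsto_Lim)
  show "(rate b \<alpha> lam A \<longlongrightarrow> (INF q\<in>{p<..}. rate b \<alpha> lam A q)) (at_right p)"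
  proof (rule order_tendstoI)
    fix a assume "a < (INF q\<in>{p<..}. rate b \<alpha> lam A q)"
    then have "a < rate b \<alpha> lam A q" if "q > p" for q
      using that by (meson INF_lower greaterThan_iff less_le_trans)
    then show "\<forall>\<^sub>F q in at_right p. a < rate b \<alpha> lam A q"
      by (auto simp: eventually_at_filter)
  next
    fix a assume "(INF q\<in>{p<..}. rate b \<alpha> lam A q) < a"
    then obtain q0 where q0: "q0 > p" "rate b \<alpha> lam A q0 < a" by (auto simp: INF_less_iff)
    have "rate b \<alpha> lam A q < a" if "p < q" "q < q0" for q
      using rate_mono[of b r A \<alpha> lam q q0] assms that q0(2) by auto
    then show "\<forall>\<^sub>F q in at_right p. rate b \<alpha> lam A q < a"
      using q0(1) by (auto simp: eventually_at_right)
  qed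
qed simp

text \<open>Split \<open>\<bar>h v\<bar>\<close> at the threshold \<open>b powr (- k / (1 + \<alpha>))\<close>.\<close>

lemma gen_avg_bound_if_cost_bounded:
  assumes b: "b \<ge> 2" and \<alpha>: "\<alpha> > 0" and lam: "lam > 0" and c: "c \<ge> 0"
  obtains \<tau> :: "nat \<Rightarrow> real" where "summable \<tau>"
    "\<And>h k. (\<And>F. finite F \<Longrightarrow> F \<subseteq> tree b - {[]} \<Longrightarrow> lam * (\<Sum>v\<in>F. \<bar>h v\<bar> powr \<alpha>) \<le> c) \<Longrightarrow>
      gen_avg b (Suc k) (\<lambda>v. \<bar>h v\<bar>) \<le> \<tau> k"
proof -
  have b1: "b \<ge> 1" using b by simp
  define D where "D = c / lam"
  have D: "D \<ge> 0" using c lam by (simp add: D_def)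
  \<comment> \<open>Bounds every |h v| by means of the cost at v alone; the + 1 keeps R positive
    when D = 0.\<close>
  define R where "R = (D + 1) powr (1 / \<alpha>)"
  have R: "R > 0" "R powr \<alpha> = D + 1" using D \<alpha> by (auto simp: R_def powr_powr)
  \<comment> \<open>Determined by q^(1+\<alpha>) = 1/b: for t = q^(k+1), both t and t^(1-\<alpha>)
    b^(-(k+1)) are then geometric in k.\<close>
  define q where "q = 1 / real b powr (1 / (1 + \<alpha>))"
  have "real b powr (1 / (1 + \<alpha>)) > 1" using b \<alpha> by (intro gr_one_powr) auto
  then have q: "0 < q" "q < 1" using b by (simp_all add: q_def divide_less_eq_1)
  have "1 + \<alpha> \<noteq> 0" using \<alpha> by simp
  then have qb: "q powr (1 + \<alpha>) = 1 / real b" using b by (simp add: q_def powr_divide powr_powr)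
  define \<tau> where "\<tau> k = q ^ Suc k + D * (q\<^sup>2) ^ Suc k + D * R powr (1 - \<alpha>) * (1 / real b) ^ Suc k" for k
  show thesis
  proof (rule that[of \<tau>])
    have geo: "summable (\<lambda>k. x ^ Suc k)" if "\<bar>x\<bar> < 1" for x :: real
      using summable_mult[OF summable_geometric[of x], of x] that by simp
    have "\<bar>q\<bar> < 1" "\<bar>q\<^sup>2\<bar> < 1" "\<bar>1 / real b\<bar> < 1"
      using q b by (auto simp: power_less_one_iff abs_square_less_1)
    then show "summable \<tau>" unfolding \<tau>_def
      by (intro summable_add summable_mult geo)
    fix h :: "nat list \<Rightarrow> real" and k
    assume cost: "\<And>F. finite F \<Longrightarrow> F \<subseteq> tree b - {[]} \<Longrightarrow> lam * (\<Sum>v\<in>F. \<bar>h v\<bar> powr \<alpha>) \<le> c"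
    let ?G = "generation b (Suc k)"
    have sumD: "(\<Sum>v\<in>F. \<bar>h v\<bar> powr \<alpha>) \<le> D" if "finite F" "F \<subseteq> tree b - {[]}" for F
      using cost[OF that] lam by (simp add: D_def field_simps)
    define t where "t = q ^ Suc k"
    have t: "t > 0" using q by (simp add: t_def)
    \<comment> \<open>Above t, write |h v| as |h v|^(1-\<alpha>) |h v|^\<alpha>. The first factor is
      at most its value at R if \<alpha> \<le> 1 and its value at t otherwise; adding both treats
      the cases together.\<close>
    have pt: "\<bar>h v\<bar> \<le> t + (t powr (1 - \<alpha>) + R powr (1 - \<alpha>)) * \<bar>h v\<bar> powr \<alpha>" if v: "v \<in> ?G" for v
    proof (cases "\<bar>h v\<bar> \<le> t")
      case True
      have "0 \<le> (t powr (1 - \<alpha>) + R powr (1 - \<alpha>)) * \<bar>h v\<bar> powr \<alpha>" by (intro mult_nonneg_nonneg add_nonneg_nonneg) auto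
      then show ?thesis using True by linarith
    next
      case False
      then have hv: "\<bar>h v\<bar> > 0" using t by linarith
      have "\<bar>h v\<bar> powr \<alpha> \<le> D"
        using sumD[of "{v}"] v generation_subset[of "Suc k" b] by auto
      then have "\<bar>h v\<bar> powr \<alpha> \<le> R powr \<alpha>" unfolding R(2) by linarith
      then have hR: "\<bar>h v\<bar> \<le> R"
        using powr_less_mono2[OF \<alpha>, of R "\<bar>h v\<bar>"] R(1) by (meson less_imp_le not_less)
      have "\<bar>h v\<bar> powr (1 - \<alpha>) \<le> t powr (1 - \<alpha>) + R powr (1 - \<alpha>)"
      proof (cases "\<alpha> \<le> 1")
        case True
        then have "\<bar>h v\<bar> powr (1 - \<alpha>) \<le> R powr (1 - \<alpha>)" using hR by (intro powr_mono2) auto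
        then show ?thesis using powr_ge_zero[of t "1 - \<alpha>"] by linarith
      next
        case False
        then have "\<bar>h v\<bar> powr (1 - \<alpha>) \<le> t powr (1 - \<alpha>)"
          using \<open>\<not> \<bar>h v\<bar> \<le> t\<close> t by (intro powr_mono2') auto
        then show ?thesis using powr_ge_zero[of R "1 - \<alpha>"] by linarith
      qed
      then have "\<bar>h v\<bar> powr (1 - \<alpha>) * \<bar>h v\<bar> powr \<alpha> \<le> (t powr (1 - \<alpha>) + R powr (1 - \<alpha>)) * \<bar>h v\<bar> powr \<alpha>"
        by (intro mult_right_mono) auto
      moreover have "\<bar>h v\<bar> powr (1 - \<alpha>) * \<bar>h v\<bar> powr \<alpha> = \<bar>h v\<bar>"
        using hv by (simp flip: powr_add)
      ultimately show ?thesis using t by linarith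
    qed
    have bk: "real b ^ Suc k > 0" using b by simp
    have "gen_avg b (Suc k) (\<lambda>v. \<bar>h v\<bar>) \<le>
        gen_avg b (Suc k) (\<lambda>v. t + (t powr (1 - \<alpha>) + R powr (1 - \<alpha>)) * \<bar>h v\<bar> powr \<alpha>)"
      by (intro gen_avg_mono pt)
    also have "\<dots> = t + (t powr (1 - \<alpha>) + R powr (1 - \<alpha>)) * ((\<Sum>v\<in>?G. \<bar>h v\<bar> powr \<alpha>) / real b ^ Suc k)"
      using b by (simp only: gen_avg_add gen_avg_cmult gen_avg_const[OF b1]) (simp only: gen_avg_def)
    also have "\<dots> \<le> t + (t powr (1 - \<alpha>) + R powr (1 - \<alpha>)) * (D / real b ^ Suc k)"
      using bk generation_subset[of "Suc k" b] sumD[of ?G]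
      by (intro add_left_mono mult_left_mono divide_right_mono add_nonneg_nonneg) auto
    also have "\<dots> = \<tau> k"
    proof -
      have "t powr (1 - \<alpha>) * (1 / real b) ^ Suc k = (q\<^sup>2) ^ Suc k"
      proof -
        have "t powr (1 - \<alpha>) * (1 / real b) ^ Suc k = q powr (real (Suc k) * (1 - \<alpha>)) * q powr (real (Suc k) * (1 + \<alpha>))"
          unfolding qb[symmetric] t_def powr_realpow[OF q(1), symmetric]
          using q by (simp add: powr_powr mult.commute powr_realpow[symmetric] del: power_Suc)
        also have "\<dots> = q powr (real (2 * Suc k))" by (simp add: algebra_simps flip: powr_add)
        also have "\<dots> = (q\<^sup>2) ^ Suc k" using q by (simp only: powr_realpow power_mult)
        finally show ?thesis .
      qed
      moreover have "(x + y) * (D / real b ^ Suc k) = D * (x * (1 / real b) ^ Suc k) + D * y * (1 / real b) ^ Suc k" for x y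
        unfolding power_one_over by (simp only: algebra_simps times_divide_eq_right add_divide_distrib mult_1_right)
      ultimately show ?thesis unfolding \<tau>_def t_def[symmetric] by (simp only: add.assoc)
    qed
    finally show "gen_avg b (Suc k) (\<lambda>v. \<bar>h v\<bar>) \<le> \<tau> k" .
  qed
qed

text \<open>Level masses see finitely many coordinates, so pointwise convergence suffices; for
  \<open>tree_mass\<close> a uniform tail bound has to be added.\<close>

lemma tendsto_level_mass:
  assumes b: "b \<ge> 1" and A: "disjoint_interval_union r A" and "\<And>v. (\<lambda>j. h j v) \<longlonglongrightarrow> l v"
  shows "(\<lambda>j::nat. level_mass b A K (h j)) \<longlonglongrightarrow> level_mass b A K l"
proof -
  have "isCont (gauss_shift A) x" for x
    using gauss_shift_continuous[OF A] by (simp add: continuous_on_eq_continuous_at)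
  then show ?thesis unfolding level_mass_def gen_avg_def path_sum_def
    using b by (intro tendsto_sum tendsto_divide tendsto_const isCont_tendsto_compose[of _ "gauss_shift A"] assms)
      auto
qed

text \<open>Otherwise a pointwise limit of fields of cost at most \<open>c\<close>, with masses approaching \<open>p\<close>, would
  have mass at least \<open>p\<close> and cost at most \<open>c\<close>.\<close>

lemma cost_gt_near_level:
  assumes b: "b \<ge> 2" and A: "disjoint_interval_union r A" and \<alpha>: "\<alpha> > 0" and lam: "lam > 0" and c: "c \<ge> 0"
    and p: "measure std_normal_distribution A \<le> p" and less: "ereal c < rate b \<alpha> lam A p"
  shows "\<exists>\<epsilon>>0. \<forall>h. (\<forall>v. v \<notin> tree b - {[]} \<longrightarrow> h v = 0) \<longrightarrow>
    (\<forall>F. finite F \<longrightarrow> F \<subseteq> tree b - {[]} \<longrightarrow> lam * (\<Sum>v\<in>F. \<bar>h v\<bar> powr \<alpha>) \<le> c) \<longrightarrow>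
    tree_mass b A h < p - \<epsilon>"
proof (rule ccontr)
  assume contra: "\<not> ?thesis"
  have b1: "b \<ge> 1" using b by simp
  \<comment> \<open>Values off the tree are fixed at 0, which confines functions on all lists to a
    product of bounded intervals.\<close>
  define good where "good h \<longleftrightarrow> (\<forall>v. v \<notin> tree b - {[]} \<longrightarrow> h v = 0) \<and>
    (\<forall>F. finite F \<longrightarrow> F \<subseteq> tree b - {[]} \<longrightarrow> lam * (\<Sum>v\<in>F. \<bar>h v\<bar> powr \<alpha>) \<le> c)" for h :: "nat list \<Rightarrow> real"
  have contra': "\<not> (\<exists>\<epsilon>>0. \<forall>h. good h \<longrightarrow> tree_mass b A h < p - \<epsilon>)"
    using contra unfolding good_def imp_conjL .
  have "\<exists>h. good h \<and> p - 1 / real (Suc j) \<le> tree_mass b A h" for j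
  proof -
    have "1 / real (Suc j) > 0" by simp
    then show ?thesis using contra' not_less by blast
  qed
  then obtain h where h: "\<And>j. good (h j)" "\<And>j. p - 1 / real (Suc j) \<le> tree_mass b A (h j)" by metis
  obtain \<tau> where \<tau>: "summable \<tau>" and "\<And>h k. (\<And>F. finite F \<Longrightarrow> F \<subseteq> tree b - {[]} \<Longrightarrow> lam * (\<Sum>v\<in>F. \<bar>h v\<bar> powr \<alpha>) \<le> c) \<Longrightarrow>
      gen_avg b (Suc k) (\<lambda>v. \<bar>h v\<bar>) \<le> \<tau> k"
    using gen_avg_bound_if_cost_bounded[OF b \<alpha> lam c] by blast
  then have le_\<tau>: "gen_avg b (Suc k) (\<lambda>v. \<bar>h v\<bar>) \<le> \<tau> k" if "good h" for h k
    using that unfolding good_def by blast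
  have nonneg: "0 \<le> gen_avg b k (\<lambda>v. \<bar>h v\<bar>)" for k and h :: "nat list \<Rightarrow> real" by (rule gen_avg_nonneg) simp
  have sm: "summable (\<lambda>k. gen_avg b (Suc k) (\<lambda>v. \<bar>h v\<bar>))" if "good h" for h
    by (rule summable_comparison_test'[OF \<tau>, of 0]) (simp add: nonneg le_\<tau>[OF that])
  have approx: "\<bar>tree_mass b A h - level_mass b A K h\<bar> \<le> 2 * real r * (\<Sum>k. \<tau> (k + K))" if "good h" for h K
  proof -
    have "(\<Sum>k. gen_avg b (Suc (k + K)) (\<lambda>v. \<bar>h v\<bar>)) \<le> (\<Sum>k. \<tau> (k + K))"
      using summable_ignore_initial_segment[OF sm[OF that], of K] summable_ignore_initial_segment[OF \<tau>, of K] le_\<tau>[OF that]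
      by (intro suminf_le) auto
    then show ?thesis
      using tree_mass_approx[OF b1 A sm[OF that], of K] by (meson mult_left_mono of_nat_0_le_iff order_trans zero_le_mult_iff zero_le_numeral)
  qed
  define R where "R = (c / lam) powr (1 / \<alpha>)"
  have hR: "\<bar>f v\<bar> \<le> R" if "good f" for f v
  proof (cases "v \<in> tree b - {[]}")
    case True
    then have "\<bar>f v\<bar> powr \<alpha> \<le> c / lam" using that lam unfolding good_def
      by (auto dest!: spec[of _ "{v}"] simp: field_simps)
    then have "(\<bar>f v\<bar> powr \<alpha>) powr (1 / \<alpha>) \<le> R" unfolding R_def using \<alpha> by (intro powr_mono2) auto
    then show ?thesis using \<alpha> by (simp add: powr_powr)
  next
    case False
    then show ?thesis using that unfolding good_def by (simp add: R_def)
  qed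
  \<comment> \<open>Tychonoff for copies of [-R, R]. Lists are countable, so compactness yields
    convergent subsequences.\<close>
  have "compactin (product_topology (\<lambda>_. euclidean) UNIV) (PiE UNIV (\<lambda>_::nat list. {-R..R}))"
    by (subst compactin_PiE) auto
  then have "compact (PiE UNIV (\<lambda>_::nat list. {-R..R}))"
    unfolding euclidean_product_topology by simp
  then have "seq_compact (PiE UNIV (\<lambda>_::nat list. {-R..R}))"
    by (rule compact_imp_seq_compact)
  moreover have "h j \<in> PiE UNIV (\<lambda>_::nat list. {-R..R})" for j
    using hR[OF h(1)[of j]] by (auto simp: abs_le_iff minus_le_iff)
  ultimately obtain l \<sigma> where \<sigma>: "strict_mono \<sigma>" and lim: "(h \<circ> \<sigma>) \<longlonglongrightarrow> l"
    unfolding seq_compact_def by metis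
  have pt: "(\<lambda>j. h (\<sigma> j) v) \<longlonglongrightarrow> l v" for v
    using continuous_on_tendsto_compose[OF continuous_on_product_coordinates lim, of v] by (simp add: comp_def)
  have "good l" unfolding good_def
  proof (intro conjI allI impI)
    fix v :: "nat list" assume v: "v \<notin> tree b - {[]}"
    then have "h (\<sigma> j) v = 0" for j using h(1)[of "\<sigma> j"] unfolding good_def by blast
    then show "l v = 0" using pt[of v] LIMSEQ_unique[OF _ tendsto_const] by auto
  next
    fix F assume F: "finite F" "F \<subseteq> tree b - {[]}"
    have "(\<lambda>j. lam * (\<Sum>v\<in>F. \<bar>h (\<sigma> j) v\<bar> powr \<alpha>)) \<longlonglongrightarrow> lam * (\<Sum>v\<in>F. \<bar>l v\<bar> powr \<alpha>)"
      using \<alpha> by (intro tendsto_intros tendsto_powr' pt) auto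
    moreover have "\<forall>\<^sub>F j in sequentially. lam * (\<Sum>v\<in>F. \<bar>h (\<sigma> j) v\<bar> powr \<alpha>) \<le> c"
      using h(1) F unfolding good_def by (intro always_eventually) blast
    ultimately show "lam * (\<Sum>v\<in>F. \<bar>l v\<bar> powr \<alpha>) \<le> c"
      by (intro tendsto_upperbound) auto
  qed
  have "p \<le> tree_mass b A l"
  proof (rule ccontr)
    assume "\<not> p \<le> tree_mass b A l"
    define d where "d = p - tree_mass b A l"
    have d: "d > 0" using \<open>\<not> p \<le> tree_mass b A l\<close> by (simp add: d_def)
    have "(\<lambda>K. 2 * real r * (\<Sum>k. \<tau> (k + K))) \<longlonglongrightarrow> 2 * real r * 0"
      by (intro tendsto_intros suminf_exist_split2 \<tau>)
    \<comment> \<open>\<open>\<tau>\<close> dominates all fields of cost at most c, so one K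
      truncates the whole sequence and its limit alike.\<close>
    then obtain K where K: "2 * real r * (\<Sum>k. \<tau> (k + K)) < d / 4"
      using order_tendstoD(2)[of "\<lambda>K. 2 * real r * (\<Sum>k. \<tau> (k + K))" "2 * real r * 0" sequentially "d / 4"] d
      by (auto simp: eventually_sequentially)
    have "\<forall>\<^sub>F j in sequentially. \<bar>level_mass b A K (h (\<sigma> j)) - level_mass b A K l\<bar> < d / 4"
      using tendstoD[OF tendsto_level_mass[OF b1 A pt], of "d / 4"] d by (simp add: dist_real_def)
    moreover have "\<forall>\<^sub>F j in sequentially. 1 / real (Suc j) < d / 4"
      using order_tendstoD(2)[OF LIMSEQ_Suc[OF lim_1_over_n], of "d / 4"] d by simp
    ultimately have "\<forall>\<^sub>F j in sequentially. False"
    proof eventually_elim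
      case (elim j)
      have "1 / real (Suc (\<sigma> j)) \<le> 1 / real (Suc j)"
        using seq_suble[OF \<sigma>, of j] by (intro divide_left_mono) auto
      then have "p - d / 4 \<le> tree_mass b A (h (\<sigma> j))" using elim(2) h(2)[of "\<sigma> j"] by linarith
      moreover have "\<bar>tree_mass b A (h (\<sigma> j)) - level_mass b A K (h (\<sigma> j))\<bar> < d / 4"
        by (rule le_less_trans[OF approx[OF h(1)] K])
      moreover have "\<bar>tree_mass b A l - level_mass b A K l\<bar> < d / 4"
        by (rule le_less_trans[OF approx[OF \<open>good l\<close>] K])
      ultimately have "tree_mass b A (h (\<sigma> j)) < tree_mass b A l + d / 4 + d / 4 + d / 4" "p - d / 4 \<le> tree_mass b A (h (\<sigma> j))"
        using elim(1) by (simp_all only: abs_less_iff, linarith)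
      then show ?case unfolding d_def by (simp add: field_simps)
    qed
    then show False by simp
  qed
  moreover have l_ts: "l \<in> tree_space b"
    using \<open>good l\<close> sm[OF \<open>good l\<close>] by (intro tree_space_if_summable_gen_avg) (auto simp: good_def)
  ultimately have "rate b \<alpha> lam A p \<le> enn2ereal (tree_cost b \<alpha> lam l)"
    using b1 A \<alpha> lam p by (intro rate_le_tree_cost)
  also have "\<dots> \<le> enn2ereal (ennreal c)"
    using tree_cost_le_iff[OF lam c, of b \<alpha> l] \<open>good l\<close> unfolding good_def less_eq_ennreal.rep_eq[symmetric] by blast
  also have "\<dots> = ereal c" using c by simp
  finally show False using less by simp
qed

section \<open>Upper and lower bounds\<close>

text \<open>Includes x = 0, where the left side is -\<infinity>: a null event is harmless in an
  upper bound.\<close>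

lemma scaled_log_prob_le:
  assumes "n > 0" "0 \<le> x" "x \<le> exp (- (c * real n powr (\<alpha> / 2)))"
  shows "ereal (real n powr (- \<alpha> / 2)) * log_prob x \<le> ereal (- c)"
proof (cases "x = 0")
  case False
  have N: "real n powr (\<alpha> / 2) > 0" using assms by simp
  have "ln x \<le> ln (exp (- (c * real n powr (\<alpha> / 2))))"
    using assms False by (subst ln_le_cancel_iff) auto
  then have "ln x \<le> - (c * real n powr (\<alpha> / 2))" by simp
  then have "ln x / real n powr (\<alpha> / 2) \<le> - c" using N by (simp add: field_simps)
  then show ?thesis using False by (simp add: log_prob_def powr_minus_divide)
qed (use assms in \<open>simp add: log_prob_def\<close>)

lemma scaled_log_prob_ge:
  assumes "n > 0" "exp (- (c * real n powr (\<alpha> / 2))) \<le> x"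
  shows "ereal (- c) \<le> ereal (real n powr (- \<alpha> / 2)) * log_prob x"
proof -
  have N: "real n powr (\<alpha> / 2) > 0" using assms by simp
  have x: "x > 0" using assms by (meson exp_gt_zero less_le_trans)
  have "- (c * real n powr (\<alpha> / 2)) \<le> ln x" using assms x by (simp add: ln_ge_iff)
  then have "- c \<le> ln x / real n powr (\<alpha> / 2)" using N by (simp add: field_simps)
  then show ?thesis using x by (simp add: log_prob_def powr_minus_divide)
qed

context walk_in_set
begin

lemma speed_at_top: "filterlim (\<lambda>n::nat. real n powr (\<alpha> / 2)) at_top sequentially"
  using \<alpha>_pos by real_asymp

text \<open>The test field consists of the rescaled displacements of the first K generations,
  continued by 0. Its truncation error vanishes, so its \<open>tree_mass\<close> is exactly
  \<open>mass_at\<close>; too small a cost would then contradict the assumption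
  \<open>cost\<close>.\<close>

lemma mass_at_ge_imp_cost:
  assumes n: "n > 0" and c: "c \<ge> 0"
    and cost: "\<And>h. (\<forall>v. v \<notin> tree b - {[]} \<longrightarrow> h v = 0) \<Longrightarrow>
      (\<forall>F. finite F \<longrightarrow> F \<subseteq> tree b - {[]} \<longrightarrow> lam * (\<Sum>v\<in>F. \<bar>h v\<bar> powr \<alpha>) \<le> c) \<Longrightarrow> tree_mass b A h < q"
    and q: "q \<le> mass_at n K w"
  shows "c / lam * real n powr (\<alpha> / 2) \<le> (\<Sum>v\<in>levels b K. \<bar>Y v w\<bar> powr \<alpha>)"
proof (rule ccontr)
  assume "\<not> ?thesis"
  then have less: "(\<Sum>v\<in>levels b K. \<bar>Y v w\<bar> powr \<alpha>) < c / lam * real n powr (\<alpha> / 2)" by simp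
  define h where "h v = (if v \<in> levels b K then Y v w / sqrt (real n) else 0)" for v
  have N: "real n powr (\<alpha> / 2) > 0" using n by simp
  have hv: "\<bar>h v\<bar> powr \<alpha> = \<bar>Y v w\<bar> powr \<alpha> / real n powr (\<alpha> / 2)" if "v \<in> levels b K" for v
    using that n by (simp add: h_def abs_divide powr_divide powr_half_sqrt[symmetric] powr_powr)
  have "lam * (\<Sum>v\<in>F. \<bar>h v\<bar> powr \<alpha>) \<le> c" if F: "finite F" for F
  proof -
    have "(\<Sum>v\<in>F. \<bar>h v\<bar> powr \<alpha>) = (\<Sum>v\<in>F \<inter> levels b K. \<bar>h v\<bar> powr \<alpha>)"
      using F by (intro sum.mono_neutral_right) (auto simp: h_def)
    also have "\<dots> \<le> (\<Sum>v\<in>levels b K. \<bar>h v\<bar> powr \<alpha>)"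
      by (intro sum_mono2) auto
    also have "\<dots> = (\<Sum>v\<in>levels b K. \<bar>Y v w\<bar> powr \<alpha>) / real n powr (\<alpha> / 2)"
      by (simp add: hv sum_divide_distrib)
    also have "\<dots> \<le> c / lam" using less N by (simp add: field_simps)
    finally show ?thesis using lam_pos by (simp add: field_simps)
  qed
  moreover have "h v = 0" if "v \<notin> tree b - {[]}" for v using that levels_subset[of b K] by (auto simp: h_def)
  ultimately have "tree_mass b A h < q" by (intro cost) auto
  moreover have "tree_mass b A h = mass_at n K w"
  proof -
    have zero: "gen_avg b (Suc k) (\<lambda>v. \<bar>h v\<bar>) = 0" if "k \<ge> K" for k
      using that by (auto simp: gen_avg_def h_def levels_def generation_def intro!: sum.neutral)
    have "summable (\<lambda>k. gen_avg b (Suc k) (\<lambda>v. \<bar>h v\<bar>))"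
      by (rule summable_finite[of "{..<K}"]) (auto simp: zero)
    from tree_mass_approx[OF b_ge_1 A this, of K] have "tree_mass b A h = level_mass b A K h"
      by (simp add: zero)
    also have "\<dots> = mass_at n K w"
      unfolding mass_at_def level_mass_def
      by (intro gen_avg_cong arg_cong[where f="gauss_shift A"] path_sum_cong) (auto simp: h_def intro: prefix_in_levels)
    finally show ?thesis .
  qed
  ultimately show False using q by simp
qed

text \<open>A mass of at least p requires that the reduction to K generations fails, or that the
  first K generations have cost at least c'. The gap \<epsilon> comes from
  \<open>cost_gt_near_level\<close> and is fixed before K, so K may depend on it.\<close>

lemma upper_bound:
  assumes p: "measure std_normal_distribution A \<le> p" and c: "0 \<le> c" "ereal c < rate b \<alpha> lam A p"
  shows "\<forall>\<^sub>F n in sequentially.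
    prob {w \<in> space M. p \<le> empirical n w} \<le> exp (- (c * real n powr (\<alpha> / 2)))"
proof -
  obtain c' where c': "c < c'" "ereal c' < rate b \<alpha> lam A p"
    using ereal_dense2[OF c(2)] by auto
  obtain \<epsilon> where \<epsilon>: "\<epsilon> > 0" and cost: "\<And>h. (\<forall>v. v \<notin> tree b - {[]} \<longrightarrow> h v = 0) \<Longrightarrow>
      (\<forall>F. finite F \<longrightarrow> F \<subseteq> tree b - {[]} \<longrightarrow> lam * (\<Sum>v\<in>F. \<bar>h v\<bar> powr \<alpha>) \<le> c') \<Longrightarrow> tree_mass b A h < p - \<epsilon>"
    using cost_gt_near_level[OF b_ge A \<alpha>_pos lam_pos _ p c'(2)] c c'(1) by auto
  obtain K where K: "\<forall>\<^sub>F n in sequentially.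
      prob {w \<in> space M. \<epsilon> < \<bar>empirical n w - mass_at n K w\<bar>} \<le> exp (- ((c + 1) * real n powr (\<alpha> / 2)))"
    using empirical_approx[OF \<epsilon>, of "c + 1"] c by auto
  \<comment> \<open>Makes s c' / lam the midpoint of c and c'. Then s < lam, as Chernoff's bound
    requires, and the rate exceeds c strictly, which absorbs the constant prefactor.\<close>
  define s where "s = lam * ((c + c') / 2) / c'"
  have "0 < c'" using c c'(1) by simp
  have "lam * ((c + c') / 2) < lam * c'" using c'(1) lam_pos by (intro mult_strict_left_mono) auto
  then have s: "0 < s" "s < lam" "s * (c' / lam) = (c + c') / 2"
    unfolding s_def using \<open>0 < c'\<close> c lam_pos
    by (intro divide_pos_pos mult_pos_pos, auto simp: pos_divide_less_eq)
  obtain C where C: "C \<ge> 1" "\<And>J t. finite J \<Longrightarrow> J \<subseteq> tree b - {[]} \<Longrightarrow>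
      prob {w \<in> space M. (\<Sum>v\<in>J. \<bar>Y v w\<bar> powr \<alpha>) \<ge> t} \<le> C ^ card J * exp (- (s * t))"
    using chernoff[OF s(1,2)] by blast
  have "\<forall>\<^sub>F t in at_top. exp (- ((c + 1) * t)) + C ^ card (levels b K) * exp (- ((c + c') / 2 * t)) \<le> exp (- (c * t))"
    using c' by (intro exp_sum_le_eventually) auto
  from filterlim_iff[THEN iffD1, OF speed_at_top, rule_format, OF this]
  show ?thesis using K eventually_gt_at_top[of 0]
  proof eventually_elim
    case (elim n)
    let ?N = "real n powr (\<alpha> / 2)"
    let ?B = "{w \<in> space M. (\<Sum>v\<in>levels b K. \<bar>Y v w\<bar> powr \<alpha>) \<ge> c' / lam * ?N}"
    let ?E = "{w \<in> space M. \<epsilon> < \<bar>empirical n w - mass_at n K w\<bar>}"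
    note [measurable] = empirical_measurable[OF elim(3)]
    have [measurable]: "Y v \<in> borel_measurable M" if "v \<in> levels b K" for v
      using that levels_subset[of b K] Y_borel by auto
    have "{w \<in> space M. p \<le> empirical n w} \<subseteq> ?E \<union> ?B"
    proof safe
      fix w assume w: "w \<in> space M" "p \<le> empirical n w" and nB: "\<not> c' / lam * ?N \<le> (\<Sum>v\<in>levels b K. \<bar>Y v w\<bar> powr \<alpha>)"
      have "\<not> p - \<epsilon> \<le> mass_at n K w"
        using mass_at_ge_imp_cost[OF elim(3) _ cost, where K=K and w=w] nB c c'(1) by auto
      then show "\<epsilon> < \<bar>empirical n w - mass_at n K w\<bar>" using w by linarith
    qed
    then have "prob {w \<in> space M. p \<le> empirical n w} \<le> prob (?E \<union> ?B)"
      by (intro finite_measure_mono) auto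
    also have "\<dots> \<le> prob ?E + prob ?B" by (intro measure_Un_le) auto
    also have "prob ?B \<le> C ^ card (levels b K) * exp (- (s * (c' / lam * ?N)))"
      by (intro C(2) levels_subset) auto
    also have "s * (c' / lam * ?N) = (c + c') / 2 * ?N" using s(3) by (metis mult.assoc)
    finally show ?case using elim(1,2) by linarith
  qed
qed

text \<open>Independence gives a product of finitely many one-vertex probabilities, whose lower
  bounds hold simultaneously for large n. \<open>K \<ge> 1\<close> makes the index set of the
  intersection nonempty.\<close>

lemma prob_levels_close:
  assumes K: "K \<ge> 1" and \<delta>: "\<delta> > 0"
  shows "\<forall>\<^sub>F n in sequentially.
    exp (- (lam * (\<Sum>v\<in>levels b K. (\<bar>h v\<bar> + \<delta>) powr \<alpha>) * real n powr (\<alpha> / 2))) \<le>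
    prob {w \<in> space M. \<forall>v\<in>levels b K. \<bar>Y v w - sqrt (real n) * h v\<bar> < sqrt (real n) * \<delta>}"
proof -
  have "replicate 1 1 \<in> levels b K" using K b_ge by (auto simp: levels_def tree_def)
  then have ne: "levels b K \<noteq> {}" by auto
  have "\<forall>\<^sub>F n in sequentially. \<forall>v\<in>levels b K. exp (- (lam * (\<bar>h v\<bar> + \<delta>) powr \<alpha> * real n powr (\<alpha> / 2))) \<le>
     measure N {w \<in> space N. \<bar>X w - sqrt (real n) * h v\<bar> < sqrt (real n) * \<delta>}"
    by (intro eventually_ball_finite ballI local_lower_bound \<delta>) auto
  then show ?thesis
  proof eventually_elim
    case (elim n)
    define S where "S v = {x. \<bar>x - sqrt (real n) * h v\<bar> < sqrt (real n) * \<delta>}" for v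
    have S: "S v \<in> sets borel" for v unfolding S_def by measurable
    have "exp (- (lam * (\<Sum>v\<in>levels b K. (\<bar>h v\<bar> + \<delta>) powr \<alpha>) * real n powr (\<alpha> / 2))) =
        (\<Prod>v\<in>levels b K. exp (- (lam * (\<bar>h v\<bar> + \<delta>) powr \<alpha> * real n powr (\<alpha> / 2))))"
      by (simp add: exp_sum[symmetric] sum_negf sum_distrib_left sum_distrib_right)
    also have "\<dots> \<le> (\<Prod>v\<in>levels b K. prob (Y v -` S v \<inter> space M))"
    proof (intro prod_mono conjI)
      fix v assume v: "v \<in> levels b K"
      have "prob (Y v -` S v \<inter> space M) = measure N {w \<in> space N. X w \<in> S v}"
        using v levels_subset[of b K] by (intro prob_Y S) auto
      then show "exp (- (lam * (\<bar>h v\<bar> + \<delta>) powr \<alpha> * real n powr (\<alpha> / 2))) \<le> prob (Y v -` S v \<inter> space M)"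
        using elim v by (simp add: S_def)
    qed simp
    also have "\<dots> = prob (\<Inter>v\<in>levels b K. Y v -` S v \<inter> space M)"
      using ne levels_subset S by (intro indep_varsD[OF indep_Y, symmetric]) auto
    also have "(\<Inter>v\<in>levels b K. Y v -` S v \<inter> space M) =
        {w \<in> space M. \<forall>v\<in>levels b K. \<bar>Y v w - sqrt (real n) * h v\<bar> < sqrt (real n) * \<delta>}"
      using ne by (auto simp: S_def)
    finally show ?case .
  qed
qed

text \<open>Following h within \<delta> forces \<open>mass_at\<close> above p + 2\<epsilon>, so the
  level p is missed only if the reduction to K generations fails. That failure has rate c' + 1 and
  is negligible against the price of following h.\<close>

lemma lower_bound:
  assumes h: "h \<in> tree_space b" and mass: "p < tree_mass b A h"
    and cost: "tree_cost b \<alpha> lam h \<le> ennreal c" and c: "0 \<le> c" "c < c'"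
  shows "\<forall>\<^sub>F n in sequentially.
    exp (- (c' * real n powr (\<alpha> / 2))) \<le> prob {w \<in> space M. p \<le> empirical n w}"
proof -
  \<comment> \<open>A quarter of the surplus: one part for truncating h, one for the deviation
    \<delta>, one for the deep generations, one to spare.\<close>
  define \<epsilon> where "\<epsilon> = (tree_mass b A h - p) / 4"
  have \<epsilon>: "\<epsilon> > 0" using mass by (simp add: \<epsilon>_def)
  define B where "B = 2 * real r + 1"
  have B: "B > 0" by (simp add: B_def add_nonneg_pos)
  note sm = summable_gen_avg_if_tree_space[OF h]
  have "(\<lambda>K. 2 * real r * (\<Sum>k. gen_avg b (Suc (k + K)) (\<lambda>v. \<bar>h v\<bar>))) \<longlonglongrightarrow> 2 * real r * 0"
    by (intro tendsto_intros suminf_exist_split2[OF sm])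
  then have "\<forall>\<^sub>F K in sequentially. 2 * real r * (\<Sum>k. gen_avg b (Suc (k + K)) (\<lambda>v. \<bar>h v\<bar>)) < \<epsilon>"
    by (rule order_tendstoD) (simp add: \<epsilon>)
  then obtain K1 where K1: "\<And>K. K \<ge> K1 \<Longrightarrow> 2 * real r * (\<Sum>k. gen_avg b (Suc (k + K)) (\<lambda>v. \<bar>h v\<bar>)) < \<epsilon>"
    unfolding eventually_sequentially by blast
  obtain K0 where K0: "\<And>K. K \<ge> K0 \<Longrightarrow> \<forall>\<^sub>F n in sequentially.
      prob {w \<in> space M. \<epsilon> < \<bar>empirical n w - mass_at n K w\<bar>} \<le> exp (- ((c' + 1) * real n powr (\<alpha> / 2)))"
    using empirical_approx[OF \<epsilon>, of "c' + 1"] c by auto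
  define K where "K = max 1 (max K0 K1)"
  have K: "K \<ge> 1" "K \<ge> K0" "K \<ge> K1" by (auto simp: K_def)
  have level: "\<bar>tree_mass b A h - level_mass b A K h\<bar> < \<epsilon>"
    using tree_mass_approx[OF b_ge_1 A sm, of K] K1[OF K(3)] by linarith
  define c2 where "c2 = (c + c') / 2"
  have c2: "c < c2" "c2 < c'" using c by (auto simp: c2_def)
  have le_c: "lam * (\<Sum>v\<in>levels b K. \<bar>h v\<bar> powr \<alpha>) \<le> c"
    using cost tree_cost_le_iff[OF lam_pos c(1), of b \<alpha> h] levels_subset[of b K] by simp
  \<comment> \<open>Taken from the right, which keeps the bases nonnegative even at vertices where h
    vanishes.\<close>
  have lim: "((\<lambda>\<delta>. lam * (\<Sum>v\<in>levels b K. (\<bar>h v\<bar> + \<delta>) powr \<alpha>)) \<longlongrightarrow> lam * (\<Sum>v\<in>levels b K. (\<bar>h v\<bar> + 0) powr \<alpha>)) (at_right 0)"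
    using \<alpha>_pos by (intro tendsto_intros tendsto_powr2) (auto simp: eventually_at_filter)
  have "\<forall>\<^sub>F \<delta> in at_right 0. lam * (\<Sum>v\<in>levels b K. (\<bar>h v\<bar> + \<delta>) powr \<alpha>) < c2"
    by (rule order_tendstoD(2)[OF lim]) (use le_c c2 in simp)
  moreover have "\<forall>\<^sub>F \<delta> in at_right 0. B * (real K * \<delta>) < \<epsilon>"
  proof (rule order_tendstoD(2))
    show "((\<lambda>\<delta>. B * (real K * \<delta>)) \<longlongrightarrow> B * (real K * 0)) (at_right 0)" by (intro tendsto_intros)
  qed (simp add: \<epsilon>)
  moreover have "\<forall>\<^sub>F \<delta> in at_right (0::real). \<delta> > 0" by (auto simp: eventually_at_filter)
  ultimately have "\<forall>\<^sub>F \<delta> in at_right 0. \<delta> > 0 \<and> lam * (\<Sum>v\<in>levels b K. (\<bar>h v\<bar> + \<delta>) powr \<alpha>) < c2 \<and> B * (real K * \<delta>) < \<epsilon>"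
    by eventually_elim simp
  then obtain \<delta> where \<delta>: "\<delta> > 0" "lam * (\<Sum>v\<in>levels b K. (\<bar>h v\<bar> + \<delta>) powr \<alpha>) < c2" "B * (real K * \<delta>) < \<epsilon>"
    using eventually_happens'[of "at_right (0::real)"] by auto
  \<comment> \<open>To be read as a subtraction: exp (- c2 t) minus the failure probability is still
    at least exp (- c' t).\<close>
  have "\<forall>\<^sub>F t in at_top. exp (- ((c' + 1) * t)) + 1 * exp (- (c' * t)) \<le> exp (- (c2 * t))"
    using c2 by (intro exp_sum_le_eventually) auto
  from filterlim_iff[THEN iffD1, OF speed_at_top, rule_format, OF this]
  show ?thesis using K0[OF K(2)] prob_levels_close[OF K(1) \<delta>(1), of h] eventually_gt_at_top[of 0]
  proof eventually_elim
    case (elim n)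
    let ?N = "real n powr (\<alpha> / 2)"
    let ?G = "{w \<in> space M. \<forall>v\<in>levels b K. \<bar>Y v w - sqrt (real n) * h v\<bar> < sqrt (real n) * \<delta>}"
    let ?E = "{w \<in> space M. \<epsilon> < \<bar>empirical n w - mass_at n K w\<bar>}"
    note [measurable] = empirical_measurable[OF elim(4)]
    have rn: "sqrt (real n) > 0" using elim(4) by simp
    have "?G \<subseteq> ?E \<union> {w \<in> space M. p \<le> empirical n w}"
    proof safe
      fix w assume w: "w \<in> space M" and close: "\<forall>v\<in>levels b K. \<bar>Y v w - sqrt (real n) * h v\<bar> < sqrt (real n) * \<delta>"
        and emp: "\<not> p \<le> empirical n w"
      have close': "\<bar>Y v w / sqrt (real n) - h v\<bar> \<le> \<delta>" if v: "v \<in> levels b K" for v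
      proof -
        have "Y v w / sqrt (real n) - h v = (Y v w - sqrt (real n) * h v) / sqrt (real n)"
          using rn by (simp add: diff_divide_distrib)
        then have "\<bar>Y v w / sqrt (real n) - h v\<bar> = \<bar>Y v w - sqrt (real n) * h v\<bar> / sqrt (real n)"
          using rn by (simp only: abs_divide abs_of_pos)
        also have "\<dots> \<le> \<delta>" using close v rn by (simp add: field_simps less_imp_le)
        finally show ?thesis .
      qed
      have "\<bar>mass_at n K w - level_mass b A K h\<bar> \<le> B * (real K * \<delta>)"
        unfolding mass_at_def level_mass_def
      proof (rule abs_gen_avg_diff_le[OF b_ge_1])
        fix u assume u: "u \<in> generation b K"
        have "\<bar>path_sum (\<lambda>v. Y v w / sqrt (real n)) u - path_sum h u\<bar> \<le> real (length u) * \<delta>"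
          unfolding path_sum_diff[symmetric]
          by (rule abs_path_sum_le) (auto intro!: close' prefix_in_levels[OF u])
        then have "B * \<bar>path_sum (\<lambda>v. Y v w / sqrt (real n)) u - path_sum h u\<bar> \<le> B * (real K * \<delta>)"
          using u B by (intro mult_left_mono) (auto simp: generation_def)
        then show "\<bar>gauss_shift A (path_sum (\<lambda>v. Y v w / sqrt (real n)) u) - gauss_shift A (path_sum h u)\<bar> \<le> B * (real K * \<delta>)"
          unfolding B_def by (rule order_trans[OF gauss_shift_A_lipschitz])
      qed
      then have "tree_mass b A h - 2 * \<epsilon> < mass_at n K w" using \<delta>(3) level by linarith
      moreover have "\<epsilon> * 4 = tree_mass b A h - p" unfolding \<epsilon>_def by (rule nonzero_eq_divide_eq[THEN iffD1]) simp_all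
      ultimately show "\<epsilon> < \<bar>empirical n w - mass_at n K w\<bar>" using emp \<epsilon> by linarith
    qed
    then have "prob ?G \<le> prob (?E \<union> {w \<in> space M. p \<le> empirical n w})"
      by (intro finite_measure_mono) auto
    also have "\<dots> \<le> prob ?E + prob {w \<in> space M. p \<le> empirical n w}" by (intro measure_Un_le) auto
    finally have "prob ?G \<le> prob ?E + prob {w \<in> space M. p \<le> empirical n w}" .
    moreover have "exp (- (c2 * ?N)) \<le> prob ?G"
    proof -
      have "exp (- (c2 * ?N)) \<le> exp (- (lam * (\<Sum>v\<in>levels b K. (\<bar>h v\<bar> + \<delta>) powr \<alpha>) * ?N))"
        using \<delta>(2) by (simp add: mult_right_mono)
      then show ?thesis using elim(3) by linarith
    qed
    ultimately show ?case using elim(1,2) by linarith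
  qed
qed

end

section \<open>From eventual exponential bounds to liminf and limsup\<close>

theorem theorem1p2:
  fixes b :: nat and \<alpha> lam :: real
    and N :: "'v measure" and X :: "'v \<Rightarrow> real"
    and M :: "'w measure" and Y :: "nat list \<Rightarrow> 'w \<Rightarrow> real"
    and A :: "real set" and rA :: nat and p :: real
  assumes "b \<ge> 2" and "\<alpha> > 0" and "lam > 0"
    and "prob_space N" and "X \<in> borel_measurable N"
    and symmetric: "distr N borel (\<lambda>w. - X w) = distr N borel X"
    and mean: "integrable N X" "(LINT w|N. X w) = 0"
    and variance: "integrable N (\<lambda>w. (X w)\<^sup>2)" "(LINT w|N. (X w)\<^sup>2) = 1"
    and tail: "((\<lambda>x::real. ereal (x powr (- \<alpha>)) * log_prob (measure N {w \<in> space N. X w > x}))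
                 \<longlongrightarrow> ereal (- lam)) at_top"
    and "prob_space M" and "iid_copies M (tree b - {[]}) Y N X"
    and "A \<noteq> {}" and "A \<noteq> UNIV" and "rA \<ge> 1" and "disjoint_interval_union rA A"
    and "p \<in> {measure std_normal_distribution A <..< gauss_max A}"
  defines "a \<equiv> (\<lambda>n::nat. ereal (real n powr (- \<alpha> / 2)) *
             log_prob (measure M {w \<in> space M. brw_empirical b Y n w ((\<lambda>a. sqrt (real n) * a) ` A) \<ge> p}))"
  shows "- rate_right b \<alpha> lam A p \<le> liminf a
       \<and> liminf a \<le> limsup a
       \<and> limsup a \<le> - rate b \<alpha> lam A p
       \<and> (rate_right b \<alpha> lam A p = rate b \<alpha> lam A p \<longrightarrow> a \<longlonglongrightarrow> - rate b \<alpha> lam A p)"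
proof -
  interpret walk_in_set M b \<alpha> lam N X Y A rA
    using assms by (auto simp: walk_in_set_def walk_in_set_axioms_def branching_walk_def branching_walk_axioms_def)
  have a_eq: "a n = ereal (real n powr (- \<alpha> / 2)) * log_prob (prob {w \<in> space M. p \<le> empirical n w})" for n
    by (simp add: a_def empirical_def)
  have p: "measure std_normal_distribution A \<le> p" using assms by simp
  have lower: "- rate_right b \<alpha> lam A p \<le> liminf a"
  proof (rule ccontr)
    assume "\<not> ?thesis"
    then obtain z where z: "liminf a < ereal z" "ereal z < - rate_right b \<alpha> lam A p"
      using ereal_dense2[of "liminf a"] by (auto simp: not_le)
    then have "rate_right b \<alpha> lam A p < ereal (- z)"
      by (metis ereal_less_uminus_reorder uminus_ereal.simps(1))
    \<comment> \<open>The infimum over q > p supplies a field of mass strictly above p; this surplus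
      is what \<open>lower_bound\<close> consumes.\<close>
    then obtain q where q: "q > p" "rate b \<alpha> lam A q < ereal (- z)"
      unfolding rate_right_eq_INF[OF b_ge_1 A \<alpha>_pos lam_pos p] by (auto simp: INF_less_iff)
    then obtain h where h: "h \<in> tree_space b" "tree_mass b A h = q" "enn2ereal (tree_cost b \<alpha> lam h) < ereal (- z)"
      unfolding rate_def by (auto simp: INF_less_iff)
    obtain c where c: "tree_cost b \<alpha> lam h = ennreal c" "0 \<le> c" "c < - z"
      using h(3) by (cases "tree_cost b \<alpha> lam h" rule: ennreal_cases) auto
    have "\<forall>\<^sub>F n in sequentially. ereal (- (- z)) \<le> a n"
    proof -
      have "\<forall>\<^sub>F n in sequentially. exp (- (- z * real n powr (\<alpha> / 2))) \<le> prob {w \<in> space M. p \<le> empirical n w}"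
        using h(2) q(1) c(1) by (intro lower_bound[OF h(1) _ _ c(2,3)]) auto
      then show ?thesis using eventually_gt_at_top[of 0]
        unfolding a_eq by eventually_elim (rule scaled_log_prob_ge)
    qed
    then have "ereal z \<le> liminf a" by (intro Liminf_bounded) simp
    then show False using z(1) by simp
  qed
  have upper: "limsup a \<le> - rate b \<alpha> lam A p"
  proof (rule ccontr)
    assume "\<not> ?thesis"
    then obtain z where z: "- rate b \<alpha> lam A p < ereal z" "ereal z < limsup a"
      using ereal_dense2[of "- rate b \<alpha> lam A p"] by (auto simp: not_le)
    \<comment> \<open>\<open>upper_bound\<close> takes a nonnegative rate. For z > 0 the trivial
      bound 1 on probabilities gives limsup at most 0, which is enough.\<close>
    have "\<forall>\<^sub>F n in sequentially. a n \<le> ereal (- max 0 (- z))"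
    proof (cases "z \<le> 0")
      case True
      have mz: "max 0 (- z) = - z" using True by simp
      have "ereal (- z) < rate b \<alpha> lam A p"
        using z(1) by (metis ereal_uminus_less_reorder uminus_ereal.simps(1))
      then have "\<forall>\<^sub>F n in sequentially. prob {w \<in> space M. p \<le> empirical n w} \<le> exp (- (- z * real n powr (\<alpha> / 2)))"
        using True by (intro upper_bound[OF p]) auto
      then show ?thesis using eventually_gt_at_top[of 0]
        unfolding a_eq mz by eventually_elim (rule scaled_log_prob_le, auto)
    next
      case False
      then have "max 0 (- z) = 0" by simp
      then show ?thesis unfolding a_eq
        by (intro eventually_mono[OF eventually_gt_at_top[of 0]]) (simp only:, rule scaled_log_prob_le, auto)
    qed
    then have "limsup a \<le> ereal (- max 0 (- z))" by (rule Limsup_bounded)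
    also have "\<dots> \<le> ereal z" by simp
    finally show False using z(2) by simp
  qed
  have le: "liminf a \<le> limsup a" by (rule Liminf_le_Limsup) simp
  have "a \<longlonglongrightarrow> - rate b \<alpha> lam A p" if "rate_right b \<alpha> lam A p = rate b \<alpha> lam A p"
    using lower upper le that by (intro Liminf_eq_Limsup) (auto intro: antisym)
  then show ?thesis using lower upper le by blast
qed

end
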